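(* For every $n\ge1$, the group $nV$ has property FA: every simplicial action of $nV$ on a simplicial tree without edge inversions has a global fixed point. In particular, the number of ends of $nV$ is $e(nV)=1$.
   Context: $nV$ denotes Brin's $n$-dimensional Thompson group: with $I=[0,1)$, dyadic rectangles in $I^n$ are obtained from $I^n$ by repeatedly halving in one coordinate; a pattern is a finite set of pairwise disjoint dyadic rectangles with union $I^n$; for numbered patterns $P=(P_i)_{i<r}$, $Q=(Q_i)_{i<r}$, $g(P,Q)$ maps each $P_i$ onto $Q_i$ by a map $(x_k)_k\mapsto(a_k+2^{j_k}x_k)_k$; $nV$ is the group of all such maps (equivalently a group of homeomorphisms of $C^n$, $C$ the Cantor set). It is finitely generated. For a finitely generated group $G$ with finite generating set $S$, $e(G)$ is the number of ends of the Cayley graph $\Gamma_{G,S}$, i.e. the supremum over finite subgraphs $K$ of the number of unbounded connected components of $\Gamma_{G,S}-K$; it does not depend on $S$. *)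

theory Defs
  imports Complex_Main "HOL-Algebra.Group_Action" "HOL-Algebra.Generated_Groups" "HOL-Library.Extended_Nat"
begin

text \<open>Points of I^n are modelled as functions nat => real whose coordinates k < n
lie in [0,1) and whose coordinates k >= n are 0.\<close>

definition cube :: "nat \<Rightarrow> (nat \<Rightarrow> real) set" where
  "cube n = {x. (\<forall>k<n. 0 \<le> x k \<and> x k < 1) \<and> (\<forall>k\<ge>n. x k = 0)}"

text \<open>A rectangle is described by its lower corner a and the exponents j:
  rect n (a,j) = prod_{k<n} [a k, a k + 2^-(j k)).\<close>

type_synonym rdata = "(nat \<Rightarrow> real) \<times> (nat \<Rightarrow> nat)"

definition rect :: "nat \<Rightarrow> rdata \<Rightarrow> (nat \<Rightarrow> real) set" where
  "rect n R = {x \<in> cube n. \<forall>k<n. fst R k \<le> x k \<and> x k < fst R k + (1/2) ^ (snd R k)}"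

inductive dyadic :: "nat \<Rightarrow> rdata \<Rightarrow> bool" for n where
  whole: "dyadic n (\<lambda>_. 0, \<lambda>_. 0)"
| lower: "dyadic n (a, j) \<Longrightarrow> k < n \<Longrightarrow> dyadic n (a, j(k := Suc (j k)))"
| upper: "dyadic n (a, j) \<Longrightarrow> k < n \<Longrightarrow>
           dyadic n (a(k := a k + (1/2) ^ Suc (j k)), j(k := Suc (j k)))"

definition numbered_pattern :: "nat \<Rightarrow> rdata list \<Rightarrow> bool" where
  "numbered_pattern n P \<longleftrightarrow>
     (\<forall>i<length P. dyadic n (P ! i)) \<and>
     (\<forall>i<length P. \<forall>i'<length P. i \<noteq> i' \<longrightarrow> rect n (P ! i) \<inter> rect n (P ! i') = {}) \<and>
     (\<Union>i<length P. rect n (P ! i)) = cube n"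

definition rect_map :: "nat \<Rightarrow> rdata \<Rightarrow> rdata \<Rightarrow> (nat \<Rightarrow> real) \<Rightarrow> (nat \<Rightarrow> real)" where
  "rect_map n R R' x = (\<lambda>k. if k < n
       then fst R' k + (2 powr (real_of_int (int (snd R k) - int (snd R' k)))) * (x k - fst R k)
       else x k)"

text \<open>g(P,Q), extended by the identity outside I^n (so that nV is a group under composition).\<close>

definition nV_set :: "nat \<Rightarrow> ((nat \<Rightarrow> real) \<Rightarrow> (nat \<Rightarrow> real)) set" where
  "nV_set n = {g. \<exists>P Q. numbered_pattern n P \<and> numbered_pattern n Q \<and> length P = length Q \<and>
       (\<forall>i<length P. \<forall>x \<in> rect n (P ! i). g x = rect_map n (P ! i) (Q ! i) x) \<and>
       (\<forall>x. x \<notin> cube n \<longrightarrow> g x = x)}"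

definition nV :: "nat \<Rightarrow> ((nat \<Rightarrow> real) \<Rightarrow> (nat \<Rightarrow> real)) monoid" where
  "nV n = \<lparr>carrier = nV_set n, mult = (\<lambda>f g. f \<circ> g), one = id\<rparr>"

text \<open>Walks in a graph given by an adjacency relation E: nonempty vertex lists with
consecutive entries adjacent; length of the walk is length xs - 1.\<close>

definition walk :: "('v \<Rightarrow> 'v \<Rightarrow> bool) \<Rightarrow> 'v list \<Rightarrow> bool" where
  "walk E xs \<longleftrightarrow> xs \<noteq> [] \<and> (\<forall>i. Suc i < length xs \<longrightarrow> E (xs ! i) (xs ! Suc i))"

definition simple_graph :: "'v set \<Rightarrow> ('v \<Rightarrow> 'v \<Rightarrow> bool) \<Rightarrow> bool" where
  "simple_graph V E \<longleftrightarrow> (\<forall>u v. E u v \<longrightarrow> u \<in> V \<and> v \<in> V \<and> E v u \<and> u \<noteq> v)"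

definition connected_graph :: "'v set \<Rightarrow> ('v \<Rightarrow> 'v \<Rightarrow> bool) \<Rightarrow> bool" where
  "connected_graph V E \<longleftrightarrow>
     (\<forall>u\<in>V. \<forall>v\<in>V. \<exists>xs. walk E xs \<and> hd xs = u \<and> last xs = v)"

definition has_cycle :: "('v \<Rightarrow> 'v \<Rightarrow> bool) \<Rightarrow> bool" where
  "has_cycle E \<longleftrightarrow> (\<exists>xs. length xs \<ge> 3 \<and> distinct xs \<and> walk E xs \<and> E (last xs) (hd xs))"

definition simplicial_tree :: "'v set \<Rightarrow> ('v \<Rightarrow> 'v \<Rightarrow> bool) \<Rightarrow> bool" where
  "simplicial_tree V E \<longleftrightarrow> V \<noteq> {} \<and> simple_graph V E \<and> connected_graph V E \<and> \<not> has_cycle E"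

definition simplicial_action ::
  "('g, 'b) monoid_scheme \<Rightarrow> 'v set \<Rightarrow> ('v \<Rightarrow> 'v \<Rightarrow> bool) \<Rightarrow> ('g \<Rightarrow> 'v \<Rightarrow> 'v) \<Rightarrow> bool" where
  "simplicial_action G V E \<phi> \<longleftrightarrow> group_action G V \<phi> \<and>
     (\<forall>g\<in>carrier G. \<forall>u\<in>V. \<forall>v\<in>V. E (\<phi> g u) (\<phi> g v) \<longleftrightarrow> E u v)"

definition without_inversions ::
  "('g, 'b) monoid_scheme \<Rightarrow> ('v \<Rightarrow> 'v \<Rightarrow> bool) \<Rightarrow> ('g \<Rightarrow> 'v \<Rightarrow> 'v) \<Rightarrow> bool" where
  "without_inversions G E \<phi> \<longleftrightarrow>
     \<not> (\<exists>g\<in>carrier G. \<exists>u v. E u v \<and> \<phi> g u = v \<and> \<phi> g v = u)"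

text \<open>Property FA, for actions on trees whose vertices live in the type 'v
(the type variable is universally quantified in the theorem).\<close>

definition property_FA :: "('g, 'b) monoid_scheme \<Rightarrow> 'v itself \<Rightarrow> bool" where
  "property_FA G (TYPE('v)) \<longleftrightarrow>
     (\<forall>(V :: 'v set) E \<phi>. simplicial_tree V E \<and> simplicial_action G V E \<phi> \<and>
        without_inversions G E \<phi> \<longrightarrow> (\<exists>v\<in>V. \<forall>g\<in>carrier G. \<phi> g v = v))"

definition cayley_adj :: "('g, 'b) monoid_scheme \<Rightarrow> 'g set \<Rightarrow> 'g \<Rightarrow> 'g \<Rightarrow> bool" where
  "cayley_adj G S g h \<longleftrightarrow> g \<in> carrier G \<and> h \<in> carrier G \<and>
     (\<exists>s\<in>S. h = g \<otimes>\<^bsub>G\<^esub> s \<or> g = h \<otimes>\<^bsub>G\<^esub> s)"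

definition finite_generating_set :: "('g, 'b) monoid_scheme \<Rightarrow> 'g set \<Rightarrow> bool" where
  "finite_generating_set G S \<longleftrightarrow> finite S \<and> S \<subseteq> carrier G \<and> generate G S = carrier G"

definition cayley_components :: "('g, 'b) monoid_scheme \<Rightarrow> 'g set \<Rightarrow> 'g set \<Rightarrow> 'g set set" where
  "cayley_components G S K =
     {{v. \<exists>xs. walk (cayley_adj G S) xs \<and> set xs \<inter> K = {} \<and> hd xs = u \<and> last xs = v}
      | u. u \<in> carrier G - K}"

definition cayley_bounded :: "('g, 'b) monoid_scheme \<Rightarrow> 'g set \<Rightarrow> 'g set \<Rightarrow> bool" where
  "cayley_bounded G S C \<longleftrightarrow>
     (\<exists>N::nat. \<forall>x\<in>C. \<exists>xs. walk (cayley_adj G S) xs \<and> hd xs = \<one>\<^bsub>G\<^esub> \<and> last xs = x \<and> length xs \<le> Suc N)"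

definition num_ends :: "('g, 'b) monoid_scheme \<Rightarrow> 'g set \<Rightarrow> enat" where
  "num_ends G S = (SUP K \<in> {K. finite K}.
     (let U = {C \<in> cayley_components G S K. \<not> cayley_bounded G S C}
      in if finite U then enat (card U) else \<infinity>))"

end

theory Submission
  imports Defs "HOL-Library.Sublist" "HOL-Combinatorics.Transposition"
begin

text \<open>
  A rectangle is a tuple of binary words, and \<open>nV\<close> is generated by swaps of two disjoint rectangles.
  Modulo swaps, any two halving patterns with the same number of pieces are equivalent, except that
  halving in direction \<open>k\<close> has to be traded for halving in direction \<open>l\<close>; this is the baker's map,
  whose class \<open>\<beta>\<close> satisfies \<open>\<beta> = \<beta>\<^sup>2\<close> because a baker's map is a swap times two smaller baker's maps.
  Conjugating with shallow swaps makes a deep rectangle shallower, so finitely many swaps suffice.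

  Property FA: each swap is an involution and fixes a vertex. Any two of the generators \<open>s\<close>, \<open>t\<close> have
  conjugates \<open>s'\<close>, \<open>t'\<close> under a common element that commute with both of them. If the fixed trees of \<open>s\<close> and
  \<open>t\<close> were disjoint, then \<open>s'\<close> and \<open>t'\<close> would fix the bridge between them, hence would have a common
  fixed vertex, and so would \<open>s\<close> and \<open>t\<close>. The Helly property of trees gives a global fixed vertex.

  One end: let \<open>A\<close> be an almost invariant set, such as a component of the
  complement of a finite set. On a coset of \<open>\<int>\<^sup>2\<close> it is finite or cofinite. The elements of infinite
  order that fix a rectangle pointwise form a conjugation invariant set in which any two elements are linked
  by a chain generating successive copies of \<open>\<int>\<^sup>2\<close>, which forces the same alternative on all cosets.
\<close>

section \<open>Trees\<close>

text \<open>The generators are tuned to the number eight. Three binary digits of coordinate 0 cut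
  the cube into eight columns, and each generator swaps two rectangles that lie inside one column
  each. Two generators touch at most four columns, so all of these can be pushed into the other
  four; this produces the commuting conjugates. Two obstacles shape the generation argument. A
  pattern need not arise by successive halvings, so elements are compared only through grids and
  their refinements. And the swap subgroup is not known to be normal beforehand, so \<beta> =
  \<beta>^2 cannot be computed in a quotient; instead a baker's map is pushed past a swap that
  involves its own rectangle, at the price of another product of swaps. For the ends, a single line
  of powers may have different limits at its two ends; a commuting independent element forces them
  to agree. Conjugation invariance serves to change the base point:
  \<open>x (inv x t x)^i = t^i x\<close> turns a line through \<open>x\<close> into a right
  translate of a line through the identity.\<close>

lemma walk_iff_successively: "walk E xs \<longleftrightarrow> xs \<noteq> [] \<and> successively E xs"
  by (simp add: walk_def successively_conv_nth)

definition spath :: "('v \<Rightarrow> 'v \<Rightarrow> bool) \<Rightarrow> 'v \<Rightarrow> 'v \<Rightarrow> 'v list \<Rightarrow> bool" where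
  "spath E u v xs \<longleftrightarrow> xs \<noteq> [] \<and> successively E xs \<and> distinct xs \<and> hd xs = u \<and> last xs = v"

locale tree =
  fixes V :: "'v set" and E :: "'v \<Rightarrow> 'v \<Rightarrow> bool"
  assumes tree: "simplicial_tree V E"
begin

lemma E_sym: "E u v \<Longrightarrow> E v u"
  and E_V: "E u v \<Longrightarrow> u \<in> V \<and> v \<in> V"
  and V_nonempty: "V \<noteq> {}"
  using tree by (auto simp: simplicial_tree_def simple_graph_def)

lemma no_cycle: "\<lbrakk>length xs \<ge> 3; distinct xs; successively E xs; E (last xs) (hd xs)\<rbrakk> \<Longrightarrow> False"
  using tree by (force simp: simplicial_tree_def has_cycle_def walk_iff_successively)

lemma successively_rev_E: "successively E (rev xs) \<longleftrightarrow> successively E xs"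
  unfolding successively_rev by (rule successively_cong) (auto intro: E_sym)

text \<open>If the first steps differ, let \<open>z\<close> be the first vertex of one path that the
  other also visits (the endpoint \<open>v\<close> is a candidate). Going out to \<open>z\<close>
  along one path and back along the other is a cycle.\<close>

lemma spath_unique:
  assumes "spath E u v xs" "spath E u v ys"
  shows "xs = ys"
  using assms
proof (induction xs arbitrary: u ys)
  case Nil
  then show ?case by (simp add: spath_def)
next
  case (Cons x xs)
  from Cons.prems obtain ys' where ys: "ys = u # ys'" and xu: "x = u"
    by (cases ys) (auto simp: spath_def)
  show ?case
  proof (cases "u = v")
    case True
    have "xs = []"
      using Cons.prems(1) True xu by (auto simp: spath_def split: if_splits)
    moreover have "ys' = []"
      using Cons.prems(2) True ys by (auto simp: spath_def split: if_splits)
    ultimately show ?thesis using ys xu by simp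
  next
    case False
    then have ne: "xs \<noteq> []" "ys' \<noteq> []"
      using Cons.prems ys xu by (auto simp: spath_def)
    have px: "spath E (hd xs) v xs" and Eux: "E u (hd xs)" and ux: "u \<notin> set xs"
      using Cons.prems(1) ne xu by (auto simp: spath_def successively_Cons)
    have py: "spath E (hd ys') v ys'" and Euy: "E u (hd ys')" and uy: "u \<notin> set ys'"
      using Cons.prems(2) ne ys by (auto simp: spath_def successively_Cons)
    show ?thesis
    proof (cases "hd xs = hd ys'")
      case True
      then have "xs = ys'" using Cons.IH[OF px] py by simp
      then show ?thesis using ys xu by simp
    next
      case neq: False
      have "v \<in> set xs" "v \<in> set ys'"
        using px py unfolding spath_def by (metis last_in_set)+
      then obtain p z r where xs: "xs = p @ z # r" "z \<in> set ys'" "\<forall>y\<in>set p. y \<notin> set ys'"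
        using split_list_first_prop[of xs "\<lambda>y. y \<in> set ys'"] by blast
      obtain q r' where ys': "ys' = q @ z # r'"
        using split_list[OF xs(2)] by blast
      define c where "c = u # p @ z # rev q"
      have "distinct c"
        using px py ux uy xs ys' unfolding c_def spath_def by auto
      moreover have "successively E c"
      proof -
        have 1: "successively E (u # p @ [z])"
          using px Eux ne(1) xs(1) unfolding spath_def
          by (cases p) (auto simp: successively_append_iff successively_Cons hd_append)
        have "successively E (q @ [z])"
          using py ys' unfolding spath_def by (auto simp: successively_append_iff successively_Cons)
        then have "successively E (rev (q @ [z]))"
          by (simp only: successively_rev_E)
        then have 2: "successively E (z # rev q)" by simp
        show ?thesis
          using 1 2 unfolding c_def
          by (auto simp: successively_append_iff successively_Cons hd_append)
      qed
      moreover have "E (last c) (hd c)"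
        using Euy ys' by (cases q) (auto simp: c_def last_rev intro: E_sym)
      moreover have "length c \<ge> 3"
        using neq xs ys' by (cases p; cases q) (auto simp: c_def)
      ultimately show ?thesis using no_cycle by blast
    qed
  qed
qed

text \<open>A walk of least length repeats no vertex, since the segment between two visits could be
  cut out.\<close>

lemma spath_exists:
  assumes "u \<in> V" "v \<in> V"
  shows "\<exists>xs. spath E u v xs"
proof -
  let ?P = "\<lambda>xs. xs \<noteq> [] \<and> successively E xs \<and> hd xs = u \<and> last xs = v"
  have "\<exists>xs. ?P xs"
    using tree assms unfolding simplicial_tree_def connected_graph_def walk_iff_successively by blast
  then obtain xs where xs: "?P xs" and min: "\<And>ys. ?P ys \<Longrightarrow> length xs \<le> length ys"
    using ex_has_least_nat[of ?P _ length] by metis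
  have "distinct xs"
  proof (rule ccontr)
    assume "\<not> distinct xs"
    then obtain as bs cs y where "xs = as @ [y] @ bs @ [y] @ cs"
      using not_distinct_decomp by blast
    moreover from this have "?P (as @ [y] @ cs)"
      using xs by (cases as; cases cs)
        (auto simp: successively_append_iff successively_Cons hd_append split: if_splits)
    ultimately show False
      using min[of "as @ [y] @ cs"] by (simp only: length_append) simp
  qed
  then show ?thesis using xs by (auto simp: spath_def)
qed

definition path :: "'v \<Rightarrow> 'v \<Rightarrow> 'v list" where
  "path u v = (THE xs. spath E u v xs)"

lemma pathI: "spath E u v xs \<Longrightarrow> path u v = xs"
  unfolding path_def using spath_unique by blast

lemma spath_path: "u \<in> V \<Longrightarrow> v \<in> V \<Longrightarrow> spath E u v (path u v)"
  using spath_exists pathI by metis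

lemma spath_subset: "spath E u v xs \<Longrightarrow> u \<in> V \<Longrightarrow> set xs \<subseteq> V"
proof (induction xs arbitrary: u)
  case (Cons x xs)
  show ?case
  proof (cases "xs = []")
    case False
    then have "E x (hd xs)" "spath E (hd xs) v xs"
      using Cons.prems by (auto simp: spath_def successively_Cons)
    then show ?thesis using Cons E_V by auto
  qed (use Cons in \<open>auto simp: spath_def\<close>)
qed (simp add: spath_def)

lemma path_subset: "u \<in> V \<Longrightarrow> v \<in> V \<Longrightarrow> set (path u v) \<subseteq> V"
  using spath_subset spath_path by blast

lemma path_ends: "u \<in> V \<Longrightarrow> v \<in> V \<Longrightarrow> u \<in> set (path u v) \<and> v \<in> set (path u v)"
  using spath_path[of u v] unfolding spath_def by (metis hd_in_set last_in_set)

lemma path_rev: "u \<in> V \<Longrightarrow> v \<in> V \<Longrightarrow> path v u = rev (path u v)"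
  using spath_path[of u v]
  by (intro pathI) (auto simp: spath_def successively_rev_E hd_rev last_rev simp del: successively_rev)

lemma path_split:
  assumes "u \<in> V" "v \<in> V" "z \<in> set (path u v)"
  shows "path u v = path u z @ tl (path z v)"
proof -
  obtain as bs where p: "path u v = as @ z # bs"
    using split_list[OF assms(3)] by blast
  have s: "spath E u v (as @ z # bs)"
    using spath_path[OF assms(1,2)] p by simp
  have "path u z = as @ [z]"
    using s by (intro pathI) (cases as; auto simp: spath_def successively_append_iff successively_Cons hd_append)
  moreover have "path z v = z # bs"
    using s by (intro pathI) (auto simp: spath_def successively_append_iff successively_Cons)
  ultimately show ?thesis using p by simp
qed

lemma path_suffix_subset:
  assumes "u \<in> V" "v \<in> V" "z \<in> set (path u v)"
  shows "set (path z v) \<subseteq> set (path u v)"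
proof -
  have "z \<in> V" using assms path_subset by blast
  then obtain bs where bs: "path z v = z # bs"
    using spath_path[of z v] assms(2) by (cases "path z v") (auto simp: spath_def)
  have "set (path u v) = set (path u z) \<union> set bs"
    using path_split[OF assms] bs by simp
  then show ?thesis using assms(3) bs by auto
qed

lemma path_append:
  assumes "u \<in> V" "z \<in> V" "v \<in> V" "set (path u z) \<inter> set (path z v) \<subseteq> {z}"
  shows "path u v = path u z @ tl (path z v)"
proof (rule pathI)
  obtain bs where b: "path z v = z # bs"
    using spath_path[OF assms(2,3)] by (cases "path z v") (auto simp: spath_def)
  have P: "path u z \<noteq> []" "successively E (path u z)" "distinct (path u z)"
    "hd (path u z) = u" "last (path u z) = z"
    using spath_path[OF assms(1,2)] by (auto simp: spath_def)
  have Q: "successively E (z # bs)" "distinct (z # bs)" "last (z # bs) = v"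
    using spath_path[OF assms(2,3)] unfolding b by (auto simp: spath_def)
  have "set (path u z) \<inter> set bs = {}"
    using assms(4) Q(2) unfolding b by auto
  moreover have "successively E (path u z @ bs)"
    using P Q(1) by (auto simp: successively_append_iff successively_Cons)
  ultimately show "spath E u v (path u z @ tl (path z v))"
    using P Q(2,3) unfolding b by (auto simp: spath_def)
qed

section \<open>Subtrees, nearest points and the Helly property\<close>

definition convex :: "'v set \<Rightarrow> bool" where
  "convex C \<longleftrightarrow> C \<subseteq> V \<and> (\<forall>u\<in>C. \<forall>v\<in>C. set (path u v) \<subseteq> C)"

lemma convex_V: "convex C \<Longrightarrow> x \<in> C \<Longrightarrow> x \<in> V"
  and convex_path: "convex C \<Longrightarrow> u \<in> C \<Longrightarrow> v \<in> C \<Longrightarrow> x \<in> set (path u v) \<Longrightarrow> x \<in> C"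
  unfolding convex_def by blast+

lemma convex_Int: "convex C \<Longrightarrow> convex D \<Longrightarrow> convex (C \<inter> D)"
  unfolding convex_def by blast

text \<open>The nearest-point projection of \<open>p\<close> to a subtree, described as the point of
  entry. Unlike minimality of a distance, this form passes at once to subpaths ending in
  \<open>q\<close>.\<close>

definition gate :: "'v \<Rightarrow> 'v set \<Rightarrow> 'v \<Rightarrow> bool" where
  "gate p C q \<longleftrightarrow> q \<in> C \<and> set (path p q) \<inter> C \<subseteq> {q}"

lemma gate_exists:
  assumes "p \<in> V" "convex C" "C \<noteq> {}"
  shows "\<exists>q. gate p C q"
proof -
  obtain q where q: "q \<in> C" and min: "\<And>x. x \<in> C \<Longrightarrow> length (path p q) \<le> length (path p x)"
    using assms(3) ex_has_least_nat[of "\<lambda>x. x \<in> C" _ "\<lambda>x. length (path p x)"]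
    by (metis ex_in_conv)
  have "z = q" if z: "z \<in> set (path p q)" "z \<in> C" for z
  proof -
    have qV: "q \<in> V" "z \<in> V" using q assms(2) z by (auto simp: convex_def)
    have "path p q = path p z @ tl (path z q)"
      using path_split assms(1) qV z by blast
    \<comment> \<open>Lengths count vertices, so minimality leaves only one vertex for the path from
      \<open>z\<close> to \<open>q\<close>.\<close>
    then have "length (path z q) \<le> Suc 0" using min[OF z(2)] by simp
    then have "path z q = [z]"
      using spath_path[OF qV(2,1)] by (cases "path z q") (auto simp: spath_def)
    then show ?thesis
      using spath_path[OF qV(2,1)] by (simp add: spath_def)
  qed
  then show ?thesis using q unfolding gate_def by blast
qed

lemma gateD: "gate p C q \<Longrightarrow> q \<in> C"
  by (simp add: gate_def)

text \<open>A subtree can be entered only through the gate: the path from \<open>q\<close> to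
  \<open>x\<close> stays in \<open>C\<close>, the path from \<open>p\<close> to \<open>q\<close>
  avoids \<open>C\<close> before \<open>q\<close>, so the two meet only in \<open>q\<close>.\<close>

lemma gate_between:
  assumes "p \<in> V" "convex C" "gate p C q" "x \<in> C"
  shows "path p x = path p q @ tl (path q x)"
proof (rule path_append)
  have "set (path q x) \<subseteq> C" using assms convex_path gateD by blast
  then show "set (path p q) \<inter> set (path q x) \<subseteq> {q}"
    using assms(3) by (auto simp: gate_def)
  show "q \<in> V" "x \<in> V" using assms convex_V gateD by blast+
qed (rule assms)

lemma gate_in_path:
  assumes "p \<in> V" "convex C" "gate p C q" "x \<in> C"
  shows "q \<in> set (path p x)"
proof -
  have "q \<in> V" using assms convex_V gateD by blast
  then show ?thesis
    using gate_between[OF assms] path_ends[of p q] assms(1) by simp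
qed

lemma gate_unique:
  assumes "p \<in> V" "convex C" "gate p C q" "gate p C q'"
  shows "q = q'"
  using gate_in_path[OF assms(1,2,3), of q'] assms(3,4) unfolding gate_def by blast

text \<open>Two points of \<open>C\<close> with different gates in \<open>D\<close> would be joined by a path through \<open>D\<close>.\<close>

lemma gate_const:
  assumes "convex C" "convex D" "C \<inter> D = {}" "p \<in> C" "p' \<in> C" "gate p D q" "gate p' D q'"
  shows "q = q'"
proof (rule ccontr)
  assume "q \<noteq> q'"
  have D: "q \<in> D" "q' \<in> D" using gateD assms by blast+
  have V: "p \<in> V" "p' \<in> V" "q \<in> V" "q' \<in> V"
    using assms(1,2,4,5) D convex_V by blast+
  have 1: "path p q' = path p q @ tl (path q q')"
    by (rule gate_between[OF V(1) assms(2,6) D(2)])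
  \<comment> \<open>A vertex on both paths would have both \<open>q\<close> and \<open>q'\<close> as
    gates in \<open>D\<close>, because gates are inherited along the path.\<close>
  have disj: "set (path p q) \<inter> set (path q' p') = {}"
  proof (rule ccontr)
    assume "\<not> ?thesis"
    then obtain z where z: "z \<in> set (path p q)" "z \<in> set (path p' q')"
      using path_rev[OF V(2,4)] by auto
    have zV: "z \<in> V" using z path_subset V by blast
    have "gate z D q"
      using assms(6) path_suffix_subset[OF V(1,3) z(1)] unfolding gate_def by blast
    moreover have "gate z D q'"
      using assms(7) path_suffix_subset[OF V(2,4) z(2)] unfolding gate_def by blast
    ultimately show False using gate_unique zV assms(2) \<open>q \<noteq> q'\<close> by blast
  qed
  have "set (path q q') \<subseteq> D" using D assms(2) convex_path by blast
  then have "set (tl (path q q')) \<subseteq> D"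
    by (cases "path q q'") auto
  moreover have "set (path q' p') \<inter> D \<subseteq> {q'}"
    using assms(7) path_rev[OF V(2,4)] unfolding gate_def by simp
  ultimately have "set (path p q') \<inter> set (path q' p') \<subseteq> {q'}"
    unfolding 1 set_append using disj by blast
  then have "path p p' = path p q' @ tl (path q' p')"
    using path_append V by blast
  then have "q \<in> set (path p p')" using 1 path_ends[of p q] V by simp
  then have "q \<in> C" by (rule convex_path[OF assms(1,4,5)])
  then show False using assms(3) D by blast
qed

text \<open>Project a point \<open>p\<close> of \<open>A\<close> and \<open>B\<close> to
  \<open>C\<close>. The projection lies on the path from \<open>p\<close> to every point of
  \<open>C\<close>; aiming at a point of \<open>A\<close> puts it into \<open>A\<close>, aiming at a
  point of \<open>B\<close> puts it into \<open>B\<close>.\<close>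

lemma helly3:
  assumes "convex A" "convex B" "convex C" "A \<inter> B \<noteq> {}" "A \<inter> C \<noteq> {}" "B \<inter> C \<noteq> {}"
  shows "A \<inter> B \<inter> C \<noteq> {}"
proof -
  obtain x y p where x: "x \<in> A" "x \<in> C" and y: "y \<in> B" "y \<in> C" and p: "p \<in> A" "p \<in> B"
    using assms(4-6) by blast
  have pV: "p \<in> V" using p(1) assms(1) convex_V by blast
  obtain q where q: "gate p C q"
    using gate_exists[OF pV assms(3)] x by blast
  have "q \<in> A"
    by (rule convex_path[OF assms(1) p(1) x(1) gate_in_path[OF pV assms(3) q x(2)]])
  moreover have "q \<in> B"
    by (rule convex_path[OF assms(2) p(2) y(1) gate_in_path[OF pV assms(3) q y(2)]])
  ultimately show ?thesis using gateD[OF q] by blast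
qed

lemma helly:
  assumes "finite I" "I \<noteq> {}" "\<And>i. i \<in> I \<Longrightarrow> convex (F i)"
    "\<And>i j. i \<in> I \<Longrightarrow> j \<in> I \<Longrightarrow> F i \<inter> F j \<noteq> {}"
  shows "(\<Inter>i\<in>I. F i) \<noteq> {}"
  using assms
proof (induction I arbitrary: F rule: finite_ne_induct)
  case (singleton i)
  then show ?case by auto
next
  case (insert i I)
  \<comment> \<open>Intersecting every set with \<open>F i\<close> preserves the hypotheses, because
    pairs still meet by \<open>helly3\<close>.\<close>
  have "(\<Inter>j\<in>I. F i \<inter> F j) \<noteq> {}"
  proof (rule insert.IH)
    show "convex (F i \<inter> F j)" if "j \<in> I" for j
      using convex_Int insert.prems that by blast
    show "(F i \<inter> F j) \<inter> (F i \<inter> F k) \<noteq> {}" if "j \<in> I" "k \<in> I" for j k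
      using helly3[of "F i" "F j" "F k"] insert.prems that by blast
  qed
  then show ?case using insert.hyps by auto
qed

section \<open>Automorphisms of a tree and their fixed subtrees\<close>

definition aut :: "('v \<Rightarrow> 'v) \<Rightarrow> bool" where
  "aut f \<longleftrightarrow> bij_betw f V V \<and> (\<forall>u\<in>V. \<forall>v\<in>V. E (f u) (f v) \<longleftrightarrow> E u v)"

lemma aut_path:
  assumes "aut f" "u \<in> V" "v \<in> V"
  shows "path (f u) (f v) = map f (path u v)"
proof (rule pathI)
  have s: "spath E u v (path u v)" and sub: "set (path u v) \<subseteq> V"
    using spath_path path_subset assms by auto
  have "successively (\<lambda>x y. E (f x) (f y)) (path u v)"
    using s assms(1) sub unfolding spath_def aut_def
    by (metis (no_types, lifting) successively_cong subsetD)
  moreover have "inj_on f (set (path u v))"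
    using assms(1) sub unfolding aut_def bij_betw_def by (meson inj_on_subset)
  ultimately show "spath E (f u) (f v) (map f (path u v))"
    using s unfolding spath_def
    by (auto simp: successively_map distinct_map hd_map last_map)
qed

text \<open>Paths are unique, so an automorphism that fixes both ends of a path fixes it vertex by
  vertex.\<close>

lemma convex_fix:
  assumes "aut f"
  shows "convex {v \<in> V. f v = v}"
  unfolding convex_def
proof (intro conjI ballI)
  fix u v assume u: "u \<in> {v \<in> V. f v = v}" and v: "v \<in> {v \<in> V. f v = v}"
  then have "map f (path u v) = path u v"
    using aut_path[OF assms, of u v] by simp
  then have "\<forall>x\<in>set (path u v). f x = x"
    by (metis map_eq_conv list.map_ident)
  then show "set (path u v) \<subseteq> {v \<in> V. f v = v}"
    using path_subset u v by blast
qed auto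

text \<open>The involution reverses the path from \<open>v\<close> to \<open>f v\<close>. With an
  odd number of vertices it fixes the middle one; with an even number it would invert the middle
  edge.\<close>

lemma involution_fixes_vertex:
  assumes "aut f" "\<And>v. v \<in> V \<Longrightarrow> f (f v) = v" "\<not> (\<exists>u v. E u v \<and> f u = v \<and> f v = u)"
  shows "\<exists>v\<in>V. f v = v"
proof -
  obtain v where v: "v \<in> V" using V_nonempty by blast
  then have fv: "f v \<in> V" using assms(1) unfolding aut_def by (meson bij_betwE)
  define xs where "xs = path v (f v)"
  have "map f xs = path (f v) v"
    unfolding xs_def using aut_path[OF assms(1) v fv] assms(2)[OF v] by simp
  then have m: "map f xs = rev xs" unfolding xs_def using path_rev[OF v fv] by simp
  have ne: "xs \<noteq> []" and succ: "successively E xs"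
    using spath_path[OF v fv] unfolding xs_def spath_def by auto
  have sub: "set xs \<subseteq> V" unfolding xs_def using path_subset v fv by blast
  define m' where "m' = (length xs - 1) div 2"
  have fi: "f (xs ! i) = xs ! (length xs - Suc i)" if "i < length xs" for i
    using m that by (metis length_rev nth_map rev_nth)
  show ?thesis
  proof (cases "odd (length xs)")
    case True
    then obtain k where k: "length xs = 2 * k + 1" by (elim oddE)
    have "f (xs ! k) = xs ! k" using fi[of k] k by simp
    moreover have "xs ! k \<in> V" using sub k by (simp add: subset_iff)
    ultimately show ?thesis by blast
  next
    case False
    then obtain k where k: "length xs = 2 * Suc k"
      using ne by (metis evenE length_0_conv mult_0_right not0_implies_Suc)
    have "f (xs ! k) = xs ! Suc k" "f (xs ! Suc k) = xs ! k"
      using fi[of k] fi[of "Suc k"] k by simp_all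
    moreover have "E (xs ! k) (xs ! Suc k)"
      using succ k by (simp add: successively_conv_nth)
    ultimately show ?thesis using assms(3) by blast
  qed
qed

text \<open>If the fixed trees of \<open>s\<close> and \<open>t\<close> were disjoint, automorphisms commuting with both would
fix the bridge between them.\<close>

lemma disjoint_fix_gate:
  assumes "convex C" "convex D" "C \<inter> D = {}" "C \<noteq> {}" "D \<noteq> {}"
  shows "\<exists>q\<in>V. \<forall>f. aut f \<and> f ` C \<subseteq> C \<and> f ` D = D \<longrightarrow> f q = q"
proof -
  obtain p where p: "p \<in> C" "p \<in> V" using assms by (auto simp: convex_def)
  obtain q where q: "gate p D q" using gate_exists p assms by blast
  have qV: "q \<in> V" "q \<in> D" using q assms by (auto simp: gate_def convex_def)
  have "f q = q" if f: "aut f" "f ` C \<subseteq> C" "f ` D = D" for f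
  proof -
    have "gate (f p) D (f q)"
      unfolding gate_def
    proof
      show "f q \<in> D" using f qV by blast
      have inj: "inj_on f V" using f(1) by (simp add: aut_def bij_betw_def)
      have "path (f p) (f q) = map f (path p q)"
        using aut_path f(1) p qV by blast
      \<comment> \<open>\<open>D\<close> has to be mapped onto itself, not just into itself: a point
        of \<open>D\<close> on the image path must be the image of a point of
        \<open>D\<close>.\<close>
      moreover have "f ` set (path p q) \<inter> f ` D \<subseteq> {f q}"
        using q path_subset[OF p(2) qV(1)] assms(2) inj_on_image_Int[OF inj, of "set (path p q)" D]
        unfolding gate_def convex_def by auto
      ultimately show "set (path (f p) (f q)) \<inter> D \<subseteq> {f q}" using f(3) by simp
    qed
    \<comment> \<open>Both \<open>p\<close> and \<open>f p\<close> lie in \<open>C\<close>, so by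
      \<open>gate_const\<close> their gates \<open>q\<close> and \<open>f q\<close> in
      \<open>D\<close> agree.\<close>
    moreover have "f p \<in> C" using f p by blast
    ultimately show ?thesis
      using gate_const[OF assms(1-3)] p(1) q by metis
  qed
  then show ?thesis using qV by blast
qed

end

section \<open>Fixed vertices and almost invariant sets\<close>

lemma (in group) conj_mult:
  assumes "k \<in> carrier G" "a \<in> carrier G" "b \<in> carrier G"
  shows "(k \<otimes> a \<otimes> inv k) \<otimes> (k \<otimes> b \<otimes> inv k) = k \<otimes> (a \<otimes> b) \<otimes> inv k"
proof -
  have "inv k \<otimes> (k \<otimes> y) = y" if "y \<in> carrier G" for y
    using assms that by (simp add: m_assoc[symmetric])
  then show ?thesis using assms by (simp add: m_assoc)
qed

lemma (in group) int_pow_conj: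
  assumes "g \<in> carrier G" "t \<in> carrier G"
  shows "(inv g \<otimes> t \<otimes> g) [^] (i::int) = inv g \<otimes> t [^] i \<otimes> g"
proof -
  have "(\<lambda>y. inv g \<otimes> y \<otimes> g) \<in> hom G G"
    using conj_mult[of "inv g"] assms(1) by (auto simp: hom_def)
  then have "group_hom G G (\<lambda>y. inv g \<otimes> y \<otimes> g)"
    by (simp add: group_hom_def group_hom_axioms_def is_group)
  then show ?thesis
    using group_hom.hom_int_pow[of G G "\<lambda>y. inv g \<otimes> y \<otimes> g" t i] assms(2) by simp
qed

text \<open>One \<open>k\<close> has to serve all four pairs. Then, if the fixed trees were
  disjoint, the conjugates of \<open>s\<close> and of \<open>t\<close> would both preserve them and
  fix the same vertex \<open>q\<close>, and the vertex that \<open>k\<close> sends to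
  \<open>q\<close> would be fixed by \<open>s\<close> and by \<open>t\<close>.\<close>

lemma property_FA_if_involutions:
  fixes G (structure)
  assumes S: "finite S" "S \<noteq> {}" "S \<subseteq> carrier G" "generate G S = carrier G"
    and invol: "\<And>s. s \<in> S \<Longrightarrow> s \<otimes> s = \<one>"
    and comm: "\<And>s t. s \<in> S \<Longrightarrow> t \<in> S \<Longrightarrow> \<exists>k\<in>carrier G. \<forall>a\<in>{s, t}. \<forall>b\<in>{s, t}.
      (k \<otimes> a \<otimes> inv k) \<otimes> b = b \<otimes> (k \<otimes> a \<otimes> inv k)"
  shows "property_FA G TYPE('v)"
  unfolding property_FA_def
proof (intro allI impI, elim conjE)
  fix V :: "'v set" and E \<phi>
  assume V: "simplicial_tree V E" and act: "simplicial_action G V E \<phi>"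
    and ninv: "without_inversions G E \<phi>"
  interpret tree V E by unfold_locales (rule V)
  interpret group_action G V \<phi> using act by (simp add: simplicial_action_def)
  interpret group G using group_hom by (simp add: group_hom_def)
  have mult: "\<phi> (g \<otimes> h) v = \<phi> g (\<phi> h v)"
    if "g \<in> carrier G" "h \<in> carrier G" "v \<in> V" for g h v
    using composition_rule that by blast
  have \<phi>V: "\<phi> g v \<in> V" if "g \<in> carrier G" "v \<in> V" for g v
    using element_image that by blast
  have phi_one: "\<phi> \<one> v = v" if "v \<in> V" for v
    using that id_eq_one by (metis restrict_apply')
  have aut: "aut (\<phi> g)" if "g \<in> carrier G" for g
    using act bij_prop0[OF that] that unfolding aut_def simplicial_action_def Bij_def by blast
  have inv_eq: "inv s = s" if "s \<in> S" for s
    using invol[OF that] that S(3) by (meson inv_equality subsetD)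
  define F where "F s = {v \<in> V. \<phi> s v = v}" for s
  have conv: "convex (F s)" if "s \<in> S" for s
    unfolding F_def using convex_fix aut that S(3) by blast
  have ne: "F s \<noteq> {}" if s: "s \<in> S" for s
  proof -
    have "\<phi> s (\<phi> s v) = v" if "v \<in> V" for v
      using mult[of s s v] invol[OF s] phi_one that s S(3) by auto
    then show ?thesis
      using involution_fixes_vertex[OF aut, of s] ninv s S(3)
      unfolding F_def without_inversions_def by blast
  qed
  have pair: "F s \<inter> F t \<noteq> {}" if s: "s \<in> S" and t: "t \<in> S" for s t
  proof
    assume empty: "F s \<inter> F t = {}"
    obtain k where k: "k \<in> carrier G" and c: "\<And>a b. a \<in> {s, t} \<Longrightarrow> b \<in> {s, t} \<Longrightarrow>
        (k \<otimes> a \<otimes> inv k) \<otimes> b = b \<otimes> (k \<otimes> a \<otimes> inv k)"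
      using comm[OF s t] by blast
    obtain q where q: "q \<in> V" and fixq: "\<And>f. aut f \<Longrightarrow> f ` F s \<subseteq> F s \<Longrightarrow> f ` F t = F t \<Longrightarrow> f q = q"
      using disjoint_fix_gate[OF conv[OF s] conv[OF t] empty ne[OF s] ne[OF t]] by blast
    have "inv k \<in> carrier G" using k by simp
    have "\<phi> a (\<phi> (inv k) q) = \<phi> (inv k) q" if a: "a \<in> {s, t}" for a
    proof -
      have aG: "a \<in> carrier G" and aS: "a \<in> S" using a s t S(3) by auto
      define a' where "a' = k \<otimes> a \<otimes> inv k"
      have a'G: "a' \<in> carrier G" using k aG by (simp add: a'_def)
      have sub: "\<phi> a' ` F b \<subseteq> F b" if b: "b \<in> {s, t}" for b
      proof
        fix w assume "w \<in> \<phi> a' ` F b"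
        then obtain v where v: "v \<in> V" "\<phi> b v = v" "w = \<phi> a' v" by (auto simp: F_def)
        have bG: "b \<in> carrier G" using b s t S(3) by auto
        have "\<phi> b w = \<phi> (b \<otimes> a') v" using mult[OF bG a'G v(1)] v(3) by simp
        also have "\<dots> = \<phi> (a' \<otimes> b) v" using c[OF a b] by (simp add: a'_def)
        also have "\<dots> = w" using mult[OF a'G bG v(1)] v by simp
        finally show "w \<in> F b" using \<phi>V[OF a'G v(1)] v(3) by (simp add: F_def)
      qed
      \<comment> \<open>Being an involution upgrades the inclusion \<open>sub\<close> to the
        equality that \<open>disjoint_fix_gate\<close> demands for \<open>F t\<close>.\<close>
      have "a' \<otimes> a' = \<one>"
        using conj_mult[OF k aG aG] invol[OF aS] k by (simp add: a'_def)
      then have "\<phi> a' (\<phi> a' v) = v" if "v \<in> V" for v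
        using mult[OF a'G a'G that] phi_one[OF that] by simp
      then have "F t \<subseteq> \<phi> a' ` F t"
        using sub[of t] by (force simp: F_def)
      then have "\<phi> a' q = q"
        using fixq[OF aut[OF a'G]] sub by blast
      moreover have "a \<otimes> inv k = inv k \<otimes> a'"
        using k aG by (simp add: a'_def m_assoc[symmetric])
      ultimately show ?thesis
        using mult[OF aG \<open>inv k \<in> carrier G\<close> q] mult[OF \<open>inv k \<in> carrier G\<close> a'G q] by simp
    qed
    then have "\<phi> (inv k) q \<in> F s \<inter> F t"
      using \<phi>V[OF \<open>inv k \<in> carrier G\<close> q] by (simp add: F_def)
    then show False using empty by blast
  qed
  have "(\<Inter>s\<in>S. F s) \<noteq> {}"
    by (rule helly[OF S(1,2)]) (simp_all add: conv pair)
  then obtain v where v: "\<And>s. s \<in> S \<Longrightarrow> v \<in> F s" by blast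
  then have vV: "v \<in> V" using S(2) by (auto simp: F_def)
  have "g \<in> carrier G \<and> \<phi> g v = v" if "g \<in> generate G S" for g
    using that
  proof (induction rule: generate.induct)
    case one
    then show ?case using phi_one vV by simp
  next
    case (incl h)
    then show ?case using v S(3) by (auto simp: F_def)
  next
    case (inv h)
    then show ?case using v S(3) inv_eq by (auto simp: F_def)
  next
    case (eng h1 h2)
    then show ?case using mult vV by simp
  qed
  then show "\<exists>v\<in>V. \<forall>g\<in>carrier G. \<phi> g v = v" using S(4) vV by blast
qed

text \<open>Outside a large square no edge of the grid changes the value, so far rows and far
  columns are constant. They cross each other, so all carry one value \<open>e\<close>, and all but
  finitely many points of either axis lie on one of them.\<close>

lemma grid_one_ended:
  fixes f :: "int \<Rightarrow> int \<Rightarrow> bool"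
  assumes "finite {(i, j). f i j \<noteq> f (i + 1) j}" "finite {(i, j). f i j \<noteq> f i (j + 1)}"
  shows "\<exists>e. finite {i. f i 0 \<noteq> e} \<and> finite {j. f 0 j \<noteq> e}"
proof -
  have const: "g i = g 0" if "\<And>i. g i = g (i + 1)" for g :: "int \<Rightarrow> bool" and i
  proof (induction i rule: int_induct[where k = 0])
    case (step2 i)
    then show ?case using that[of "i - 1"] by simp
  qed (use that in auto)
  let ?B = "{(i, j). f i j \<noteq> f (i + 1) j} \<union> {(i, j). f i j \<noteq> f i (j + 1)}"
  define N where "N = Max (insert 0 ((\<lambda>(i, j). max \<bar>i\<bar> \<bar>j\<bar>) ` ?B)) + 1"
  have N: "\<bar>i\<bar> < N \<and> \<bar>j\<bar> < N" if "(i, j) \<in> ?B" for i j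
  proof -
    have "max \<bar>i\<bar> \<bar>j\<bar> \<le> Max (insert 0 ((\<lambda>(i, j). max \<bar>i\<bar> \<bar>j\<bar>) ` ?B))"
      using that assms by (intro Max_ge) (blast, force)
    then show ?thesis by (simp add: N_def)
  qed
  have row: "f i j = f 0 j" if "\<bar>j\<bar> \<ge> N" for i j
  proof (rule const[of "\<lambda>i. f i j"])
    show "f i j = f (i + 1) j" for i using N[of i j] that by auto
  qed
  have col: "f i j = f i 0" if "\<bar>i\<bar> \<ge> N" for i j
  proof (rule const[of "\<lambda>j. f i j"])
    show "f i j = f i (j + 1)" for j using N[of i j] that by auto
  qed
  \<comment> \<open>The absolute values place this point on a far row and a far column whatever the
    sign of \<open>N\<close>.\<close>
  define e where "e = f \<bar>N\<bar> \<bar>N\<bar>"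
  have "f i 0 = e" if "\<bar>i\<bar> \<ge> N" for i
    using col[OF that, of "\<bar>N\<bar>"] row[of "\<bar>N\<bar>" i] row[of "\<bar>N\<bar>" "\<bar>N\<bar>"] by (simp add: e_def)
  moreover have "f 0 j = e" if "\<bar>j\<bar> \<ge> N" for j
    using row[OF that, of "\<bar>N\<bar>"] col[of "\<bar>N\<bar>" j] col[of "\<bar>N\<bar>" "\<bar>N\<bar>"] by (simp add: e_def)
  ultimately have "\<bar>i\<bar> \<le> N" if "f i 0 \<noteq> e \<or> f 0 i \<noteq> e" for i
    using that by (meson linear)
  then have "{i. f i 0 \<noteq> e} \<subseteq> {-N..N}" "{j. f 0 j \<noteq> e} \<subseteq> {-N..N}"
    by (auto simp: abs_le_iff minus_le_iff)
  then show ?thesis using finite_subset[OF _ finite_atLeastAtMost_int] by blast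
qed

section \<open>Almost invariant sets and their limits along cyclic subgroups\<close>

context group
begin

text \<open>For a finitely generated group these are the vertex sets with finite edge boundary in
  the Cayley graph; quantifying over all \<open>g\<close> makes the notion independent of
  generators.\<close>

definition almost_invariant :: "'a set \<Rightarrow> bool" where
  "almost_invariant A \<longleftrightarrow> A \<subseteq> carrier G \<and>
     (\<forall>g\<in>carrier G. finite {x \<in> carrier G. (x \<in> A) \<noteq> (x \<otimes> g \<in> A)})"

text \<open>The two elements freely generate a copy of Z^2; taking \<open>j = 0\<close> shows that
  \<open>t\<close> has infinite order.\<close>

definition independent :: "'a \<Rightarrow> 'a \<Rightarrow> bool" where
  "independent t u \<longleftrightarrow> t \<otimes> u = u \<otimes> t \<and> (\<forall>(i::int) (j::int). t [^] i = u [^] j \<longrightarrow> i = 0 \<and> j = 0)"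

lemma commutes_int_pow:
  assumes "x \<in> carrier G" "y \<in> carrier G" "x \<otimes> y = y \<otimes> x"
  shows "x [^] (i::int) \<otimes> y = y \<otimes> x [^] i"
proof -
  have n: "x [^] (n::nat) \<otimes> y = y \<otimes> x [^] n" for n
    using group_commutes_pow assms by blast
  have ni: "inv (x [^] (n::nat)) \<otimes> y = y \<otimes> inv (x [^] n)" for n
  proof -
    have "y = inv (x [^] n) \<otimes> (x [^] n \<otimes> y)" using assms by (simp add: m_assoc[symmetric])
    also have "\<dots> = inv (x [^] n) \<otimes> y \<otimes> x [^] n" using n assms by (simp add: m_assoc)
    finally show ?thesis using assms by (metis inv_closed inv_solve_right m_closed nat_pow_closed)
  qed
  show ?thesis
    using n ni by (cases "i < 0") (simp_all only: int_pow_def2 if_True if_False)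
qed

lemma independent_inj:
  assumes "t \<in> carrier G" "u \<in> carrier G" "x \<in> carrier G" "independent t u"
  shows "inj (\<lambda>(i::int, j::int). x \<otimes> t [^] i \<otimes> u [^] j)"
proof (rule injI, clarsimp)
  fix i j i' j' :: int
  assume "x \<otimes> t [^] i \<otimes> u [^] j = x \<otimes> t [^] i' \<otimes> u [^] j'"
  then have eq: "t [^] i \<otimes> u [^] j = t [^] i' \<otimes> u [^] j'"
    using assms by (simp add: m_assoc)
  have "t [^] (i - i') = inv (t [^] i') \<otimes> t [^] i"
    using assms(1) int_pow_mult[of t "- i'" i] by (simp add: int_pow_neg)
  also have "\<dots> = inv (t [^] i') \<otimes> (t [^] i \<otimes> u [^] j) \<otimes> inv (u [^] j)"
    using assms by (simp add: m_assoc)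
  also have "\<dots> = u [^] j' \<otimes> inv (u [^] j)"
    unfolding eq using assms by (simp add: m_assoc[symmetric])
  also have "\<dots> = u [^] (j' - j)"
    using assms(2) int_pow_mult[of u j' "- j"] by (simp add: int_pow_neg)
  finally show "i = i' \<and> j = j'" using assms(4) unfolding independent_def by fastforce
qed

text \<open>Membership in \<open>A\<close> has the limit \<open>e\<close> at both ends of the line
  through \<open>x\<close> in direction \<open>t\<close>. A single line need not have such a limit,
  since the integers have two ends.\<close>

definition converges :: "'a set \<Rightarrow> 'a \<Rightarrow> 'a \<Rightarrow> bool \<Rightarrow> bool" where
  "converges A t x e \<longleftrightarrow> finite {i::int. (x \<otimes> t [^] i \<in> A) \<noteq> e}"

lemma converges_unique: "converges A t x e \<Longrightarrow> converges A t x e' \<Longrightarrow> e = e'"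
proof (rule ccontr)
  assume a: "converges A t x e" "converges A t x e'" "e \<noteq> e'"
  have "UNIV = {i::int. (x \<otimes> t [^] i \<in> A) \<noteq> e} \<union> {i. (x \<otimes> t [^] i \<in> A) \<noteq> e'}"
    using a(3) by auto
  then show False using a(1,2) infinite_UNIV_int unfolding converges_def by (metis finite_UnI)
qed

text \<open>The orbit map \<open>h\<close> of Z^2 is injective, so the finitely many elements where
  right multiplication by \<open>t\<close> or \<open>u\<close> changes membership account for
  finitely many grid edges, and \<open>grid_one_ended\<close> applies.\<close>

lemma independent_converges:
  assumes A: "almost_invariant A" and t: "t \<in> carrier G" and u: "u \<in> carrier G"
    and x: "x \<in> carrier G" and ind: "independent t u"
  shows "\<exists>e. converges A t x e \<and> converges A u x e"
proof -
  define h where "h = (\<lambda>(i::int, j::int). x \<otimes> t [^] i \<otimes> u [^] j)"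
  have hG: "h p \<in> carrier G" for p using t u x by (auto simp: h_def split: prod.split)
  have inj: "inj h" unfolding h_def using independent_inj[OF t u x ind] .
  define f where "f i j \<longleftrightarrow> h (i, j) \<in> A" for i j
  have "u [^] j \<otimes> t = t \<otimes> u [^] j" for j :: int
    using commutes_int_pow[OF u t] ind by (simp add: independent_def)
  then have ht: "h (i + 1, j) = h (i, j) \<otimes> t" for i j
    using t u x int_pow_mult[of t i 1] by (simp add: h_def m_assoc)
  have hu: "h (i, j + 1) = h (i, j) \<otimes> u" for i j
    using t u x int_pow_mult[of u j 1] by (simp add: h_def m_assoc)
  have fin: "finite {p. (h p \<in> A) \<noteq> (h p \<otimes> g \<in> A)}" if "g \<in> carrier G" for g
  proof -
    have "finite (h -` {x \<in> carrier G. (x \<in> A) \<noteq> (x \<otimes> g \<in> A)})"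
      using A that inj by (intro finite_vimageI) (auto simp: almost_invariant_def)
    moreover have "\<dots> = {p. (h p \<in> A) \<noteq> (h p \<otimes> g \<in> A)}" using hG by auto
    ultimately show ?thesis by simp
  qed
  have "{(i, j). f i j \<noteq> f (i + 1) j} = {p. (h p \<in> A) \<noteq> (h p \<otimes> t \<in> A)}"
       "{(i, j). f i j \<noteq> f i (j + 1)} = {p. (h p \<in> A) \<noteq> (h p \<otimes> u \<in> A)}"
    by (auto simp: f_def ht hu)
  then obtain e where "finite {i. f i 0 \<noteq> e} \<and> finite {j. f 0 j \<noteq> e}"
    using grid_one_ended[of f] fin[OF t] fin[OF u] by auto
  then show ?thesis using t u x by (auto simp: converges_def f_def h_def)
qed

lemma int_switch:
  fixes g :: "int \<Rightarrow> bool"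
  assumes "finite {i. g i \<noteq> e}" "g 0 \<noteq> e"
  shows "\<exists>i. g i \<noteq> e \<and> g (i + 1) = e"
proof -
  have "Max {i. g i \<noteq> e} \<in> {i. g i \<noteq> e}" using assms by (intro Max_in) auto
  moreover have "Max {i. g i \<noteq> e} + 1 \<notin> {i. g i \<noteq> e}"
    using Max_ge[OF assms(1)] by fastforce
  ultimately show ?thesis by blast
qed

text \<open>At a fixed \<open>x\<close> the limit is the same for all of \<open>T\<close> by the
  chain condition, and conjugation makes it independent of \<open>x\<close>. An element on the wrong
  side of \<open>e\<close> then lies on a line in direction \<open>t\<close> that switches to
  \<open>e\<close>; switches happen at finitely many elements, and each line has finitely many
  exceptions.\<close>

lemma almost_invariant_finite_or_cofinite:
  assumes A: "almost_invariant A" and T: "T \<subseteq> carrier G" "T \<noteq> {}"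
    and conj: "\<And>t g. t \<in> T \<Longrightarrow> g \<in> carrier G \<Longrightarrow> inv g \<otimes> t \<otimes> g \<in> T"
    and chain: "\<And>t u. t \<in> T \<Longrightarrow> u \<in> T \<Longrightarrow>
      \<exists>t'\<in>T. \<exists>u'\<in>T. independent t t' \<and> independent t' u' \<and> independent u' u"
  shows "finite A \<or> finite (carrier G - A)"
proof -
  have ind: "converges A u x e" if "t \<in> T" "u \<in> T" "x \<in> carrier G" "independent t u"
    "converges A t x e" for t u x e
    using independent_converges[OF A, of t u x] converges_unique that T(1) by blast
  have all: "converges A u x e" if "t \<in> T" "u \<in> T" "x \<in> carrier G" "converges A t x e" for t u x e
  proof -
    obtain t' u' where "t' \<in> T" "u' \<in> T" "independent t t'" "independent t' u'" "independent u' u"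
      using chain[OF \<open>t \<in> T\<close> \<open>u \<in> T\<close>] by blast
    then show ?thesis using ind that by metis
  qed
  obtain t where t: "t \<in> T" using T(2) by blast
  then have tG: "t \<in> carrier G" using T(1) by blast
  obtain t' where t': "t' \<in> T" "independent t t'" using chain[OF t t] by blast
  obtain e where e: "converges A t \<one> e"
    using independent_converges[OF A tG _ one_closed t'(2)] t'(1) T(1) by blast
  have conv: "converges A t x e" if x: "x \<in> carrier G" for x
  proof -
    \<comment> \<open>The line through \<open>x\<close> in direction \<open>s\<close> is the line of
      powers of \<open>t\<close>, translated on the right by \<open>x\<close>; almost invariance
      changes membership at only finitely many of its points.\<close>
    define s where "s = inv x \<otimes> t \<otimes> x"
    have sT: "s \<in> T" unfolding s_def using conj t x by blast
    have pow: "x \<otimes> s [^] i = t [^] i \<otimes> x" for i :: int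
    proof -
      have "inv x \<otimes> (t [^] i) \<otimes> x = s [^] i"
        using int_pow_conj[OF x tG] by (simp add: s_def)
      then have "x \<otimes> s [^] i = x \<otimes> (inv x \<otimes> (t [^] i) \<otimes> x)" by simp
      then show ?thesis using x tG by (simp add: m_assoc[symmetric])
    qed
    have sG: "s \<in> carrier G" using sT T(1) by blast
    obtain s' where s': "s' \<in> T" "independent s s'" using chain[OF sT sT] by blast
    obtain e' where e': "converges A s x e'"
      using independent_converges[OF A sG _ x s'(2)] s'(1) T(1) by blast
    have "finite {i::int. (t [^] i \<in> A) \<noteq> e}"
      using e tG by (simp add: converges_def)
    moreover have "finite {i::int. (t [^] i \<otimes> x \<in> A) \<noteq> e'}"
      using e' by (simp add: converges_def pow)
    moreover have "finite {i::int. (t [^] i \<in> A) \<noteq> (t [^] i \<otimes> x \<in> A)}"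
    proof -
      have "inj (\<lambda>i::int. t [^] i)"
      proof (rule injI)
        fix i j :: int assume "t [^] i = t [^] j"
        then have "(\<lambda>(i::int, j::int). \<one> \<otimes> t [^] i \<otimes> t' [^] j) (i, 0) =
          (\<lambda>(i::int, j::int). \<one> \<otimes> t [^] i \<otimes> t' [^] j) (j, 0)" by simp
        then show "i = j"
          using independent_inj[OF tG _ one_closed t'(2)] t'(1) T(1) by (meson Pair_inject injD subsetD)
      qed
      then have "finite ((\<lambda>i::int. t [^] i) -` {y \<in> carrier G. (y \<in> A) \<noteq> (y \<otimes> x \<in> A)})"
        using A x by (intro finite_vimageI) (auto simp: almost_invariant_def)
      moreover have "(\<lambda>i::int. t [^] i) -` {y \<in> carrier G. (y \<in> A) \<noteq> (y \<otimes> x \<in> A)} =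
        {i::int. (t [^] i \<in> A) \<noteq> (t [^] i \<otimes> x \<in> A)}" using tG by auto
      ultimately show ?thesis by simp
    qed
    \<comment> \<open>If \<open>e\<close> and \<open>e'\<close> differed, every integer would lie in
      one of these three finite sets.\<close>
    ultimately have fin: "finite ({i::int. (t [^] i \<in> A) \<noteq> e} \<union> {i. (t [^] i \<otimes> x \<in> A) \<noteq> e'} \<union>
       {i. (t [^] i \<in> A) \<noteq> (t [^] i \<otimes> x \<in> A)})" by blast
    have "e = e'"
    proof (rule ccontr)
      assume "e \<noteq> e'"
      then have "{i::int. (t [^] i \<in> A) \<noteq> e} \<union> {i. (t [^] i \<otimes> x \<in> A) \<noteq> e'} \<union>
        {i. (t [^] i \<in> A) \<noteq> (t [^] i \<otimes> x \<in> A)} = UNIV" by auto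
      with fin show False by (simp only: infinite_UNIV_int)
    qed
    then show ?thesis using all[OF sT t x] e' by simp
  qed
  define D where "D = {x \<in> carrier G. (x \<in> A) \<noteq> (x \<otimes> t \<in> A)}"
  have "finite D" using A tG by (simp add: D_def almost_invariant_def)
  have "{x \<in> carrier G. (x \<in> A) \<noteq> e} \<subseteq> (\<Union>y\<in>D. (\<lambda>i::int. y \<otimes> t [^] i) ` {i. (y \<otimes> t [^] i \<in> A) \<noteq> e})"
  proof
    fix x assume x: "x \<in> {x \<in> carrier G. (x \<in> A) \<noteq> e}"
    then obtain i :: int where i: "(x \<otimes> t [^] i \<in> A) \<noteq> e" "(x \<otimes> t [^] (i + 1) \<in> A) = e"
      using int_switch[of "\<lambda>i. x \<otimes> t [^] i \<in> A" e] conv[of x] by (auto simp: converges_def)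
    define y where "y = x \<otimes> t [^] i"
    have "y \<otimes> t = x \<otimes> t [^] (i + 1)"
      using x tG int_pow_mult[OF tG, of i 1] by (simp add: y_def m_assoc)
    then have "y \<in> D" using i x tG by (auto simp: D_def y_def)
    moreover have "x = y \<otimes> t [^] (- i)"
      using x tG int_pow_mult[OF tG, of i "- i"] by (simp add: y_def m_assoc)
    ultimately show "x \<in> (\<Union>y\<in>D. (\<lambda>i::int. y \<otimes> t [^] i) ` {i. (y \<otimes> t [^] i \<in> A) \<noteq> e})"
      using x by blast
  qed
  moreover have "finite (\<Union>y\<in>D. (\<lambda>i::int. y \<otimes> t [^] i) ` {i. (y \<otimes> t [^] i \<in> A) \<noteq> e})"
    using \<open>finite D\<close> conv by (auto simp: converges_def D_def)
  ultimately have "finite {x \<in> carrier G. (x \<in> A) \<noteq> e}" by (rule finite_subset)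
  moreover have "{x \<in> carrier G. (x \<in> A) \<noteq> e} = (if e then carrier G - A else A)"
    using A by (auto simp: almost_invariant_def)
  ultimately show ?thesis by (cases e) auto
qed

end

section \<open>Ends of Cayley graphs\<close>

lemma walk_avoiding_iff:
  "(\<exists>xs. walk E xs \<and> set xs \<inter> K = {} \<and> hd xs = u \<and> last xs = v) \<longleftrightarrow>
    u \<notin> K \<and> (\<lambda>x y. E x y \<and> x \<notin> K \<and> y \<notin> K)\<^sup>*\<^sup>* u v" (is "?L \<longleftrightarrow> ?R")
proof
  assume ?L
  then obtain xs where "walk E xs" "set xs \<inter> K = {}" "hd xs = u" "last xs = v" by blast
  then show ?R
  proof (induction xs arbitrary: u)
    case (Cons x xs)
    show ?case
    proof (cases "xs = []")
      case False
      then have "E x (hd xs)" "walk E xs" "hd xs \<in> set xs"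
        using Cons.prems(1) by (auto simp: walk_iff_successively successively_Cons)
      then show ?thesis using Cons False by (auto intro: converse_rtranclp_into_rtranclp)
    qed (use Cons in auto)
  qed (simp add: walk_def)
next
  assume R: ?R
  then have "(\<lambda>x y. E x y \<and> x \<notin> K \<and> y \<notin> K)\<^sup>*\<^sup>* u v" "u \<notin> K" by auto
  then show ?L
  proof (induction rule: rtranclp_induct)
    case base
    then show ?case using R by (intro exI[of _ "[u]"]) (auto simp: walk_def)
  next
    case (step y z)
    then obtain xs where "walk E xs" "set xs \<inter> K = {}" "hd xs = u" "last xs = y" by blast
    then show ?case using step.hyps
      by (intro exI[of _ "xs @ [z]"]) (auto simp: walk_iff_successively successively_append_iff)
  qed
qed

context group
begin

definition reach :: "'a set \<Rightarrow> 'a set \<Rightarrow> 'a \<Rightarrow> 'a \<Rightarrow> bool" where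
  "reach S K = (\<lambda>x y. cayley_adj G S x y \<and> x \<notin> K \<and> y \<notin> K)\<^sup>*\<^sup>*"

lemma cayley_adj_sym: "cayley_adj G S x y \<Longrightarrow> cayley_adj G S y x"
  by (auto simp: cayley_adj_def)

lemma reach_sym: "reach S K x y \<Longrightarrow> reach S K y x"
  unfolding reach_def
  by (rule sympD[OF symp_rtranclp]) (auto intro: sympI cayley_adj_sym)

lemma reach_trans: "reach S K x y \<Longrightarrow> reach S K y z \<Longrightarrow> reach S K x z"
  unfolding reach_def by (rule rtranclp_trans)

lemma reach_carrier: "reach S K x y \<Longrightarrow> x \<in> carrier G \<Longrightarrow> y \<in> carrier G"
  unfolding reach_def by (induction rule: rtranclp_induct) (auto simp: cayley_adj_def)

lemma reach_avoid: "reach S K x y \<Longrightarrow> x \<notin> K \<Longrightarrow> y \<notin> K"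
  unfolding reach_def by (induction rule: rtranclp_induct) auto

lemma cayley_components_eq:
  "cayley_components G S K = (\<lambda>u. {v. reach S K u v}) ` (carrier G - K)"
  unfolding cayley_components_def walk_avoiding_iff reach_def by auto

lemma finite_mult_preimage:
  assumes "finite F" "g \<in> carrier G"
  shows "finite {x \<in> carrier G. x \<otimes> g \<in> F}"
proof -
  have "{x \<in> carrier G. x \<otimes> g \<in> F} \<subseteq> (\<lambda>y. y \<otimes> inv g) ` F"
    using assms(2) by (force simp: m_assoc)
  then show ?thesis using assms(1) finite_subset by blast
qed

text \<open>An edge leaving a component has an endpoint in \<open>K\<close>, so a generator changes
  membership only at points of \<open>K\<close> or one step before \<open>K\<close>. Inverses and
  products follow by translating finite sets.\<close>

lemma almost_invariant_component:
  assumes S: "finite_generating_set G S" and K: "finite K" and A: "A \<in> cayley_components G S K"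
  shows "almost_invariant A"
proof -
  obtain u where u: "u \<in> carrier G" "u \<notin> K" "A = {v. reach S K u v}"
    using A by (auto simp: cayley_components_eq)
  have AG: "A \<subseteq> carrier G" using u reach_carrier by blast
  have SG: "S \<subseteq> carrier G" "generate G S = carrier G"
    using S by (auto simp: finite_generating_set_def)
  let ?D = "\<lambda>g. {x \<in> carrier G. (x \<in> A) \<noteq> (x \<otimes> g \<in> A)}"
  have step: "y \<in> A" if "x \<in> A" "cayley_adj G S x y" "y \<notin> K" for x y
  proof -
    have "x \<notin> K" using that(1) u reach_avoid by blast
    then show ?thesis using that u(3) unfolding reach_def by (auto intro: rtranclp.rtrancl_into_rtrancl)
  qed
  have gen: "finite (?D s)" if s: "s \<in> S" for s
  proof -
    have sG: "s \<in> carrier G" using s SG by blast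
    have "?D s \<subseteq> K \<union> {x \<in> carrier G. x \<otimes> s \<in> K}"
    proof
      fix x assume x: "x \<in> ?D s"
      then have "cayley_adj G S x (x \<otimes> s)" "cayley_adj G S (x \<otimes> s) x"
        using s sG by (auto simp: cayley_adj_def)
      then show "x \<in> K \<union> {x \<in> carrier G. x \<otimes> s \<in> K}" using x step by blast
    qed
    then show ?thesis using K finite_mult_preimage[OF K sG] finite_subset by blast
  qed
  have inv: "finite (?D (inv s))" if s: "s \<in> S" for s
  proof -
    have sG: "s \<in> carrier G" using s SG by blast
    have "?D (inv s) \<subseteq> {x \<in> carrier G. x \<otimes> inv s \<in> ?D s}"
      using sG by (auto simp: m_assoc)
    then show ?thesis using finite_mult_preimage[OF gen[OF s], of "inv s"] sG finite_subset by blast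
  qed
  have "g \<in> carrier G \<and> finite (?D g)" if "g \<in> generate G S" for g
    using that
  proof (induction rule: generate.induct)
    case one
    have "?D \<one> = {}" by auto
    then show ?case by (simp only: one_closed finite.emptyI simp_thms)
  next
    case (incl h)
    then show ?case using gen SG by blast
  next
    case (inv h)
    then show ?case using \<open>\<And>s. s \<in> S \<Longrightarrow> finite (?D (inv s))\<close> SG by blast
  next
    case (eng g h)
    then have gh: "g \<in> carrier G" "h \<in> carrier G" by auto
    have "?D (g \<otimes> h) \<subseteq> ?D g \<union> {x \<in> carrier G. x \<otimes> g \<in> ?D h}"
      using gh by (auto simp: m_assoc)
    moreover have "finite {x \<in> carrier G. x \<otimes> g \<in> ?D h}"
      using finite_mult_preimage[of "?D h" g] eng.IH gh by blast
    ultimately show ?case using eng.IH gh finite_subset by (meson finite_UnI m_closed)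
  qed
  then show ?thesis using AG SG by (auto simp: almost_invariant_def)
qed

lemma reach_all:
  assumes "finite_generating_set G S" "x \<in> carrier G" "y \<in> carrier G"
  shows "reach S {} x y"
proof -
  have SG: "S \<subseteq> carrier G" "generate G S = carrier G"
    using assms(1) by (auto simp: finite_generating_set_def)
  have "h \<in> carrier G \<and> (\<forall>g\<in>carrier G. reach S {} g (g \<otimes> h))" if "h \<in> generate G S" for h
    using that
  proof (induction rule: generate.induct)
    case (incl h)
    then have "cayley_adj G S g (g \<otimes> h)" if "g \<in> carrier G" for g
      using that SG by (auto simp: cayley_adj_def)
    then show ?case using incl SG by (auto simp: reach_def)
  next
    case (inv h)
    have "cayley_adj G S g (g \<otimes> inv h)" if "g \<in> carrier G" for g
    proof -
      have "h \<in> carrier G" using inv SG by blast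
      then have "g = (g \<otimes> inv h) \<otimes> h" using that by (simp add: m_assoc)
      then show ?thesis using that inv \<open>h \<in> carrier G\<close> by (auto simp: cayley_adj_def)
    qed
    then show ?case using inv SG by (auto simp: reach_def)
  next
    case (eng h1 h2)
    have "reach S {} g (g \<otimes> (h1 \<otimes> h2))" if g: "g \<in> carrier G" for g
    proof -
      have "reach S {} g (g \<otimes> h1)" "reach S {} (g \<otimes> h1) (g \<otimes> h1 \<otimes> h2)" using eng g by auto
      then have "reach S {} g (g \<otimes> h1 \<otimes> h2)" by (rule reach_trans)
      then show ?thesis using eng g by (simp add: m_assoc)
    qed
    then show ?case using eng by blast
  qed (simp add: reach_def)
  then have "reach S {} x (x \<otimes> (inv x \<otimes> y))" using SG assms by simp
  then show ?thesis using assms by (simp add: m_assoc[symmetric])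
qed

lemma finite_imp_bounded:
  assumes "finite_generating_set G S" "finite A" "A \<subseteq> carrier G"
  shows "cayley_bounded G S A"
proof -
  have "\<exists>xs. walk (cayley_adj G S) xs \<and> hd xs = \<one> \<and> last xs = x" if "x \<in> A" for x
    using reach_all[OF assms(1) one_closed, of x] that assms(3)
      walk_avoiding_iff[of "cayley_adj G S" "{}" \<one> x] by (auto simp: reach_def)
  then obtain p where p: "\<And>x. x \<in> A \<Longrightarrow> walk (cayley_adj G S) (p x) \<and> hd (p x) = \<one> \<and> last (p x) = x"
    by metis
  have "length (p x) \<le> Suc (Max ((\<lambda>x. length (p x)) ` A))" if "x \<in> A" for x
    using assms(2) that by (intro le_SucI Max_ge) auto
  then show ?thesis unfolding cayley_bounded_def using p by blast
qed

text \<open>Balls about the identity are finite, because each vertex has at most two neighbours per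
  generator.\<close>

lemma bounded_imp_finite:
  assumes S: "finite_generating_set G S" and A: "cayley_bounded G S A"
  shows "finite A"
proof -
  let ?B = "\<lambda>N. {x. \<exists>xs. walk (cayley_adj G S) xs \<and> hd xs = \<one> \<and> last xs = x \<and> length xs \<le> Suc N}"
  have SG: "S \<subseteq> carrier G" "finite S" using S by (auto simp: finite_generating_set_def)
  have nb: "finite {z. cayley_adj G S y z}" for y
  proof -
    have "{z. cayley_adj G S y z} \<subseteq> (\<lambda>s. y \<otimes> s) ` S \<union> (\<lambda>s. y \<otimes> inv s) ` S"
    proof
      fix z assume "z \<in> {z. cayley_adj G S y z}"
      then obtain s where "s \<in> S" "z \<in> carrier G" "z = y \<otimes> s \<or> y = z \<otimes> s"
        by (auto simp: cayley_adj_def)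
      moreover have "z = y \<otimes> inv s" if "y = z \<otimes> s" "s \<in> S" "z \<in> carrier G"
        using that SG by (auto simp: m_assoc)
      ultimately show "z \<in> (\<lambda>s. y \<otimes> s) ` S \<union> (\<lambda>s. y \<otimes> inv s) ` S" by blast
    qed
    then show ?thesis using SG finite_subset by blast
  qed
  have "finite (?B N)" for N
  proof (induction N)
    case 0
    have "?B 0 \<subseteq> {\<one>}"
    proof
      fix x assume "x \<in> ?B 0"
      then obtain xs where "xs \<noteq> []" "hd xs = \<one>" "last xs = x" "length xs \<le> 1"
        by (auto simp: walk_def)
      then show "x \<in> {\<one>}" by (cases xs) auto
    qed
    then show ?case using finite_subset by blast
  next
    case (Suc N)
    have "?B (Suc N) \<subseteq> ?B N \<union> (\<Union>y\<in>?B N. {z. cayley_adj G S y z})"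
    proof
      fix x assume "x \<in> ?B (Suc N)"
      then obtain xs where xs: "walk (cayley_adj G S) xs" "hd xs = \<one>" "last xs = x" "length xs \<le> Suc (Suc N)"
        by blast
      show "x \<in> ?B N \<union> (\<Union>y\<in>?B N. {z. cayley_adj G S y z})"
      proof (cases "length xs \<le> Suc N")
        case True
        then show ?thesis using xs by blast
      next
        case False
        then have "butlast xs \<noteq> []" by (cases xs rule: rev_cases) auto
        moreover have e: "xs = butlast xs @ [x]" using xs by (metis append_butlast_last_id walk_def)
        ultimately have "walk (cayley_adj G S) (butlast xs)" "hd (butlast xs) = \<one>"
          "cayley_adj G S (last (butlast xs)) x" "length (butlast xs) \<le> Suc N"
          using xs by (metis walk_iff_successively successively_append_iff list.sel(1) list.distinct(1),
              metis hd_append2, metis walk_iff_successively successively_append_iff list.sel(1) list.distinct(1),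
              simp)
        then show ?thesis by blast
      qed
    qed
    moreover have "finite (?B N \<union> (\<Union>y\<in>?B N. {z. cayley_adj G S y z}))"
      using Suc nb by blast
    ultimately show ?case by (rule finite_subset)
  qed
  moreover obtain N where "A \<subseteq> ?B N" using A unfolding cayley_bounded_def by blast
  ultimately show ?thesis using finite_subset by blast
qed

text \<open>An unbounded component is infinite, hence cofinite, so any two of them meet and
  coincide. Removing the empty set leaves one component, unbounded because the group is infinite;
  this gives the lower bound.\<close>

lemma num_ends_eq_1:
  assumes S: "finite_generating_set G S" and inf: "infinite (carrier G)"
    and triv: "\<And>A. almost_invariant A \<Longrightarrow> finite A \<or> finite (carrier G - A)"
  shows "num_ends G S = 1"
proof -
  define U where "U K = {C \<in> cayley_components G S K. \<not> cayley_bounded G S C}" for K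
  have eq: "C = D" if K: "finite K" and C: "C \<in> U K" and D: "D \<in> U K" for K C D
  proof -
    obtain u v where u: "u \<in> carrier G" "u \<notin> K" "C = {x. reach S K u x}"
      and v: "v \<in> carrier G" "v \<notin> K" "D = {x. reach S K v x}"
      using C D by (auto simp: U_def cayley_components_eq)
    have sub: "C \<subseteq> carrier G" "D \<subseteq> carrier G" using u v reach_carrier by blast+
    then have "infinite C" "infinite D"
      using C D finite_imp_bounded[OF S] by (auto simp: U_def)
    moreover have "finite (carrier G - C)"
      using triv[OF almost_invariant_component[OF S K, of C]] C \<open>infinite C\<close> by (auto simp: U_def)
    ultimately have "\<not> D \<subseteq> carrier G - C" using finite_subset by blast
    then obtain z where "reach S K u z" "reach S K v z" using sub u v by blast
    then have "reach S K u x \<longleftrightarrow> reach S K v x" for x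
      using reach_sym reach_trans by meson
    then show ?thesis using u v by simp
  qed
  have fin: "finite (U K) \<and> card (U K) \<le> 1" if K: "finite K" for K
  proof (cases "U K = {}")
    case False
    then have "\<exists>C. U K = {C}" using eq[OF K] by blast
    then show ?thesis by auto
  qed simp
  have "cayley_components G S {} = {carrier G}"
  proof -
    have "{v. reach S {} u v} = carrier G" if "u \<in> carrier G" for u
      using that reach_all[OF S] reach_carrier by blast
    then show ?thesis using one_closed by (force simp: cayley_components_eq)
  qed
  then have "U {} = {carrier G}"
    using bounded_imp_finite[OF S] inf by (auto simp: U_def)
  then have one: "card (U {}) = 1" "finite (U {})" by simp_all
  show ?thesis
    unfolding num_ends_def Let_def U_def[symmetric]
  proof (rule antisym)
    show "(SUP K\<in>{K. finite K}. if finite (U K) then enat (card (U K)) else \<infinity>) \<le> 1"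
      using fin by (intro SUP_least) (auto simp: one_enat_def)
    have "(1::enat) = (if finite (U {}) then enat (card (U {})) else \<infinity>)"
      using one by (simp add: one_enat_def)
    also have "\<dots> \<le> (SUP K\<in>{K. finite K}. if finite (U K) then enat (card (U K)) else \<infinity>)"
      by (rule SUP_upper) simp
    finally show "1 \<le> (SUP K\<in>{K. finite K}. if finite (U K) then enat (card (U K)) else \<infinity>)" .
  qed
qed

end

section \<open>Rectangles as tuples of words\<close>

text \<open>The contraction of [0,1) onto the numbers whose binary expansion starts with the given
  word.\<close>

fun word_map :: "bool list \<Rightarrow> real \<Rightarrow> real" where
  "word_map [] x = x"
| "word_map (b # w) x = (of_bool b + word_map w x) / 2"

lemma word_map_append: "word_map (u @ v) x = word_map u (word_map v x)"
  by (induction u) auto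

lemma word_map_affine: "word_map w x = word_map w 0 + x / 2 ^ length w"
  by (induction w) (auto simp: field_simps)

lemma word_map_bounds: "0 \<le> x \<Longrightarrow> x < 1 \<Longrightarrow> 0 \<le> word_map w x \<and> word_map w x < 1"
  by (induction w) (auto simp: of_bool_def)

lemma word_map_inj: "word_map w x = word_map w y \<longleftrightarrow> x = y"
  using word_map_affine[of w x] word_map_affine[of w y] by auto

lemma word_map_digit:
  assumes "0 \<le> x" "x < 1"
  shows "word_map (b # w) x < 1 / 2 \<longleftrightarrow> \<not> b"
  using word_map_bounds[OF assms, of w] by (auto simp: of_bool_def)

lemma word_map_cover:
  assumes "0 \<le> x" "x < 1"
  shows "\<exists>w y. length w = N \<and> 0 \<le> y \<and> y < 1 \<and> x = word_map w y"
  using assms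
proof (induction N arbitrary: x)
  case (Suc N)
  define b where "b \<longleftrightarrow> x \<ge> 1 / 2"
  have "0 \<le> 2 * x - of_bool b" "2 * x - of_bool b < 1" using Suc.prems by (auto simp: b_def)
  then obtain w y where w: "length w = N" "0 \<le> y" "y < 1" "2 * x - of_bool b = word_map w y"
    using Suc.IH by blast
  then have "x = word_map (b # w) y" by (simp flip: w(4))
  then show ?case using w by (intro exI[of _ "b # w"] exI[of _ y]) auto
qed auto

text \<open>Leading digits can be read off from the value, so equal values force the two words to
  agree as far as both reach.\<close>

lemma word_map_overlap:
  assumes "word_map u x = word_map v y" "0 \<le> x" "x < 1" "0 \<le> y" "y < 1"
  shows "\<not> u \<parallel> v"
  using assms(1)
proof (induction u arbitrary: v)
  case (Cons b u)
  show ?case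
  proof (cases v)
    case v: (Cons c v')
    have "b = c"
      using word_map_digit[OF assms(2,3), of b u] word_map_digit[OF assms(4,5), of c v'] Cons.prems
      unfolding v by metis
    moreover from this have "word_map u x = word_map v' y"
      using Cons.prems v by simp
    ultimately show ?thesis using Cons.IH v by (simp add: parallel_def)
  qed (simp add: parallel_def)
qed (simp add: parallel_def)

type_synonym mword = "nat \<Rightarrow> bool list"

definition app :: "mword \<Rightarrow> mword \<Rightarrow> mword" where
  "app w u = (\<lambda>k. w k @ u k)"

definition emb :: "mword \<Rightarrow> (nat \<Rightarrow> real) \<Rightarrow> (nat \<Rightarrow> real)" where
  "emb w x = (\<lambda>k. word_map (w k) (x k))"

text \<open>Prefix-incomparable words in a single coordinate already separate two rectangles,
  however the other coordinates overlap.\<close>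

definition incomp :: "mword \<Rightarrow> mword \<Rightarrow> bool" where
  "incomp w v \<longleftrightarrow> (\<exists>k. w k \<parallel> v k)"

definition rdata_of :: "mword \<Rightarrow> rdata" where
  "rdata_of w = (\<lambda>k. word_map (w k) 0, \<lambda>k. length (w k))"

lemma emb_app: "emb (app w u) x = emb w (emb u x)"
  by (simp add: emb_def app_def word_map_append)

lemma emb_inj: "emb w x = emb w y \<longleftrightarrow> x = y"
  by (auto simp: emb_def fun_eq_iff word_map_inj)

lemma incomp_sym: "incomp w v \<Longrightarrow> incomp v w"
  unfolding incomp_def using parallel_commute by blast

lemma incomp_app: "incomp w v \<Longrightarrow> incomp (app w u) (app v u')"
  unfolding incomp_def app_def by (meson parallel_append)

lemma incomp_app1: "incomp w v \<Longrightarrow> incomp (app w u) v"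
  and incomp_app2: "incomp w v \<Longrightarrow> incomp w (app v u)"
  unfolding incomp_def app_def by (metis parallel_append append_Nil2)+

lemma not_incomp_self: "\<not> incomp w w"
  by (simp add: incomp_def parallel_def)

lemma comparable_app:
  assumes "\<not> incomp w v" "\<And>k. length (w k) \<le> length (v k)"
  shows "v = app w (\<lambda>k. drop (length (w k)) (v k))"
proof
  fix k
  have "prefix (w k) (v k)"
  proof (cases "prefix (v k) (w k)")
    case True
    then show ?thesis using assms(2)[of k] by (auto simp: prefix_def)
  next
    case False
    then show ?thesis using assms(1) by (auto simp: incomp_def)
  qed
  then show "v k = app w (\<lambda>k. drop (length (w k)) (v k)) k"
    by (auto simp: app_def prefix_def)
qed

section \<open>Cells of the cube and maps that are affine on the cells of a grid\<close>

locale brin_thompson =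
  fixes n :: nat
  assumes n_pos: "n \<ge> 1"
begin

definition words :: "mword set" where
  "words = {w. \<forall>k\<ge>n. w k = []}"

definition cell :: "mword \<Rightarrow> (nat \<Rightarrow> real) set" where
  "cell w = emb w ` cube n"

text \<open>In binary digits, \<open>g\<close> replaces the prefix \<open>w\<close> by
  \<open>v\<close> in every coordinate and leaves the tails alone. Between \<open>words\<close> this
  is the action of \<open>rect_map\<close> on the corresponding rectangles.\<close>

definition aff :: "((nat \<Rightarrow> real) \<Rightarrow> nat \<Rightarrow> real) \<Rightarrow> mword \<Rightarrow> mword \<Rightarrow> bool" where
  "aff g w v \<longleftrightarrow> (\<forall>x\<in>cube n. g (emb w x) = emb v x)"

definition box :: "(nat \<Rightarrow> nat) \<Rightarrow> mword set" where
  "box l = {w \<in> words. \<forall>k<n. length (w k) = l k}"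

lemma app_words: "w \<in> words \<Longrightarrow> u \<in> words \<Longrightarrow> app w u \<in> words"
  by (simp add: words_def app_def)

lemma emb_cube: "w \<in> words \<Longrightarrow> x \<in> cube n \<Longrightarrow> emb w x \<in> cube n"
  using word_map_bounds by (auto simp: words_def cube_def emb_def)

lemma zero_cube: "(\<lambda>_. 0) \<in> cube n"
  by (simp add: cube_def)

lemma cell_subset: "w \<in> words \<Longrightarrow> cell w \<subseteq> cube n"
  using emb_cube by (auto simp: cell_def)

lemma cell_nonempty: "cell w \<noteq> {}"
  using zero_cube by (auto simp: cell_def)

lemma cell_app_subset: "u \<in> words \<Longrightarrow> cell (app w u) \<subseteq> cell w"
  using emb_cube by (auto simp: cell_def emb_app)

lemma cell_disjoint:
  assumes "incomp w v"
  shows "cell w \<inter> cell v = {}"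
proof (rule ccontr)
  assume "cell w \<inter> cell v \<noteq> {}"
  then obtain x y where xy: "x \<in> cube n" "y \<in> cube n" "emb w x = emb v y"
    by (auto simp: cell_def)
  obtain k where k: "w k \<parallel> v k" using assms by (auto simp: incomp_def)
  have "0 \<le> x k \<and> x k < 1" "0 \<le> y k \<and> y k < 1"
    using xy(1,2) unfolding cube_def by (metis (mono_tags, lifting) mem_Collect_eq linorder_not_le zero_less_one order_refl)+
  moreover have "word_map (w k) (x k) = word_map (v k) (y k)"
    using fun_cong[OF xy(3), of k] by (simp add: emb_def)
  ultimately show False using word_map_overlap k by blast
qed

lemma affD: "aff g w v \<Longrightarrow> x \<in> cube n \<Longrightarrow> g (emb w x) = emb v x"
  by (simp add: aff_def)

lemma aff_app: "aff g w v \<Longrightarrow> u \<in> words \<Longrightarrow> aff g (app w u) (app v u)"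
  using emb_cube by (simp add: aff_def emb_app)

lemma aff_comp: "aff g w v \<Longrightarrow> aff h v z \<Longrightarrow> aff (h \<circ> g) w z"
  by (simp add: aff_def)

lemma aff_cell: "aff g w v \<Longrightarrow> g ` cell w = cell v"
  by (auto simp: aff_def cell_def image_iff)

lemma cube_0_ends: "x \<in> cube n \<Longrightarrow> 0 \<le> x k \<and> x k < 1"
  by (cases "k < n") (auto simp: cube_def)

lemma box_cover:
  assumes "x \<in> cube n"
  shows "\<exists>w\<in>box l. x \<in> cell w"
proof -
  have "\<forall>k. \<exists>w y. length w = l k \<and> 0 \<le> y \<and> y < 1 \<and> x k = word_map w y"
    using word_map_cover cube_0_ends[OF assms] by blast
  then obtain W Y where WY: "\<And>k. length (W k) = l k \<and> 0 \<le> Y k \<and> Y k < 1 \<and> x k = word_map (W k) (Y k)"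
    by metis
  define w where "w k = (if k < n then W k else [])" for k
  define y where "y k = (if k < n then Y k else 0)" for k
  have "w \<in> box l" using WY by (auto simp: w_def box_def words_def)
  moreover have "y \<in> cube n" using WY by (auto simp: y_def cube_def)
  moreover have "x = emb w y"
    using WY assms by (auto simp: emb_def w_def y_def cube_def fun_eq_iff)
  ultimately show ?thesis by (auto simp: cell_def)
qed

lemma box_incomp:
  assumes "w \<in> box l" "v \<in> box l" "w \<noteq> v"
  shows "incomp w v"
proof -
  obtain k where k: "w k \<noteq> v k" using assms(3) by blast
  have "length (w k) = length (v k)"
    using assms(1,2) unfolding box_def words_def by (cases "k < n") auto
  then have "w k \<parallel> v k" using k by (metis parallelI prefix_length_prefix prefix_order.eq_iff le_refl
      append_eq_append_conv prefixE)
  then show ?thesis by (auto simp: incomp_def)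
qed

lemma finite_box: "finite (box l)"
proof -
  let ?L = "Max (l ` {..<n})"
  have "box l \<subseteq> {f. \<forall>k. (k \<in> {..<n} \<longrightarrow> f k \<in> {w. set w \<subseteq> UNIV \<and> length w \<le> ?L}) \<and> (k \<notin> {..<n} \<longrightarrow> f k = [])}"
    by (auto simp: box_def words_def)
  moreover have "finite \<dots>"
    by (intro finite_set_of_finite_funs finite_lists_length_le) auto
  ultimately show ?thesis by (rule finite_subset)
qed

definition max_level :: "mword \<Rightarrow> nat" where
  "max_level w = Max ((\<lambda>k. length (w k)) ` {..<n})"

lemma length_le_max_level: "w \<in> words \<Longrightarrow> length (w k) \<le> max_level w"
  by (cases "k < n") (auto simp: max_level_def words_def)

text \<open>A grid at least as fine as \<open>w\<close> in every coordinate has no cell crossing the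
  boundary of the cell of \<open>w\<close>.\<close>

lemma words_refine:
  assumes w: "w \<in> words" and v: "v \<in> box (\<lambda>_. N)" and le: "max_level w \<le> N"
    and meet: "cell w \<inter> cell v \<noteq> {}"
  shows "\<exists>u\<in>words. v = app w u"
proof -
  have "\<not> incomp w v" using meet cell_disjoint by blast
  moreover have "length (w k) \<le> length (v k)" for k
    using length_le_max_level[OF w, of k] le v w by (cases "k < n") (auto simp: box_def words_def)
  ultimately have "v = app w (\<lambda>k. drop (length (w k)) (v k))" by (rule comparable_app)
  moreover have "(\<lambda>k. drop (length (w k)) (v k)) \<in> words" using v by (auto simp: box_def words_def)
  ultimately show ?thesis by blast
qed

text \<open>A uniform grid replaces an arbitrary source pattern, since it can refine any finite
  cover by cells (\<open>piecewise_affineI\<close>). The target cells carry no condition here;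
  bijectivity of \<open>g\<close> will turn them into a pattern.\<close>

definition piecewise_affine :: "((nat \<Rightarrow> real) \<Rightarrow> nat \<Rightarrow> real) \<Rightarrow> bool" where
  "piecewise_affine g \<longleftrightarrow> (\<exists>N. \<forall>w\<in>box (\<lambda>_. N). \<exists>v\<in>words. aff g w v)"

lemma piecewise_affineI:
  assumes "finite W" "W \<subseteq> words" "cube n \<subseteq> (\<Union>w\<in>W. cell w)" "\<And>w. w \<in> W \<Longrightarrow> \<exists>v\<in>words. aff g w v"
  shows "piecewise_affine g"
proof -
  define N where "N = Max (max_level ` W)"
  have "\<exists>v\<in>words. aff g z v" if z: "z \<in> box (\<lambda>_. N)" for z
  proof -
    have "emb z (\<lambda>_. 0) \<in> cell z" using zero_cube by (auto simp: cell_def)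
    moreover have "z \<in> words" using z by (simp add: box_def)
    ultimately obtain w where w: "w \<in> W" "cell w \<inter> cell z \<noteq> {}"
      using assms(3) cell_subset by blast
    have "max_level w \<le> N" unfolding N_def using assms(1) w by simp
    then obtain u where u: "u \<in> words" "z = app w u" using words_refine w z assms(2) by blast
    then show ?thesis using assms(4)[OF w(1)] aff_app app_words by blast
  qed
  then show ?thesis by (auto simp: piecewise_affine_def)
qed

lemma piecewise_affine_comp:
  assumes g: "piecewise_affine g" and h: "piecewise_affine h"
  shows "piecewise_affine (h \<circ> g)"
proof -
  obtain N where N: "\<And>w. w \<in> box (\<lambda>_. N) \<Longrightarrow> \<exists>v\<in>words. aff g w v"
    using g by (auto simp: piecewise_affine_def)
  obtain M where M: "\<And>w. w \<in> box (\<lambda>_. M) \<Longrightarrow> \<exists>v\<in>words. aff h w v"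
    using h by (auto simp: piecewise_affine_def)
  \<comment> \<open>The first \<open>N\<close> digits serve \<open>g\<close>; the remaining
    \<open>M\<close> are carried along, so the image word has the \<open>M\<close> digits that
    \<open>h\<close> needs.\<close>
  have "\<exists>v\<in>words. aff (h \<circ> g) w v" if w: "w \<in> box (\<lambda>_. N + M)" for w
  proof -
    define w1 where "w1 k = take N (w k)" for k
    define w2 where "w2 k = drop N (w k)" for k
    have w12: "w = app w1 w2" by (simp add: w1_def w2_def app_def)
    have w1: "w1 \<in> box (\<lambda>_. N)" and w2: "w2 \<in> box (\<lambda>_. M)"
      using w by (auto simp: box_def words_def w1_def w2_def)
    obtain v where v: "v \<in> words" "aff g w1 v" using N[OF w1] by blast
    define z where "z = app v w2"
    have z: "aff g w z" "z \<in> words" unfolding w12 z_def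
      using aff_app[OF v(2)] app_words[OF v(1)] w2 by (auto simp: box_def)
    define z1 where "z1 k = take M (z k)" for k
    define z2 where "z2 k = drop M (z k)" for k
    have z12: "z = app z1 z2" by (simp add: z1_def z2_def app_def)
    have z1: "z1 \<in> box (\<lambda>_. M)" and z2: "z2 \<in> words"
      using w2 v by (auto simp: box_def words_def z1_def z2_def z_def app_def)
    obtain y where y: "y \<in> words" "aff h z1 y" using M[OF z1] by blast
    have "aff h z (app y z2)" unfolding z12 using aff_app[OF y(2) z2] .
    then show ?thesis using aff_comp[OF z(1)] app_words[OF y(1) z2] by blast
  qed
  then show ?thesis by (auto simp: piecewise_affine_def)
qed

section \<open>Translation between words and dyadic rectangle data\<close>

lemma dyadic_rdata_of:
  assumes "w \<in> words"
  shows "dyadic n (rdata_of w)"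
  using assms
proof (induction "\<Sum>k<n. length (w k)" arbitrary: w)
  case 0
  then have "w k = []" for k by (cases "k < n") (auto simp: words_def)
  then have "w = (\<lambda>_. [])" by blast
  then show ?case using dyadic.whole by (simp add: rdata_of_def)
next
  case (Suc m)
  then have "\<exists>k<n. w k \<noteq> []" by (metis (no_types, lifting) lessThan_iff list.size(3) nat.distinct(1) sum.neutral)
  then obtain k where k: "k < n" "w k \<noteq> []" by blast
  define v where "v = w(k := butlast (w k))"
  have wv: "w = v(k := v k @ [last (w k)])" using k by (auto simp: v_def fun_eq_iff)
  have "(\<Sum>i<n. length (w i)) = Suc (\<Sum>i<n. length (v i))"
    unfolding v_def using k
    by (subst (1 2) sum.remove[of _ k]) (auto intro!: sum.cong)
  then have "m = (\<Sum>i<n. length (v i))" using Suc.hyps(2) by simp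
  moreover have "v \<in> words" using Suc.prems k by (auto simp: v_def words_def)
  ultimately have d: "dyadic n (rdata_of v)" using Suc.hyps(1) by blast
  have half: "word_map (u @ [True]) 0 = word_map u 0 + (1 / 2) ^ Suc (length u)" for u
    using word_map_affine[of u "1 / 2"] by (simp add: word_map_append power_divide)
  show ?case
  proof (cases "last (w k)")
    case True
    then have "rdata_of w = ((fst (rdata_of v))(k := fst (rdata_of v) k + (1 / 2) ^ Suc (snd (rdata_of v) k)),
       (snd (rdata_of v))(k := Suc (snd (rdata_of v) k)))"
      by (subst wv) (auto simp: rdata_of_def fun_eq_iff half simp del: power_Suc)
    then show ?thesis using dyadic.upper[of n "fst (rdata_of v)" "snd (rdata_of v)"] d k by simp
  next
    case False
    then have "rdata_of w = (fst (rdata_of v), (snd (rdata_of v))(k := Suc (snd (rdata_of v) k)))"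
      by (subst wv) (auto simp: rdata_of_def fun_eq_iff word_map_append)
    then show ?thesis using dyadic.lower[of n "fst (rdata_of v)" "snd (rdata_of v)"] d k by simp
  qed
qed

lemma dyadic_imp_rdata_of: "dyadic n R \<Longrightarrow> \<exists>w\<in>words. R = rdata_of w"
proof (induction rule: dyadic.induct)
  case whole
  then show ?case by (intro bexI[of _ "\<lambda>_. []"]) (auto simp: rdata_of_def words_def)
next
  case (lower a j k)
  then obtain w where w: "w \<in> words" "(a, j) = rdata_of w" by blast
  then show ?case using lower.hyps
    by (intro bexI[of _ "w(k := w k @ [False])"]) (auto simp: rdata_of_def words_def word_map_append fun_eq_iff)
next
  case (upper a j k)
  then obtain w where w: "w \<in> words" "(a, j) = rdata_of w" by blast
  have half: "word_map (u @ [True]) 0 = word_map u 0 + (1 / 2) ^ Suc (length u)" for u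
    using word_map_affine[of u "1 / 2"] by (simp add: word_map_append power_divide)
  show ?case using upper.hyps w
    by (intro bexI[of _ "w(k := w k @ [True])"]) (auto simp: rdata_of_def words_def half fun_eq_iff simp del: power_Suc)
qed

lemma rect_rdata_of:
  assumes "w \<in> words"
  shows "rect n (rdata_of w) = cell w"
proof (intro equalityI subsetI)
  fix x assume x: "x \<in> rect n (rdata_of w)"
  define y where "y k = (x k - word_map (w k) 0) * 2 ^ length (w k)" for k
  have ge: "w k = []" "x k = 0" if "k \<ge> n" for k
    using x assms that by (auto simp: rect_def cube_def words_def)
  have "emb w y = x"
    unfolding emb_def y_def by (rule ext) (subst word_map_affine, simp)
  moreover have "y \<in> cube n"
    using x ge by (auto simp: cube_def rect_def rdata_of_def y_def power_divide field_simps)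
  ultimately show "x \<in> cell w" by (auto simp: cell_def)
next
  fix x assume "x \<in> cell w"
  then obtain y where y: "y \<in> cube n" "x = emb w y" by (auto simp: cell_def)
  have "word_map (w k) 0 \<le> x k \<and> x k < word_map (w k) 0 + (1 / 2) ^ length (w k)" for k
    using cube_0_ends[OF y(1), of k] word_map_affine[of "w k" "y k"]
    by (simp add: y(2) emb_def power_divide divide_strict_right_mono)
  then show "x \<in> rect n (rdata_of w)"
    using emb_cube[OF assms y(1)] y(2) by (auto simp: rect_def rdata_of_def)
qed

lemma rect_map_rdata_of:
  assumes "w \<in> words" "v \<in> words" "x \<in> cube n"
  shows "rect_map n (rdata_of w) (rdata_of v) (emb w x) = emb v x"
proof
  fix k
  show "rect_map n (rdata_of w) (rdata_of v) (emb w x) k = emb v x k"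
  proof (cases "k < n")
    case True
    have "(2::real) powr (real_of_int (int a - int b)) = 2 ^ a / 2 ^ b" for a b
      by (simp add: powr_diff powr_realpow)
    then have "rect_map n (rdata_of w) (rdata_of v) (emb w x) k =
        word_map (v k) 0 + 2 ^ length (w k) / 2 ^ length (v k) * (word_map (w k) (x k) - word_map (w k) 0)"
      using True by (simp add: rect_map_def rdata_of_def emb_def)
    also have "\<dots> = word_map (v k) 0 + x k / 2 ^ length (v k)"
      by (subst word_map_affine[of "w k" "x k"]) simp
    also have "\<dots> = emb v x k" by (simp add: emb_def flip: word_map_affine)
    finally show ?thesis .
  next
    case False
    then show ?thesis using assms by (simp add: rect_map_def emb_def words_def)
  qed
qed

text \<open>The grid serves as source pattern; its image cells are disjoint and cover the cube
  because \<open>g\<close> is a bijection.\<close>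

lemma nV_setI:
  assumes "\<And>x. x \<notin> cube n \<Longrightarrow> g x = x" "bij_betw g (cube n) (cube n)" "piecewise_affine g"
  shows "g \<in> nV_set n"
proof -
  obtain N f where N: "\<And>w. w \<in> box (\<lambda>_. N) \<Longrightarrow> f w \<in> words \<and> aff g w (f w)"
    using assms(3) unfolding piecewise_affine_def by metis
  obtain ws where ws: "set ws = box (\<lambda>_. N)" "distinct ws"
    using finite_distinct_list[OF finite_box] by blast
  have W: "ws ! i \<in> box (\<lambda>_. N)" "ws ! i \<in> words" "f (ws ! i) \<in> words" "aff g (ws ! i) (f (ws ! i))"
    if "i < length ws" for i
    using that N ws(1) nth_mem[OF that] unfolding box_def by auto
  have im: "g ` cell (ws ! i) = cell (f (ws ! i))" if "i < length ws" for i
    using aff_cell[OF W(4)[OF that]] .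
  have dis: "cell (ws ! i) \<inter> cell (ws ! j) = {}" if "i < length ws" "j < length ws" "i \<noteq> j" for i j
    using that W(1) ws(2) by (intro cell_disjoint box_incomp) (auto simp: nth_eq_iff_index_eq)
  have cov: "(\<Union>i<length ws. cell (ws ! i)) = cube n"
  proof
    show "(\<Union>i<length ws. cell (ws ! i)) \<subseteq> cube n" using W(2) cell_subset by blast
    show "cube n \<subseteq> (\<Union>i<length ws. cell (ws ! i))"
    proof
      fix x assume "x \<in> cube n"
      then obtain w where "w \<in> set ws" "x \<in> cell w" using box_cover[of x "\<lambda>_. N"] ws(1) by blast
      then show "x \<in> (\<Union>i<length ws. cell (ws ! i))" by (auto simp: in_set_conv_nth)
    qed
  qed
  have dis': "cell (f (ws ! i)) \<inter> cell (f (ws ! j)) = {}" if "i < length ws" "j < length ws" "i \<noteq> j" for i j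
  proof -
    have "g ` (cell (ws ! i) \<inter> cell (ws ! j)) = g ` cell (ws ! i) \<inter> g ` cell (ws ! j)"
      using assms(2) cell_subset[OF W(2)] that by (intro inj_on_image_Int) (auto simp: bij_betw_def)
    then show ?thesis using im that dis by simp
  qed
  have cov': "(\<Union>i<length ws. cell (f (ws ! i))) = cube n"
  proof -
    have "(\<Union>i<length ws. cell (f (ws ! i))) = (\<Union>i<length ws. g ` cell (ws ! i))"
      using im by simp
    also have "\<dots> = g ` cube n" using cov by blast
    finally show ?thesis using assms(2) by (simp add: bij_betw_def)
  qed
  have "numbered_pattern n (map rdata_of ws)"
    unfolding numbered_pattern_def using W(2) dis cov by (simp add: dyadic_rdata_of rect_rdata_of)
  moreover have "numbered_pattern n (map (rdata_of \<circ> f) ws)"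
    unfolding numbered_pattern_def using W(3) dis' cov' by (simp add: dyadic_rdata_of rect_rdata_of)
  moreover have "g x = rect_map n (map rdata_of ws ! i) (map (rdata_of \<circ> f) ws ! i) x"
    if "i < length ws" "x \<in> rect n (map rdata_of ws ! i)" for i x
  proof -
    have "x \<in> cell (ws ! i)" using that W(2) by (simp add: rect_rdata_of)
    then obtain y where y: "y \<in> cube n" "x = emb (ws ! i) y" by (auto simp: cell_def)
    then show ?thesis
      using W that rect_map_rdata_of by (simp add: affD)
  qed
  ultimately show ?thesis
    unfolding nV_set_def using assms(1)
    by (intro CollectI exI[of _ "map rdata_of ws"] exI[of _ "map (rdata_of \<circ> f) ws"]) auto
qed

lemma pattern_words:
  assumes "numbered_pattern n P"
  shows "\<exists>ws. length ws = length P \<and> (\<forall>i<length P. ws ! i \<in> words \<and> P ! i = rdata_of (ws ! i))"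
proof -
  have "dyadic n (P ! i)" if "i < length P" for i
    using assms that by (simp add: numbered_pattern_def)
  then have "\<forall>i. \<exists>w. i < length P \<longrightarrow> w \<in> words \<and> P ! i = rdata_of w"
    using dyadic_imp_rdata_of by blast
  then obtain f where "\<forall>i. i < length P \<longrightarrow> f i \<in> words \<and> P ! i = rdata_of (f i)"
    using choice[of "\<lambda>i w. i < length P \<longrightarrow> w \<in> words \<and> P ! i = rdata_of w"] by blast
  then show ?thesis by (intro exI[of _ "map f [0..<length P]"]) simp
qed

lemma nV_setD:
  assumes "g \<in> nV_set n"
  shows "x \<notin> cube n \<Longrightarrow> g x = x" "bij_betw g (cube n) (cube n)" "piecewise_affine g"
proof -
  obtain P Q where P: "numbered_pattern n P" and Q: "numbered_pattern n Q" and len: "length P = length Q"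
    and g: "\<And>i x. i < length P \<Longrightarrow> x \<in> rect n (P ! i) \<Longrightarrow> g x = rect_map n (P ! i) (Q ! i) x"
    and off: "\<And>x. x \<notin> cube n \<Longrightarrow> g x = x"
    using assms unfolding nV_set_def by blast
  show "x \<notin> cube n \<Longrightarrow> g x = x" by (rule off)
  obtain ws where ws: "length ws = length P" "\<And>i. i < length P \<Longrightarrow> ws ! i \<in> words \<and> P ! i = rdata_of (ws ! i)"
    using pattern_words[OF P] by blast
  obtain vs where vs: "length vs = length P" "\<And>i. i < length P \<Longrightarrow> vs ! i \<in> words \<and> Q ! i = rdata_of (vs ! i)"
    using pattern_words[OF Q] len by metis
  have aff: "aff g (ws ! i) (vs ! i)" if "i < length P" for i
    unfolding aff_def
  proof
    fix x assume x: "x \<in> cube n"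
    then have "emb (ws ! i) x \<in> rect n (P ! i)"
      using ws that by (simp add: rect_rdata_of cell_def)
    then show "g (emb (ws ! i) x) = emb (vs ! i) x"
      using g[OF that] ws(2)[OF that] vs(2)[OF that] rect_map_rdata_of x by simp
  qed
  have covw: "(\<Union>i<length P. cell (ws ! i)) = cube n"
    using P ws(2) unfolding numbered_pattern_def by (simp add: rect_rdata_of)
  have covv: "(\<Union>i<length P. cell (vs ! i)) = cube n"
    using Q vs(2) len unfolding numbered_pattern_def by (simp add: rect_rdata_of)
  have disv: "cell (vs ! i) \<inter> cell (vs ! j) = {}" if "i < length P" "j < length P" "i \<noteq> j" for i j
    using Q vs(2) len that unfolding numbered_pattern_def by (simp add: rect_rdata_of)
  have ex: "\<exists>i x'. i < length P \<and> x' \<in> cube n \<and> x = emb (ws ! i) x'" if "x \<in> cube n" for x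
  proof -
    have "x \<in> (\<Union>i<length P. cell (ws ! i))" using that covw by blast
    then show ?thesis by (auto simp: cell_def)
  qed
  show "bij_betw g (cube n) (cube n)"
    unfolding bij_betw_def
  proof
    show "inj_on g (cube n)"
    proof (rule inj_onI)
      fix x y assume xy: "x \<in> cube n" "y \<in> cube n" "g x = g y"
      obtain i x' where i: "i < length P" "x' \<in> cube n" "x = emb (ws ! i) x'"
        using ex[OF xy(1)] by blast
      obtain j y' where j: "j < length P" "y' \<in> cube n" "y = emb (ws ! j) y'"
        using ex[OF xy(2)] by blast
      have eq: "emb (vs ! i) x' = emb (vs ! j) y'"
        using affD[OF aff[OF i(1)] i(2)] affD[OF aff[OF j(1)] j(2)] xy(3) i j by simp
      then have "i = j"
        using disv[OF i(1) j(1)] i(2) j(2) unfolding cell_def by (metis disjoint_iff imageI)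
      then show "x = y" using eq i j by (simp add: emb_inj)
    qed
    have "g ` cube n = (\<Union>i<length P. g ` cell (ws ! i))" using covw by blast
    also have "\<dots> = (\<Union>i<length P. cell (vs ! i))" using aff_cell[OF aff] by simp
    finally show "g ` cube n = cube n" using covv by simp
  qed
  show "piecewise_affine g"
  proof (rule piecewise_affineI[of "(!) ws ` {..<length P}"])
    show "(!) ws ` {..<length P} \<subseteq> words" using ws(2) by auto
    show "cube n \<subseteq> (\<Union>w\<in>(!) ws ` {..<length P}. cell w)" using covw by simp
    show "\<exists>v\<in>words. aff g w v" if "w \<in> (!) ws ` {..<length P}" for w
      using that aff vs(2) by blast
  qed simp
qed

section \<open>The group structure of \<open>nV n\<close>\<close>

lemma carrier_nV: "carrier (nV n) = nV_set n"
  and mult_nV: "g \<otimes>\<^bsub>nV n\<^esub> h = g \<circ> h"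
  and one_nV: "\<one>\<^bsub>nV n\<^esub> = id"
  by (simp_all add: nV_def)

lemma nV_inverse:
  assumes g: "g \<in> nV_set n"
  shows "\<exists>h\<in>nV_set n. h \<circ> g = id"
proof -
  define h where "h x = (if x \<in> cube n then inv_into (cube n) g x else x)" for x
  have bij: "bij_betw g (cube n) (cube n)" by (rule nV_setD(2)[OF g])
  have hg: "h (g x) = x" for x
  proof (cases "x \<in> cube n")
    case True
    then show ?thesis using bij by (auto simp: h_def bij_betw_def inv_into_f_f)
  qed (simp add: h_def nV_setD(1)[OF g])
  have "h \<in> nV_set n"
  proof (rule nV_setI)
    show "bij_betw h (cube n) (cube n)"
      using bij_betw_inv_into[OF bij] by (rule bij_betw_cong[THEN iffD1, rotated]) (simp add: h_def)
    obtain N f where N: "\<And>w. w \<in> box (\<lambda>_. N) \<Longrightarrow> f w \<in> words \<and> aff g w (f w)"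
      using nV_setD(3)[OF g] unfolding piecewise_affine_def by metis
    show "piecewise_affine h"
    proof (rule piecewise_affineI[of "f ` box (\<lambda>_. N)"])
      show "finite (f ` box (\<lambda>_. N))" using finite_box by simp
      show "f ` box (\<lambda>_. N) \<subseteq> words" using N by blast
      have "cube n = g ` cube n" using bij by (simp add: bij_betw_def)
      also have "\<dots> \<subseteq> (\<Union>w\<in>box (\<lambda>_. N). g ` cell w)" using box_cover by blast
      also have "\<dots> = (\<Union>w\<in>f ` box (\<lambda>_. N). cell w)" using N aff_cell by fastforce
      finally show "cube n \<subseteq> (\<Union>w\<in>f ` box (\<lambda>_. N). cell w)" .
      show "\<exists>v\<in>words. aff h w v" if w: "w \<in> f ` box (\<lambda>_. N)" for w
      proof -
        obtain z where z: "z \<in> box (\<lambda>_. N)" "w = f z" using w by auto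
        then have "aff h w z" using N[OF z(1)] hg unfolding aff_def by metis
        then show ?thesis using z(1) by (auto simp: box_def)
      qed
    qed
  qed (simp add: h_def)
  then show ?thesis using hg by (auto simp: fun_eq_iff)
qed

lemma nV_comp:
  assumes "g \<in> nV_set n" "h \<in> nV_set n"
  shows "g \<circ> h \<in> nV_set n"
  using assms nV_setD by (intro nV_setI bij_betw_trans piecewise_affine_comp) auto

lemma nV_id: "id \<in> nV_set n"
  by (intro nV_setI) (auto simp: piecewise_affine_def aff_def box_def)

sublocale nV: group "nV n"
proof (rule groupI)
  show "\<exists>y\<in>carrier (nV n). y \<otimes>\<^bsub>nV n\<^esub> x = \<one>\<^bsub>nV n\<^esub>" if "x \<in> carrier (nV n)" for x
    using that nV_inverse by (simp add: carrier_nV mult_nV one_nV)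
qed (auto simp: carrier_nV mult_nV one_nV nV_comp nV_id comp_assoc)

text \<open>By injectivity \<open>h\<close> preserves \<open>A\<close> and \<open>f\<close>
  preserves the complement, and on each of these two sets one of the maps is the identity.\<close>

lemma commute_disjoint_support:
  assumes "f \<in> nV_set n" "h \<in> nV_set n" "\<And>x. x \<in> A \<Longrightarrow> f x = x" "\<And>x. x \<notin> A \<Longrightarrow> h x = x"
  shows "f \<circ> h = h \<circ> f"
proof
  fix x
  have inj: "inj g" if g: "g \<in> nV_set n" for g
  proof -
    obtain g' where "g' \<circ> g = id" using nV_inverse[OF g] by blast
    then show ?thesis by (metis inj_on_id inj_on_imageI2)
  qed
  show "(f \<circ> h) x = (h \<circ> f) x"
  proof (cases "x \<in> A")
    case True
    then have "h x \<in> A" using assms(4)[of "h x"] injD[OF inj[OF assms(2)]] by metis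
    then show ?thesis using True assms(3) by simp
  next
    case False
    then have "f x \<notin> A" using assms(3)[of "f x"] injD[OF inj[OF assms(1)]] by metis
    then show ?thesis using False assms(4) by simp
  qed
qed

end

section \<open>Swaps and baker's maps\<close>

text \<open>Appending this to a word passes to one half of its rectangle in direction
  \<open>k\<close>.\<close>

definition digit :: "nat \<Rightarrow> bool \<Rightarrow> mword" where
  "digit k b = (\<lambda>i. if i = k then [b] else [])"

lemma incomp_digit: "b \<noteq> c \<Longrightarrow> incomp (app w (digit k b)) (app w (digit k c))"
  unfolding incomp_def app_def digit_def by (intro exI[of _ k]) (simp add: parallel_def)

lemma app_assoc: "app (app u v) w = app u (app v w)"
  by (simp add: app_def)

lemma app_digit_commute: "k \<noteq> l \<Longrightarrow> app (digit k b) (digit l c) = app (digit l c) (digit k b)"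
  by (auto simp: app_def digit_def fun_eq_iff)

context brin_thompson
begin

lemma digit_words: "k < n \<Longrightarrow> digit k b \<in> words"
  by (simp add: words_def digit_def)

lemma digit_cover:
  assumes "x \<in> cube n" "k < n"
  shows "\<exists>b. \<exists>y\<in>cube n. x = emb (digit k b) y"
proof -
  define b where "b \<longleftrightarrow> x k \<ge> 1 / 2"
  define y where "y = x(k := 2 * x k - of_bool b)"
  have "x = emb (digit k b) y" by (auto simp: emb_def digit_def y_def)
  moreover have "y \<in> cube n" using assms by (auto simp: cube_def y_def b_def)
  ultimately show ?thesis by blast
qed

section \<open>Swaps, copies inside a rectangle, and baker's maps\<close>

definition unemb :: "mword \<Rightarrow> (nat \<Rightarrow> real) \<Rightarrow> (nat \<Rightarrow> real)" where
  "unemb w x = (THE y. emb w y = x)"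

lemma unemb_emb [simp]: "unemb w (emb w x) = x"
  by (simp add: unemb_def emb_inj)

definition swp :: "mword \<Rightarrow> mword \<Rightarrow> (nat \<Rightarrow> real) \<Rightarrow> (nat \<Rightarrow> real)" where
  "swp w v x = (if x \<in> cell w then emb v (unemb w x)
     else if x \<in> cell v then emb w (unemb v x) else x)"

lemma emb_in_cell: "x \<in> cube n \<Longrightarrow> emb w x \<in> cell w"
  by (simp add: cell_def)

lemma emb_not_in_cell: "x \<in> cube n \<Longrightarrow> incomp w v \<Longrightarrow> emb w x \<notin> cell v"
  using cell_disjoint emb_in_cell by blast

lemma swp_left: "aff (swp w v) w v"
  by (simp add: aff_def swp_def emb_in_cell)

lemma swp_right: "incomp w v \<Longrightarrow> aff (swp w v) v w"
  using emb_not_in_cell incomp_sym by (simp add: aff_def swp_def emb_in_cell)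

lemma swp_outside: "x \<notin> cell w \<Longrightarrow> x \<notin> cell v \<Longrightarrow> swp w v x = x"
  by (simp add: swp_def)

lemma swp_fix: "incomp z w \<Longrightarrow> incomp z v \<Longrightarrow> aff (swp w v) z z"
  using emb_not_in_cell by (simp add: aff_def swp_def)

lemma swp_cases:
  obtains y where "y \<in> cube n" "x = emb w y" | y where "y \<in> cube n" "x = emb v y"
  | "x \<notin> cell w" "x \<notin> cell v"
  by (auto simp: cell_def)

lemma swp_swp:
  assumes "incomp w v"
  shows "swp w v (swp w v x) = x"
  by (rule swp_cases[where x = x and w = w and v = v])
    (use affD[OF swp_left[of w v]] affD[OF swp_right[OF assms]] in \<open>simp_all add: swp_outside\<close>)

lemma swp_in_nV:
  assumes "w \<in> words" "v \<in> words" "incomp w v"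
  shows "swp w v \<in> nV_set n"
proof (rule nV_setI)
  show "swp w v x = x" if "x \<notin> cube n" for x
    using that assms(1,2) cell_subset by (intro swp_outside) auto
  have sub: "swp w v x \<in> cube n" if "x \<in> cube n" for x
    by (rule swp_cases[where x = x and w = w and v = v])
      (use that assms emb_cube affD[OF swp_left[of w v]] affD[OF swp_right[OF assms(3)]]
        in \<open>auto simp: swp_outside\<close>)
  show "bij_betw (swp w v) (cube n) (cube n)"
    by (rule bij_betwI[of _ _ _ "swp w v"]) (use sub swp_swp[OF assms(3)] in auto)
  define N where "N = max (max_level w) (max_level v)"
  have "\<exists>y\<in>words. aff (swp w v) z y" if z: "z \<in> box (\<lambda>_. N)" for z
  proof -
    have zw: "z \<in> words" using z by (simp add: box_def)
    consider "cell w \<inter> cell z \<noteq> {}" | "cell v \<inter> cell z \<noteq> {}" | "cell w \<inter> cell z = {}" "cell v \<inter> cell z = {}"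
      by blast
    then show ?thesis
    proof cases
      case 1
      then obtain u where "u \<in> words" "z = app w u"
        using words_refine[OF assms(1) z] by (auto simp: N_def)
      then show ?thesis using aff_app[OF swp_left] app_words assms(2) by blast
    next
      case 2
      then obtain u where "u \<in> words" "z = app v u"
        using words_refine[OF assms(2) z] by (auto simp: N_def)
      then show ?thesis using aff_app[OF swp_right[OF assms(3)]] app_words assms(1) by blast
    next
      case 3
      then have "aff (swp w v) z z"
        using emb_in_cell[of _ z] unfolding aff_def by (meson disjoint_iff swp_outside)
      then show ?thesis using zw by blast
    qed
  qed
  then show "piecewise_affine (swp w v)" by (auto simp: piecewise_affine_def)
qed

lemma nV_cube: "g \<in> nV_set n \<Longrightarrow> x \<in> cube n \<Longrightarrow> g x \<in> cube n"
  using nV_setD(2) unfolding bij_betw_def by blast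

lemma nV_not_in_cell:
  assumes "h \<in> nV_set n" "w \<in> words" "w' \<in> words" "aff h w w'" "x \<notin> cell w"
  shows "h x \<notin> cell w'"
proof (cases "x \<in> cube n")
  case True
  show ?thesis
  proof
    assume "h x \<in> cell w'"
    then obtain y where y: "y \<in> cube n" "h x = h (emb w y)"
      using affD[OF assms(4)] by (auto simp: cell_def)
    then have "x = emb w y"
      using nV_setD(2)[OF assms(1)] True emb_cube[OF assms(2) y(1)]
      unfolding bij_betw_def by (meson inj_onD)
    then show False using assms(5) emb_in_cell y(1) by blast
  qed
next
  case False
  then show ?thesis using nV_setD(1)[OF assms(1)] cell_subset[OF assms(3)] by auto
qed

text \<open>The conjugation formula for swaps, written without inverses. If \<open>h\<close> is not
  affine on both cells, the conjugate need not be a single swap, which is why swaps are split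
  elsewhere.\<close>

lemma swp_conj:
  assumes "h \<in> nV_set n" "w \<in> words" "v \<in> words" "w' \<in> words" "v' \<in> words"
    "incomp w v" "incomp w' v'" "aff h w w'" "aff h v v'"
  shows "h \<circ> swp w v = swp w' v' \<circ> h"
proof
  fix x
  show "(h \<circ> swp w v) x = (swp w' v' \<circ> h) x"
  proof (rule swp_cases[where x = x and w = w and v = v])
    fix y assume "y \<in> cube n" "x = emb w y"
    then show ?thesis
      using affD[OF swp_left] affD[OF assms(8)] affD[OF assms(9)] by simp
  next
    fix y assume "y \<in> cube n" "x = emb v y"
    then show ?thesis
      using affD[OF swp_right[OF assms(6)]] affD[OF swp_right[OF assms(7)]]
        affD[OF assms(8)] affD[OF assms(9)] by simp
  next
    assume "x \<notin> cell w" "x \<notin> cell v"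
    then show ?thesis
      using nV_not_in_cell assms by (simp add: swp_outside)
  qed
qed

text \<open>Trades a swap of large rectangles for swaps of deeper ones, on which other elements are
  affine.\<close>

lemma swp_split:
  assumes "k < n" "incomp w v"
  shows "swp w v = swp (app w (digit k False)) (app v (digit k False)) \<circ>
    swp (app w (digit k True)) (app v (digit k True))"
    (is "_ = ?s0 \<circ> ?s1")
proof
  fix x
  have inc: "incomp (app w (digit k b)) (app v (digit k c))" for b c
    by (rule incomp_app[OF assms(2)])
  note inc' = inc[THEN incomp_sym]
  have ww: "incomp (app u (digit k b)) (app u (digit k (\<not> b)))" for u b
    by (rule incomp_digit) simp
  note L = affD[OF swp_left] and R = affD[OF swp_right[OF inc]]
  note F = affD[OF swp_fix]
  show "swp w v x = (?s0 \<circ> ?s1) x"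
  proof (rule swp_cases[where x = x and w = w and v = v])
    fix y assume y: "y \<in> cube n" "x = emb w y"
    then obtain b z where z: "z \<in> cube n" "y = emb (digit k b) z" using digit_cover assms(1) by blast
    then have x: "x = emb (app w (digit k b)) z" using y by (simp add: emb_app)
    have "swp w v x = emb (app v (digit k b)) z"
      using L[OF y(1)] y z by (simp add: emb_app)
    moreover have "(?s0 \<circ> ?s1) x = emb (app v (digit k b)) z"
      using L[OF z(1)] F[OF _ _ z(1)] inc inc' ww[of _ False] ww[of _ True] x by (cases b) simp_all
    ultimately show ?thesis by simp
  next
    fix y assume y: "y \<in> cube n" "x = emb v y"
    then obtain b z where z: "z \<in> cube n" "y = emb (digit k b) z" using digit_cover assms(1) by blast
    then have x: "x = emb (app v (digit k b)) z" using y by (simp add: emb_app)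
    have "swp w v x = emb (app w (digit k b)) z"
      using affD[OF swp_right[OF assms(2)] y(1)] y z by (simp add: emb_app)
    moreover have "(?s0 \<circ> ?s1) x = emb (app w (digit k b)) z"
      using R[OF z(1)] F[OF _ _ z(1)] inc inc' ww[of _ False] ww[of _ True] x by (cases b) simp_all
    ultimately show ?thesis by simp
  next
    assume "x \<notin> cell w" "x \<notin> cell v"
    then show ?thesis
      using cell_app_subset[OF digit_words[OF assms(1)]] by (simp add: swp_outside subset_iff) (metis swp_outside subsetD)
  qed
qed

text \<open>A scaled copy of \<open>f\<close> acting inside one rectangle; this supplies baker's
  maps of every size and elements of infinite order with prescribed support.\<close>

definition transplant :: "mword \<Rightarrow> ((nat \<Rightarrow> real) \<Rightarrow> nat \<Rightarrow> real) \<Rightarrow> (nat \<Rightarrow> real) \<Rightarrow> nat \<Rightarrow> real" where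
  "transplant w f x = (if x \<in> cell w then emb w (f (unemb w x)) else x)"

lemma transplant_emb: "x \<in> cube n \<Longrightarrow> transplant w f (emb w x) = emb w (f x)"
  by (simp add: transplant_def emb_in_cell)

lemma transplant_outside: "x \<notin> cell w \<Longrightarrow> transplant w f x = x"
  by (simp add: transplant_def)

lemma aff_transplant: "aff f u v \<Longrightarrow> u \<in> words \<Longrightarrow> aff (transplant w f) (app w u) (app w v)"
  using emb_cube by (simp add: aff_def emb_app transplant_emb)

lemma transplant_fix: "incomp v w \<Longrightarrow> aff (transplant w f) v v"
  using emb_not_in_cell by (simp add: aff_def transplant_outside)

lemma transplant_in_nV:
  assumes w: "w \<in> words" and f: "f \<in> nV_set n"
  shows "transplant w f \<in> nV_set n"
proof (rule nV_setI)
  show off: "transplant w f x = x" if "x \<notin> cube n" for x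
    using that w cell_subset by (intro transplant_outside) auto
  obtain h where h: "h \<in> nV_set n" "h \<circ> f = id" using nV_inverse f by blast
  have fc: "f x \<in> cube n" if "x \<in> cube n" for x
    using nV_cube[OF f that] .
  show "bij_betw (transplant w f) (cube n) (cube n)"
    unfolding bij_betw_def
  proof
    show "inj_on (transplant w f) (cube n)"
    proof (rule inj_on_inverseI)
      fix x assume "x \<in> cube n"
      show "transplant w h (transplant w f x) = x"
      proof (cases "x \<in> cell w")
        case True
        then obtain y where "y \<in> cube n" "x = emb w y" by (auto simp: cell_def)
        moreover have "h (f y) = y" using h(2) by (metis comp_apply id_apply)
        ultimately show ?thesis using fc by (simp add: transplant_emb)
      qed (simp add: transplant_outside)
    qed
    show "transplant w f ` cube n = cube n"
    proof (intro equalityI subsetI)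
      fix x assume "x \<in> transplant w f ` cube n"
      then obtain z where z: "z \<in> cube n" "x = transplant w f z" by blast
      show "x \<in> cube n"
      proof (cases "z \<in> cell w")
        case True
        then obtain y where "y \<in> cube n" "z = emb w y" by (auto simp: cell_def)
        then show ?thesis using z fc emb_cube[OF w] by (simp add: transplant_emb)
      qed (use z in \<open>simp add: transplant_outside\<close>)
    next
      fix x assume x: "x \<in> cube n"
      show "x \<in> transplant w f ` cube n"
      proof (cases "x \<in> cell w")
        case True
        then obtain y where y: "y \<in> cube n" "x = emb w y" by (auto simp: cell_def)
        then obtain z where "z \<in> cube n" "y = f z"
          using nV_setD(2)[OF f] unfolding bij_betw_def by blast
        then show ?thesis using y emb_cube[OF w]
          by (intro image_eqI[of _ _ "emb w z"]) (simp_all add: transplant_emb)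
      next
        case False
        then show ?thesis using x by (intro image_eqI[of _ _ x]) (simp_all add: transplant_outside)
      qed
    qed
  qed
  obtain N g where N: "\<And>w. w \<in> box (\<lambda>_. N) \<Longrightarrow> g w \<in> words \<and> aff f w (g w)"
    using nV_setD(3)[OF f] unfolding piecewise_affine_def by metis
  \<comment> \<open>Inside the cell of \<open>w\<close> the pieces are those of \<open>f\<close>;
    outside, they are cells of a grid fine enough not to cross its boundary.\<close>
  let ?W = "app w ` box (\<lambda>_. N) \<union> {z \<in> box (\<lambda>_. max_level w). cell w \<inter> cell z = {}}"
  show "piecewise_affine (transplant w f)"
  proof (rule piecewise_affineI[of ?W])
    show "finite ?W" using finite_box by simp
    show "?W \<subseteq> words" using w app_words by (auto simp: box_def)
    show "cube n \<subseteq> (\<Union>w\<in>?W. cell w)"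
    proof
      fix x assume x: "x \<in> cube n"
      show "x \<in> (\<Union>w\<in>?W. cell w)"
      proof (cases "x \<in> cell w")
        case True
        then obtain y where y: "y \<in> cube n" "x = emb w y" by (auto simp: cell_def)
        then obtain u where u: "u \<in> box (\<lambda>_. N)" "y \<in> cell u" using box_cover by blast
        then have "x \<in> cell (app w u)" using y by (auto simp: cell_def emb_app)
        then show ?thesis using u by blast
      next
        case False
        obtain z where z: "z \<in> box (\<lambda>_. max_level w)" "x \<in> cell z" using box_cover x by blast
        have "cell w \<inter> cell z = {}"
        proof (rule ccontr)
          assume "cell w \<inter> cell z \<noteq> {}"
          then obtain u where "u \<in> words" "z = app w u" using words_refine[OF w z(1)] by blast
          then show False using False z cell_app_subset by blast
        qed
        then show ?thesis using z by blast
      qed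
    qed
    show "\<exists>v\<in>words. aff (transplant w f) z v" if "z \<in> ?W" for z
      using that
    proof
      assume "z \<in> app w ` box (\<lambda>_. N)"
      then obtain u where u: "u \<in> box (\<lambda>_. N)" "z = app w u" by blast
      then have "aff (transplant w f) z (app w (g u))"
        using aff_transplant N[OF u(1)] by (simp add: box_def)
      then show ?thesis using N[OF u(1)] w app_words by blast
    next
      assume z: "z \<in> {z \<in> box (\<lambda>_. max_level w). cell w \<inter> cell z = {}}"
      then have "emb z x \<notin> cell w" if "x \<in> cube n" for x
        using emb_in_cell[OF that, of z] by blast
      then have "aff (transplant w f) z z" by (simp add: aff_def transplant_outside)
      then show ?thesis using z by (auto simp: box_def)
    qed
  qed
qed

lemma transplant_conj:
  assumes "h \<in> nV_set n" "w \<in> words" "w' \<in> words" "aff h w w'" "f \<in> nV_set n"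
  shows "h \<circ> transplant w f = transplant w' f \<circ> h"
proof
  fix x
  show "(h \<circ> transplant w f) x = (transplant w' f \<circ> h) x"
  proof (cases "x \<in> cell w")
    case True
    then obtain y where y: "y \<in> cube n" "x = emb w y" by (auto simp: cell_def)
    have "f y \<in> cube n" using nV_cube[OF assms(5) y(1)] .
    then show ?thesis using y affD[OF assms(4)] by (simp add: transplant_emb)
  next
    case False
    then show ?thesis using nV_not_in_cell[OF assms(1-4)] by (simp add: transplant_outside)
  qed
qed

text \<open>This is g(P,Q) with P the two halves of the cube in direction \<open>k\<close> and Q its
  two halves in direction \<open>l\<close>.\<close>

definition baker :: "nat \<Rightarrow> nat \<Rightarrow> (nat \<Rightarrow> real) \<Rightarrow> nat \<Rightarrow> real" where
  "baker k l x = (if x \<in> cube n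
     then emb (digit l (x k \<ge> 1 / 2)) (x(k := 2 * x k - of_bool (x k \<ge> 1 / 2))) else x)"

lemma aff_baker:
  assumes "k < n"
  shows "aff (baker k l) (digit k b) (digit l b)"
  unfolding aff_def
proof
  fix y assume y: "y \<in> cube n"
  have 1: "emb (digit k b) y \<in> cube n" using emb_cube digit_words assms y by blast
  have 2: "emb (digit k b) y k = (of_bool b + y k) / 2" by (simp add: emb_def digit_def)
  have 3: "emb (digit k b) y k \<ge> 1 / 2 \<longleftrightarrow> b"
    unfolding 2 using cube_0_ends[OF y, of k] by (auto simp: of_bool_def)
  have "(emb (digit k b) y)(k := 2 * emb (digit k b) y k - of_bool b) = y"
    unfolding 2 by (auto simp: emb_def digit_def fun_eq_iff add_divide_distrib)
  then show "baker k l (emb (digit k b) y) = emb (digit l b) y"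
    unfolding baker_def 3 using 1 by simp
qed

lemma baker_baker:
  assumes "k < n" "l < n"
  shows "baker l k (baker k l x) = x"
proof (cases "x \<in> cube n")
  case True
  then obtain b y where "y \<in> cube n" "x = emb (digit k b) y" using digit_cover assms by blast
  then show ?thesis using affD[OF aff_baker] assms by simp
qed (simp add: baker_def)

lemma baker_in_nV:
  assumes "k < n" "l < n"
  shows "baker k l \<in> nV_set n"
proof (rule nV_setI)
  have cube: "baker k l x \<in> cube n" if "x \<in> cube n" "k < n" "l < n" for x k l
  proof -
    obtain b y where "y \<in> cube n" "x = emb (digit k b) y" using digit_cover \<open>x \<in> cube n\<close> \<open>k < n\<close> by blast
    then show ?thesis using affD[OF aff_baker[OF that(2)]] emb_cube digit_words that by simp
  qed
  show "bij_betw (baker k l) (cube n) (cube n)"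
    by (rule bij_betwI[of _ _ _ "baker l k"]) (use assms baker_baker cube in auto)
  show "piecewise_affine (baker k l)"
  proof (rule piecewise_affineI[of "{digit k False, digit k True}"])
    show "cube n \<subseteq> (\<Union>w\<in>{digit k False, digit k True}. cell w)"
    proof
      fix x assume "x \<in> cube n"
      then obtain b y where "y \<in> cube n" "x = emb (digit k b) y" using digit_cover assms by blast
      then show "x \<in> (\<Union>w\<in>{digit k False, digit k True}. cell w)"
        by (cases b) (auto simp: cell_def)
    qed
    show "\<exists>v\<in>words. aff (baker k l) z v" if "z \<in> {digit k False, digit k True}" for z
      using that assms digit_words aff_baker by blast
  qed (use assms digit_words in auto)
qed (simp add: baker_def)

text \<open>The baker's map deletes the first digit of coordinate \<open>k\<close> and prepends it to coordinate
\<open>l\<close>; doing this to the second digit of coordinate \<open>k\<close> instead differs only by exchanging two digits.\<close>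

lemma baker_split:
  assumes "k < n" "l < n" "k \<noteq> l" "w \<in> words"
  shows "transplant w (baker k l) =
    swp (app w (app (digit k False) (digit l True))) (app w (app (digit k True) (digit l False))) \<circ>
    transplant (app w (digit k False)) (baker k l) \<circ> transplant (app w (digit k True)) (baker k l)"
    (is "_ = swp ?u ?v \<circ> ?b0 \<circ> ?b1")
proof
  fix x
  have kw: "digit k b \<in> words" "digit l b \<in> words" for b using assms digit_words by auto
  have inc: "incomp (app w (app (digit k b) (digit l c))) (app w (app (digit k b') (digit l c')))"
    if "b \<noteq> b' \<or> c \<noteq> c'" for b c b' c'
  proof (cases "b = b'")
    case True
    then show ?thesis using that incomp_digit[of c c' "app w (digit k b)" l] by (simp add: app_assoc)
  next
    case False
    then show ?thesis using incomp_app[OF incomp_digit[of b b' w k], of "digit l c" "digit l c'"]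
      by (simp add: app_assoc)
  qed
  show "transplant w (baker k l) x = (swp ?u ?v \<circ> ?b0 \<circ> ?b1) x"
  proof (cases "x \<in> cell w")
    case False
    have "x \<notin> cell (app w u)" if "u \<in> words" for u using False cell_app_subset that by blast
    then have "x \<notin> cell (app w (digit k b))" "x \<notin> cell ?u" "x \<notin> cell ?v" for b
      using kw app_words by blast+
    then show ?thesis using False by (simp add: transplant_outside swp_outside)
  next
    case True
    then obtain y where "y \<in> cube n" "x = emb w y" by (auto simp: cell_def)
    then obtain i z' where z': "z' \<in> cube n" "x = emb w (emb (digit k i) z')"
      using digit_cover assms(1) by blast
    then obtain j z where z: "z \<in> cube n" "z' = emb (digit k j) z"
      using digit_cover assms(1) by blast
    \<comment> \<open>Here \<open>i\<close>, \<open>j\<close> are the first two digits of coordinate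
      \<open>k\<close>. The large map moves \<open>i\<close> and keeps \<open>j\<close>, the small
      one moves \<open>j\<close> and keeps \<open>i\<close>; the swap corrects the case where they
      differ.\<close>
    have "transplant w (baker k l) x = emb w (emb (digit l i) (emb (digit k j) z))"
      using z' z emb_cube[OF kw(1)] affD[OF aff_baker[OF assms(1)]] by (simp add: transplant_emb)
    also have "\<dots> = emb (app w (app (digit k j) (digit l i))) z"
      using app_digit_commute[OF assms(3), of j i] by (simp add: emb_app flip: app_assoc)
    finally have lhs: "transplant w (baker k l) x = emb (app w (app (digit k j) (digit l i))) z" .
    have x: "x = emb (app w (digit k i)) (emb (digit k j) z)" using z' z by (simp add: emb_app)
    have zj: "emb (digit k j) z \<in> cube n" "emb (digit l j) z \<in> cube n"
      using z(1) kw emb_cube by blast+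
    have step: "transplant (app w (digit k i)) (baker k l) x = emb (app w (app (digit k i) (digit l j))) z"
      unfolding x transplant_emb[OF zj(1)] affD[OF aff_baker[OF assms(1)] z(1)] by (simp add: emb_app)
    have e: "emb (app w (app (digit k i) (digit l j))) z = emb (app w (digit k i)) (emb (digit l j) z)"
      by (simp add: emb_app)
    have "incomp (app w (digit k i)) (app w (digit k (\<not> i)))" by (rule incomp_digit) simp
    then have fix1: "transplant (app w (digit k (\<not> i))) (baker k l) (emb (app w (digit k i)) q) =
        emb (app w (digit k i)) q" if "q \<in> cube n" for q
      using transplant_outside emb_not_in_cell that by blast
    note fix1 = fix1[OF zj(1), folded x] fix1[OF zj(2), folded e]
    have "(?b0 \<circ> ?b1) x = emb (app w (app (digit k i) (digit l j))) z"
      using step fix1 by (cases i) simp_all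
    moreover have "swp ?u ?v (emb (app w (app (digit k i) (digit l j))) z) =
       emb (app w (app (digit k j) (digit l i))) z"
      using affD[OF swp_left z(1)] affD[OF swp_right[OF inc] z(1)] affD[OF swp_fix[OF inc inc] z(1)]
      by (cases i; cases j) simp_all
    ultimately show ?thesis using lhs by simp
  qed
qed

end

section \<open>Finite generation\<close>

context brin_thompson
begin

text \<open>Three digits of coordinate 0 fix the column. One spare digit in each coordinate is the
  slack that lets a shallow rectangle be exchanged with one less subdivided in whichever direction
  is too deep.\<close>

definition shallow :: "mword set" where
  "shallow = {w \<in> words. length (w 0) \<in> {3, 4} \<and> (\<forall>k. 0 < k \<longrightarrow> length (w k) \<le> 1)}"

definition shallow_swaps :: "((nat \<Rightarrow> real) \<Rightarrow> nat \<Rightarrow> real) set" where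
  "shallow_swaps = {swp w v | w v. w \<in> shallow \<and> v \<in> shallow \<and> incomp w v}"

definition swap_group :: "((nat \<Rightarrow> real) \<Rightarrow> nat \<Rightarrow> real) set" where
  "swap_group = generate (nV n) shallow_swaps"

definition column :: "mword \<Rightarrow> bool list" where
  "column w = take 3 (w 0)"

definition column_word :: "bool list \<Rightarrow> mword" where
  "column_word c = (\<lambda>k. if k = 0 then c else [])"

lemma shallow_words: "w \<in> shallow \<Longrightarrow> w \<in> words"
  by (simp add: shallow_def)

lemma finite_shallow: "finite shallow"
proof -
  have "shallow \<subseteq> {f. \<forall>k. (k \<in> {..<n} \<longrightarrow> f k \<in> {w. set w \<subseteq> UNIV \<and> length w \<le> 4}) \<and> (k \<notin> {..<n} \<longrightarrow> f k = [])}"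
  proof
    fix w assume w: "w \<in> shallow"
    then have "length (w k) \<le> 4" for k
      by (cases "k = 0") (auto simp: shallow_def intro: order_trans[of _ 1])
    then show "w \<in> {f. \<forall>k. (k \<in> {..<n} \<longrightarrow> f k \<in> {w. set w \<subseteq> UNIV \<and> length w \<le> 4}) \<and> (k \<notin> {..<n} \<longrightarrow> f k = [])}"
      using w by (auto simp: shallow_def words_def)
  qed
  moreover have "finite \<dots>"
    by (intro finite_set_of_finite_funs finite_lists_length_le) auto
  ultimately show ?thesis by (rule finite_subset)
qed

lemma finite_shallow_swaps: "finite shallow_swaps"
proof -
  have "shallow_swaps \<subseteq> (\<lambda>(w, v). swp w v) ` (shallow \<times> shallow)"
    by (auto simp: shallow_swaps_def)
  then show ?thesis using finite_shallow finite_subset by blast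
qed

lemma shallow_swaps_nV: "shallow_swaps \<subseteq> carrier (nV n)"
  using swp_in_nV shallow_words by (auto simp: shallow_swaps_def carrier_nV)

lemma subgroup_swap_group: "subgroup swap_group (nV n)"
  unfolding swap_group_def by (rule nV.generate_is_subgroup[OF shallow_swaps_nV])

lemma swap_group_subset_nV: "swap_group \<subseteq> nV_set n"
  using subgroup.subset[OF subgroup_swap_group] by (simp add: carrier_nV)

lemma swap_group_comp: "g \<in> swap_group \<Longrightarrow> h \<in> swap_group \<Longrightarrow> g \<circ> h \<in> swap_group"
  using subgroup.m_closed[OF subgroup_swap_group] by (simp add: mult_nV)

lemma swap_group_id: "id \<in> swap_group"
  using subgroup.one_closed[OF subgroup_swap_group] by (simp add: one_nV)

lemma swap_group_cancel_left:
  assumes "g \<in> swap_group" "g \<circ> h \<in> swap_group" "h \<in> nV_set n"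
  shows "h \<in> swap_group"
proof -
  have "inv\<^bsub>nV n\<^esub> g \<otimes>\<^bsub>nV n\<^esub> (g \<otimes>\<^bsub>nV n\<^esub> h) \<in> swap_group"
    using assms subgroup.m_closed[OF subgroup_swap_group] subgroup.m_inv_closed[OF subgroup_swap_group]
    by (simp add: mult_nV)
  moreover have "g \<in> carrier (nV n)" "h \<in> carrier (nV n)" using assms swap_group_subset_nV by (auto simp: carrier_nV)
  ultimately show ?thesis by (simp add: nV.m_assoc[symmetric])
qed

lemma incomp_column:
  assumes "length (w 0) \<ge> 3" "length (v 0) \<ge> 3" "column w \<noteq> column v"
  shows "incomp w v"
proof -
  have "w 0 \<parallel> v 0"
  proof (rule ccontr)
    assume "\<not> w 0 \<parallel> v 0"
    then have "take 3 (w 0) = take 3 (v 0)"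
      using assms(1,2) by (auto simp: parallel_def prefix_def)
    then show False using assms(3) by (simp add: column_def)
  qed
  then show ?thesis by (auto simp: incomp_def)
qed

lemma fresh_column:
  assumes "finite X" "card X \<le> 7"
  shows "\<exists>c::bool list. length c = 3 \<and> c \<notin> X"
proof (rule ccontr)
  assume "\<not> ?thesis"
  then have "{c::bool list. set c \<subseteq> UNIV \<and> length c = 3} \<subseteq> X" by auto
  then have "card {c::bool list. set c \<subseteq> UNIV \<and> length c = 3} \<le> card X"
    using assms(1) card_mono by blast
  then show False using assms(2) card_lists_length_eq[of "UNIV :: bool set" 3] by simp
qed

lemma column_word_shallow:
  assumes "length c = 3"
  shows "column_word c \<in> shallow" "column (column_word c) = c" "length (column_word c 0) = 3"
  using assms n_pos by (auto simp: column_word_def shallow_def words_def column_def)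

lemma shallow_length: "w \<in> shallow \<Longrightarrow> length (w 0) \<ge> 3"
  by (auto simp: shallow_def)

lemma shallow_swap_in_swap_group: "w \<in> shallow \<Longrightarrow> v \<in> shallow \<Longrightarrow> incomp w v \<Longrightarrow> swp w v \<in> swap_group"
  unfolding swap_group_def shallow_swaps_def by (rule generate.incl) blast

lemma swp_conj_swap_group:
  assumes "h \<in> swap_group" "w \<in> words" "v \<in> words" "w' \<in> words" "v' \<in> words"
    "incomp w v" "incomp w' v'" "aff h w w'" "aff h v v'" "h \<circ> h = id" "swp w' v' \<in> swap_group"
  shows "swp w v \<in> swap_group"
proof -
  have "h \<circ> swp w v = swp w' v' \<circ> h"
    using assms swap_group_subset_nV by (intro swp_conj) auto
  then have "h \<circ> swp w v \<in> swap_group" using swap_group_comp assms by simp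
  then show ?thesis using swap_group_cancel_left assms(1) swp_in_nV assms(2,3,6) by blast
qed

lemma swp_involution: "incomp w v \<Longrightarrow> swp w v \<circ> swp w v = id"
  by (simp add: fun_eq_iff swp_swp)

text \<open>Induction on the number of digits of \<open>\<alpha>\<close>: conjugation by a generator
  replaces a prefix of \<open>\<alpha>\<close> by one with fewer digits.\<close>

lemma swp_shallow_right:
  assumes "\<alpha> \<in> words" "\<gamma> \<in> shallow" "length (\<alpha> 0) \<ge> 3" "incomp \<alpha> \<gamma>"
  shows "swp \<alpha> \<gamma> \<in> swap_group"
  using assms
proof (induction "\<Sum>k<n. length (\<alpha> k)" arbitrary: \<alpha> \<gamma> rule: less_induct)
  case less
  show ?case
  proof (cases "\<alpha> \<in> shallow")
    case True
    then show ?thesis using shallow_swap_in_swap_group less.prems by blast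
  next
    case False
    \<comment> \<open>The longest prefix that \<open>shallow\<close> permits. As
      \<open>\<alpha>\<close> is not shallow, some \<open>u k\<close> is nonempty, and then
      \<open>p\<close> has used up its digits in direction \<open>k\<close>.\<close>
    define p where "p i = take (if i = 0 then 4 else 1) (\<alpha> i)" for i
    define u where "u i = drop (if i = 0 then 4 else 1) (\<alpha> i)" for i
    have \<alpha>: "\<alpha> = app p u" by (simp add: app_def p_def u_def)
    have p: "p \<in> shallow" and uw: "u \<in> words"
      using less.prems(1,3) by (auto simp: shallow_def words_def p_def u_def)
    have "\<exists>k<n. u k \<noteq> []"
    proof (rule ccontr)
      assume "\<not> ?thesis"
      then have "u k = []" for k using uw by (cases "k < n") (auto simp: words_def)
      then have "\<alpha> = p" by (simp add: \<alpha> app_def)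
      then show False using p False by simp
    qed
    then obtain k where k: "k < n" "u k \<noteq> []" by blast
    then have lk: "length (p k) = (if k = 0 then 4 else 1)"
      by (auto simp: p_def u_def min_def)
    obtain c where c: "length c = 3" "c \<notin> {column p}"
      using fresh_column[of "{column p}"] by auto
    have "card {column p, c, column \<gamma>} \<le> 7"
      by (simp add: card_insert_if)
    then obtain d where d: "length d = 3" "d \<notin> {column p, c, column \<gamma>}"
      using fresh_column[of "{column p, c, column \<gamma>}"] by blast
    \<comment> \<open>\<open>q\<close> lies in the fresh column \<open>c\<close> and gives up one
      digit in direction \<open>k\<close>, which makes \<open>\<alpha>'\<close> shorter than
      \<open>\<alpha>\<close>.\<close>
    define q where "q i = (if i = 0 then c @ (if k = 0 then [] else drop 3 (p 0)) else if i = k then [] else p i)" for i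
    have q: "q \<in> shallow" and colq: "column q = c"
      using p c(1) n_pos by (auto simp: q_def shallow_def words_def column_def)
    \<comment> \<open>The swap of \<open>p\<close> and \<open>q\<close> may move
      \<open>\<gamma>\<close>, so a partner in an untouched column takes its place and is exchanged
      for \<open>\<gamma>\<close> at the end.\<close>
    define \<gamma>' where "\<gamma>' = column_word d"
    note \<gamma>' = column_word_shallow[OF d(1), folded \<gamma>'_def]
    have col\<alpha>: "column \<alpha> = column p"
      by (simp add: column_def p_def)
    note len = less.prems(3) shallow_length[OF less.prems(2)] shallow_length[OF p]
      shallow_length[OF q] shallow_length[OF \<gamma>'(1)]
    have pq: "incomp p q" using incomp_column len c colq by simp
    have inc: "incomp \<gamma>' p" "incomp \<gamma>' q" "incomp \<gamma> \<gamma>'" "incomp \<alpha> \<gamma>'"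
      using incomp_column[of \<gamma>' p] incomp_column[of \<gamma>' q] incomp_column[of \<gamma> \<gamma>'] incomp_column[of \<alpha> \<gamma>']
        len d \<gamma>'(2) colq col\<alpha> by auto
    define \<alpha>' where "\<alpha>' = app q u"
    have \<alpha>'w: "\<alpha>' \<in> words" unfolding \<alpha>'_def using app_words shallow_words[OF q] uw by blast
    have \<alpha>'\<gamma>': "incomp \<alpha>' \<gamma>'" unfolding \<alpha>'_def using incomp_app1 incomp_sym inc(2) by blast
    have qle: "length (q i) \<le> length (p i)" "length (q k) < length (p k)" for i
      using c(1) lk len(3) by (auto simp: q_def)
    have "(\<Sum>i<n. length (\<alpha>' i)) < (\<Sum>i<n. length (\<alpha> i))"
      unfolding \<alpha> \<alpha>'_def app_def
      by (rule sum_strict_mono_ex1) (use qle k in auto)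
    moreover have "length (\<alpha>' 0) \<ge> 3" using len(4) by (simp add: \<alpha>'_def app_def)
    ultimately have "swp \<alpha>' \<gamma>' \<in> swap_group"
      using less.hyps \<alpha>'w \<gamma>'(1) \<alpha>'\<gamma>' by blast
    moreover have "aff (swp p q) \<alpha> \<alpha>'" unfolding \<alpha> \<alpha>'_def using aff_app swp_left uw by blast
    moreover have "aff (swp p q) \<gamma>' \<gamma>'" using swp_fix inc by blast
    ultimately have "swp \<alpha> \<gamma>' \<in> swap_group"
      using swp_conj_swap_group[OF shallow_swap_in_swap_group[OF p q pq] less.prems(1) shallow_words[OF \<gamma>'(1)] \<alpha>'w
          shallow_words[OF \<gamma>'(1)] inc(4) \<alpha>'\<gamma>'] swp_involution[OF pq] by blast
    moreover have "aff (swp \<gamma> \<gamma>') \<alpha> \<alpha>" using swp_fix less.prems(4) inc(4) by blast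
    ultimately show ?thesis
      using swp_conj_swap_group[OF shallow_swap_in_swap_group[OF less.prems(2) \<gamma>'(1) inc(3)] less.prems(1)
          shallow_words[OF less.prems(2)] less.prems(1) shallow_words[OF \<gamma>'(1)] less.prems(4) inc(4)]
        swp_left swp_involution[OF inc(3)] by blast
  qed
qed

text \<open>The usual identity for transpositions: swap \<open>\<alpha>\<close> with a free column
  and conjugate by the swap of \<open>\<beta>\<close> with that column.\<close>

lemma swp_H_deep:
  assumes "\<alpha> \<in> words" "\<beta> \<in> words" "length (\<alpha> 0) \<ge> 3" "length (\<beta> 0) \<ge> 3" "incomp \<alpha> \<beta>"
  shows "swp \<alpha> \<beta> \<in> swap_group"
proof -
  have "card {column \<alpha>, column \<beta>} \<le> 7" by (auto simp: card_insert_if)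
  then obtain d where d: "length d = 3" "d \<notin> {column \<alpha>, column \<beta>}"
    using fresh_column[of "{column \<alpha>, column \<beta>}"] by blast
  note c = column_word_shallow[OF d(1)]
  let ?\<gamma> = "column_word d"
  have inc: "incomp \<alpha> ?\<gamma>" "incomp \<beta> ?\<gamma>"
    using incomp_column[of \<alpha> ?\<gamma>] incomp_column[of \<beta> ?\<gamma>] assms c d by auto
  have "swp \<alpha> ?\<gamma> \<in> swap_group" "swp \<beta> ?\<gamma> \<in> swap_group"
    using swp_shallow_right assms c(1) inc by blast+
  moreover have "aff (swp \<beta> ?\<gamma>) \<alpha> \<alpha>" using swp_fix assms(5) inc(1) by blast
  ultimately show ?thesis
    using swp_conj_swap_group[of "swp \<beta> ?\<gamma>" \<alpha> \<beta> \<alpha> ?\<gamma>] assms shallow_words[OF c(1)] inc swp_left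
      swp_involution[OF inc(2)] by blast
qed

text \<open>Both rectangles are halved in coordinate 0 until each has three digits there. Halving
  lowers the sum of the truncated deficits as long as one of them is positive.\<close>

lemma swp_in_swap_group:
  assumes "\<alpha> \<in> words" "\<beta> \<in> words" "incomp \<alpha> \<beta>"
  shows "swp \<alpha> \<beta> \<in> swap_group"
  using assms
proof (induction "(3 - length (\<alpha> 0)) + (3 - length (\<beta> 0))" arbitrary: \<alpha> \<beta> rule: less_induct)
  case less
  show ?case
  proof (cases "length (\<alpha> 0) \<ge> 3 \<and> length (\<beta> 0) \<ge> 3")
    case True
    then show ?thesis using swp_H_deep less.prems by blast
  next
    case False
    have n0: "0 < n" using n_pos by simp
    have "swp (app \<alpha> (digit 0 b)) (app \<beta> (digit 0 b)) \<in> swap_group" for b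
      using False less.prems app_words digit_words[OF n0] incomp_app
      by (intro less.hyps) (auto simp: app_def digit_def)
    then show ?thesis using swp_split[OF n0 less.prems(3)] swap_group_comp by simp
  qed
qed

text \<open>The baker's maps on \<open>Z\<close> and on its two halves are conjugates of
  \<open>b\<close> by swaps with \<open>X\<close>, which exist because \<open>Z\<close> is disjoint
  from \<open>X\<close>. Moving \<open>b\<close> past these swaps turns \<open>baker_split\<close>
  on \<open>Z\<close> into an equation with one \<open>b\<close> on the left and two on the right,
  with swap products in between; cancelling the last \<open>b\<close> leaves \<open>b\<close> as a
  product of swaps.\<close>

lemma baker_H_disjoint:
  assumes "k < n" "l < n" "k \<noteq> l" "X \<in> words" "Z \<in> words" "incomp Z X"
  shows "transplant X (baker k l) \<in> swap_group"
proof -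
  let ?f = "baker k l"
  define b where "b = transplant X ?f"
  have f: "?f \<in> nV_set n" by (rule baker_in_nV[OF assms(1,2)])
  have bG: "b \<in> nV_set n" unfolding b_def by (rule transplant_in_nV[OF assms(4) f])
  have kw: "digit k c \<in> words" "digit l c \<in> words" for c using assms digit_words by auto
  \<comment> \<open>\<open>b\<close> is affine on the two halves of \<open>X\<close> but not on
    \<open>X\<close>, so the swap is split before \<open>b\<close> passes it.\<close>
  have b_swp: "\<exists>r\<in>swap_group. b \<circ> swp A X = r \<circ> b" if A: "A \<in> words" "incomp A X" for A
  proof -
    define A' where "A' c = app A (digit k c)" for c
    define X' where "X' c = app X (digit k c)" for c
    define X'' where "X'' c = app X (digit l c)" for c
    have wd: "A' c \<in> words" "X' c \<in> words" "X'' c \<in> words" for c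
      unfolding A'_def X'_def X''_def using A assms kw app_words by blast+
    have inc: "incomp (A' c) (X' c')" "incomp (A' c) (X'' c')" "incomp (A' c) X" for c c'
      unfolding A'_def X'_def X''_def using A incomp_app incomp_app1 by blast+
    have af: "aff b (A' c) (A' c)" "aff b (X' c) (X'' c)" for c
      unfolding b_def using transplant_fix inc(3) aff_transplant[OF aff_baker[OF assms(1)] kw(1)]
      by (simp_all add: X'_def X''_def)
    have "b \<circ> swp (A' c) (X' c) = swp (A' c) (X'' c) \<circ> b" for c
      by (rule swp_conj[OF bG wd(1,2,1,3) inc(1,2) af])
    moreover have "swp A X = swp (A' False) (X' False) \<circ> swp (A' True) (X' True)"
      unfolding A'_def X'_def by (rule swp_split[OF assms(1) A(2)])
    ultimately have "b \<circ> swp A X = (swp (A' False) (X'' False) \<circ> swp (A' True) (X'' True)) \<circ> b"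
      by (metis comp_assoc)
    moreover have "swp (A' False) (X'' False) \<circ> swp (A' True) (X'' True) \<in> swap_group"
      using swp_in_swap_group[OF wd(1,3) inc(2)] swap_group_comp by blast
    ultimately show ?thesis by blast
  qed
  have conj: "transplant A ?f = swp A X \<circ> b \<circ> swp A X" if A: "A \<in> words" "incomp A X" for A
  proof -
    have "swp A X \<circ> transplant A ?f = b \<circ> swp A X"
      unfolding b_def by (rule transplant_conj[OF swp_in_nV[OF A(1) assms(4) A(2)] A(1) assms(4) swp_left f])
    then have "swp A X \<circ> (swp A X \<circ> transplant A ?f) = swp A X \<circ> (b \<circ> swp A X)" by simp
    then show ?thesis using swp_involution[OF A(2)] by (simp add: comp_assoc[symmetric])
  qed
  let ?Z = "\<lambda>c. app Z (digit k c)"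
  have Zc: "?Z c \<in> words" "incomp (?Z c) X" for c
    using assms kw app_words incomp_app1 by blast+
  define s where "s = swp Z X"
  define s0 where "s0 = swp (?Z False) X"
  define s1 where "s1 = swp (?Z True) X"
  define \<sigma> where "\<sigma> = swp (app Z (app (digit k False) (digit l True))) (app Z (app (digit k True) (digit l False)))"
  have "incomp (app (app Z (digit k False)) (digit l True)) (app (app Z (digit k True)) (digit l False))"
    by (rule incomp_app[OF incomp_digit]) simp
  then have \<sigma>: "\<sigma> \<in> swap_group" unfolding \<sigma>_def using assms kw app_words by (intro swp_in_swap_group) (auto simp: app_assoc)
  have sH: "s \<in> swap_group" "s0 \<in> swap_group" "s1 \<in> swap_group" unfolding s_def s0_def s1_def
    using swp_in_swap_group assms Zc by blast+
  obtain r where r: "r \<in> swap_group" "b \<circ> s = r \<circ> b" unfolding s_def using b_swp assms by blast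
  obtain r0 where r0: "r0 \<in> swap_group" "b \<circ> s0 = r0 \<circ> b" unfolding s0_def using b_swp Zc by blast
  obtain r1 where r1: "r1 \<in> swap_group" "b \<circ> s1 = r1 \<circ> b" unfolding s1_def using b_swp Zc by blast
  have "s \<circ> b \<circ> s = \<sigma> \<circ> (s0 \<circ> b \<circ> s0) \<circ> (s1 \<circ> b \<circ> s1)"
    using baker_split[OF assms(1-3,5)] conj[OF assms(5,6)] conj[OF Zc]
    by (simp add: s_def s0_def s1_def \<sigma>_def)
  then have "s \<circ> r \<circ> b = \<sigma> \<circ> s0 \<circ> r0 \<circ> (b \<circ> s1) \<circ> (b \<circ> s1)"
    using r(2) r0(2) by (metis comp_assoc)
  then have eq: "s \<circ> r \<circ> b = \<sigma> \<circ> s0 \<circ> r0 \<circ> r1 \<circ> b \<circ> r1 \<circ> b"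
    using r1(2) by (simp add: comp_assoc)
  \<comment> \<open>Surjectivity is what cancelling \<open>b\<close> on the right requires.\<close>
  have "surj b"
  proof (rule surjI)
    fix x
    show "b ((inv\<^bsub>nV n\<^esub> b) x) = x"
      using nV.r_inv[of b] bG by (metis carrier_nV comp_apply id_apply mult_nV one_nV)
  qed
  have eq': "s \<circ> r = (\<sigma> \<circ> s0 \<circ> r0 \<circ> r1) \<circ> (b \<circ> r1)"
  proof
    fix x
    obtain y where "x = b y" using \<open>surj b\<close> by blast
    then show "(s \<circ> r) x = ((\<sigma> \<circ> s0 \<circ> r0 \<circ> r1) \<circ> (b \<circ> r1)) x"
      using fun_cong[OF eq, of y] by simp
  qed
  have "(\<sigma> \<circ> s0 \<circ> r0 \<circ> r1) \<circ> (b \<circ> r1) \<in> swap_group"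
    unfolding eq'[symmetric] using swap_group_comp sH r by blast
  moreover have "\<sigma> \<circ> s0 \<circ> r0 \<circ> r1 \<in> swap_group" using swap_group_comp \<sigma> sH r0 r1 by blast
  moreover have "b \<circ> r1 \<in> nV_set n" using nV_comp bG r1 swap_group_subset_nV by blast
  ultimately have "b \<circ> r1 \<in> swap_group" using swap_group_cancel_left by blast
  then have "b \<otimes>\<^bsub>nV n\<^esub> r1 \<otimes>\<^bsub>nV n\<^esub> inv\<^bsub>nV n\<^esub> r1 \<in> swap_group"
    using subgroup.m_closed[OF subgroup_swap_group] subgroup.m_inv_closed[OF subgroup_swap_group] r1(1) by (simp add: mult_nV)
  moreover have "b \<in> carrier (nV n)" "r1 \<in> carrier (nV n)" using bG r1(1) swap_group_subset_nV by (auto simp: carrier_nV)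
  ultimately show ?thesis by (simp add: nV.m_assoc b_def)
qed

text \<open>\<open>X\<close> may be the whole cube, with no disjoint rectangle left; but its two
  halves are disjoint from each other, and \<open>baker_split\<close> reduces to them.\<close>

lemma baker_in_swap_group:
  assumes "k < n" "l < n" "k \<noteq> l" "X \<in> words"
  shows "transplant X (baker k l) \<in> swap_group"
proof -
  have kw: "digit k c \<in> words" "digit l c \<in> words" for c using assms digit_words by auto
  let ?X = "\<lambda>c. app X (digit k c)"
  have Xc: "?X c \<in> words" for c using assms kw app_words by blast
  have "transplant (?X c) (baker k l) \<in> swap_group" for c
    using baker_H_disjoint[OF assms(1-3) Xc Xc[of "\<not> c"]] incomp_digit by simp
  moreover have "incomp (app (?X False) (digit l True)) (app (?X True) (digit l False))"
    by (rule incomp_app[OF incomp_digit]) simp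
  then have "swp (app X (app (digit k False) (digit l True))) (app X (app (digit k True) (digit l False))) \<in> swap_group"
    using assms kw app_words by (intro swp_in_swap_group) (auto simp: app_assoc)
  ultimately show ?thesis
    unfolding baker_split[OF assms] using swap_group_comp by blast
qed


section \<open>Halving patterns and generation by swaps\<close>

abbreviation root :: mword where
  "root \<equiv> \<lambda>_. []"

text \<open>For n \<ge> 3 a pattern need not be of this kind: in the 2x2x2 subdivision, three bars
  in the three directions and two small cubes can be arranged without any first cut.\<close>

inductive guillotine :: "mword set \<Rightarrow> bool" where
  root: "guillotine {root}"
| split: "guillotine W \<Longrightarrow> w \<in> W \<Longrightarrow> k < n \<Longrightarrow>
    guillotine (insert (app w (digit k False)) (insert (app w (digit k True)) (W - {w})))"

lemma root_words: "root \<in> words"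
  by (simp add: words_def)

lemma app_root: "app w root = w" "app root w = w"
  by (simp_all add: app_def)

lemma emb_root: "emb root x = x"
  by (simp add: emb_def)

lemma cell_root: "cell root = cube n"
  by (simp add: cell_def emb_root)

lemma guillotine_words: "guillotine W \<Longrightarrow> W \<subseteq> words"
  by (induction rule: guillotine.induct) (use root_words app_words digit_words in auto)

lemma guillotine_incomp: "guillotine W \<Longrightarrow> u \<in> W \<Longrightarrow> v \<in> W \<Longrightarrow> u \<noteq> v \<Longrightarrow> incomp u v"
proof (induction arbitrary: u v rule: guillotine.induct)
  case (split W w k)
  have *: "incomp (app w (digit k b)) z" if "z \<in> W - {w}" for b z
    using split.IH[of w z] split.hyps that incomp_app1 by blast
  have **: "incomp (app w (digit k b)) (app w (digit k (\<not> b)))" for b by (rule incomp_digit) simp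
  show ?case
    using split.prems split.IH *[of u] *[of v] *[of u, THEN incomp_sym] *[of v, THEN incomp_sym]
      **[of True] **[of False] by auto
qed simp

text \<open>Halve \<open>w\<close> once, then refine both halves by a grid with one digit less in
  that direction. The incomparability facts serve to identify the resulting sets.\<close>

lemma guillotine_refine_one:
  assumes "guillotine W" "w \<in> W"
  shows "guillotine ((W - {w}) \<union> app w ` box l)"
  using assms
proof (induction "\<Sum>k<n. l k" arbitrary: l W w)
  case 0
  then have "box l = {root}"
    using root_words by (auto simp: box_def words_def fun_eq_iff) (metis linorder_not_le)
  then show ?case using "0.prems" by (simp add: app_root insert_absorb)
next
  case (Suc m)
  then have "\<exists>k<n. l k \<noteq> 0" by (metis lessThan_iff nat.distinct(1) sum.neutral)
  then obtain k where k: "k < n" "l k \<noteq> 0" by blast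
  define l' where "l' = l(k := l k - 1)"
  have "(\<Sum>i<n. l i) = Suc (\<Sum>i<n. l' i)"
    unfolding l'_def using k by (subst (1 2) sum.remove[of _ k]) (auto intro!: sum.cong)
  then have m: "m = (\<Sum>i<n. l' i)" using Suc.hyps(2) by simp
  have box: "box l = app (digit k False) ` box l' \<union> app (digit k True) ` box l'"
  proof (intro equalityI subsetI)
    fix w assume w: "w \<in> box l"
    then have "w k \<noteq> []" using k by (auto simp: box_def)
    then obtain b z where z: "w k = b # z" by (cases "w k") auto
    define v where "v = w(k := z)"
    have "w = app (digit k b) v" using z by (auto simp: app_def digit_def v_def fun_eq_iff)
    moreover have "v \<in> box l'" using w z k by (auto simp: box_def words_def v_def l'_def)
    ultimately show "w \<in> app (digit k False) ` box l' \<union> app (digit k True) ` box l'"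
      by (cases b) auto
  next
    fix w assume "w \<in> app (digit k False) ` box l' \<union> app (digit k True) ` box l'"
    then obtain b v where "v \<in> box l'" "w = app (digit k b) v" by blast
    then show "w \<in> box l" using k by (auto simp: box_def words_def app_def digit_def l'_def)
  qed
  let ?w0 = "app w (digit k False)" and ?w1 = "app w (digit k True)"
  let ?A0 = "app ?w0 ` box l'" and ?A1 = "app ?w1 ` box l'"
  let ?W = "insert ?w0 (insert ?w1 (W - {w}))"
  have g1: "guillotine ?W" using guillotine.split Suc.prems k by blast
  have i01: "incomp ?w0 ?w1" by (rule incomp_digit) simp
  have ni: "app w (digit k b) \<notin> W - {w}" for b
    using guillotine_incomp[OF Suc.prems(1,2), of "app w (digit k b)"]
      incomp_app1[of w "app w (digit k b)" "digit k b"] not_incomp_self[of "app w (digit k b)"]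
    by (cases "app w (digit k b) = w") auto
  have ne: "?w0 \<noteq> ?w1" using i01 not_incomp_self[of ?w0] by auto
  have ni1: "?w1 \<notin> ?A0"
  proof
    assume "?w1 \<in> ?A0"
    then obtain u where u: "?w1 = app ?w0 u" by blast
    show False using incomp_app1[OF i01, of u] not_incomp_self unfolding u by blast
  qed
  have g2: "guillotine ((?W - {?w0}) \<union> ?A0)"
    by (rule Suc.hyps(1)[OF m g1]) blast
  have "guillotine (((?W - {?w0}) \<union> ?A0) - {?w1} \<union> ?A1)"
    by (rule Suc.hyps(1)[OF m g2]) (use ne in simp)
  moreover have "((?W - {?w0}) \<union> ?A0) - {?w1} \<union> ?A1 = (W - {w}) \<union> ?A0 \<union> ?A1"
    using ni[of False] ni[of True] ni1 ne ne[symmetric] by blast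
  moreover have "app w ` box l = ?A0 \<union> ?A1"
    unfolding box image_Un image_image app_assoc ..
  ultimately show ?case by (simp add: Un_assoc)
qed

lemma guillotine_refine:
  assumes "guillotine W" "finite A" "A \<subseteq> W"
  shows "guillotine ((W - A) \<union> (\<Union>w\<in>A. app w ` box (l w)))"
  using assms(2,3)
proof (induction A)
  case empty
  then show ?case using assms(1) by simp
next
  case (insert a A)
  let ?U = "\<Union>w\<in>A. app w ` box (l w)"
  have "guillotine ((W - A) \<union> ?U)" using insert by blast
  moreover have "a \<in> (W - A) \<union> ?U" using insert by blast
  ultimately have "guillotine (((W - A) \<union> ?U) - {a} \<union> app a ` box (l a))"
    by (rule guillotine_refine_one)
  moreover have "a \<notin> ?U"
  proof
    assume "a \<in> ?U"
    then obtain w u where "w \<in> A" "a = app w u" by blast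
    moreover have "incomp w a"
      using guillotine_incomp[OF assms(1), of w a] insert \<open>w \<in> A\<close> by blast
    ultimately show False using incomp_app1 not_incomp_self by metis
  qed
  then have "((W - A) \<union> ?U) - {a} \<union> app a ` box (l a) =
    (W - insert a A) \<union> (\<Union>w\<in>insert a A. app w ` box (l w))" by blast
  ultimately show ?case by simp
qed

lemma guillotine_box: "guillotine (box l)"
  using guillotine_refine_one[OF guillotine.root, of root l] by (simp add: app_root)

definition exchange :: "mword \<Rightarrow> mword \<Rightarrow> (nat \<Rightarrow> real) \<Rightarrow> nat \<Rightarrow> real" where
  "exchange w v = (if w = v then id else swp w v)"

lemma exchange_in_swap_group: "guillotine V \<Longrightarrow> w \<in> V \<Longrightarrow> v \<in> V \<Longrightarrow> exchange w v \<in> swap_group"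
  using swp_in_swap_group[of w v] guillotine_words[of V] guillotine_incomp[of V w v] swap_group_id by (auto simp: exchange_def)

lemma aff_exchange:
  assumes "guillotine V" "w \<in> V" "v \<in> V" "z \<in> V"
  shows "aff (exchange w v) z (Transposition.transpose w v z)"
proof (cases "w = v")
  case True
  then show ?thesis by (simp add: exchange_def aff_def)
next
  case False
  then have "incomp w v" using guillotine_incomp assms by blast
  then show ?thesis
    using False swp_left swp_right swp_fix guillotine_incomp[OF assms(1)] assms
    by (auto simp: exchange_def Transposition.transpose_def)
qed

lemma aff_same_target:
  assumes "g \<in> nV_set n" "w \<in> words" "w' \<in> words" "aff g w v" "aff g w' v"
  shows "\<not> incomp w w'"
proof
  assume "incomp w w'"
  obtain x where x: "x \<in> cube n" by (rule that[OF zero_cube])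
  have "g (emb w x) = g (emb w' x)" using affD assms(4,5) x by simp
  then have "emb w x = emb w' x"
    using nV_setD(2)[OF assms(1)] emb_cube assms(2,3) x unfolding bij_betw_def by (meson inj_onD)
  then show False using emb_not_in_cell[OF x \<open>incomp w w'\<close>] emb_in_cell[OF x, of w'] by simp
qed

text \<open>Both patterns are dismantled from their last halvings, \<open>w\<close> in direction
  \<open>k\<close> and \<open>v\<close> in direction \<open>l\<close>. Exchanges of pieces of
  \<open>V\<close> make \<open>g\<close> send the halves of \<open>w\<close> to the halves of
  \<open>v\<close>, and a baker's map adjusts the direction; then both halvings can be undone, and
  induction applies.\<close>

lemma table_in_swap_group:
  assumes "guillotine W" "guillotine V" "g \<in> nV_set n" "\<And>w. w \<in> W \<Longrightarrow> \<exists>v\<in>V. aff g w v"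
  shows "g \<in> swap_group"
  using assms
proof (induction arbitrary: V g rule: guillotine.induct)
  case root
  obtain v where v: "v \<in> V" "aff g root v" using root.prems(3) by blast
  have "cell v = cube n"
    using aff_cell[OF v(2)] nV_setD(2)[OF root.prems(2)] by (simp add: cell_root bij_betw_def)
  from root.prems(1) show ?case
  proof cases
    case root
    then have "g x = x" for x
      using v nV_setD(1)[OF root.prems(2)] affD[OF v(2), of x] by (cases "x \<in> cube n") (auto simp: emb_root)
    then have "g = id" by auto
    then show ?thesis using swap_group_id by blast
  next
    case (split V' u k)
    \<comment> \<open>\<open>v\<close> already fills the cube, so a pattern with a further nonempty
      cell is impossible; at least one half of \<open>u\<close> differs from
      \<open>v\<close>.\<close>
    obtain c where "app u (digit k c) \<noteq> v"
      using incomp_digit[of False True u k] not_incomp_self by metis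
    moreover have "app u (digit k c) \<in> V" using split by (cases c) auto
    ultimately have "incomp (app u (digit k c)) v" "app u (digit k c) \<in> words"
      using guillotine_incomp[OF root.prems(1)] guillotine_words[OF root.prems(1)] v(1) by blast+
    then have "cell (app u (digit k c)) \<inter> cube n = {}"
      using cell_disjoint \<open>cell v = cube n\<close> by metis
    then show ?thesis
      using cell_nonempty cell_subset[OF \<open>app u (digit k c) \<in> words\<close>] by blast
  qed
next
  case (split W w k)
  let ?w = "\<lambda>c. app w (digit k c)"
  let ?W = "insert (?w False) (insert (?w True) (W - {w}))"
  have gW: "guillotine ?W" using guillotine.split split.hyps by blast
  have wW: "?w c \<in> ?W" for c by (cases c) auto
  have distinct_image: "a \<noteq> b" if "z \<in> ?W" "z' \<in> ?W" "z \<noteq> z'" "h \<in> nV_set n" "aff h z a" "aff h z' b" for h z z' a b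
    using aff_same_target[OF that(4), of z z' a] guillotine_words[OF gW] guillotine_incomp[OF gW] that by blast
  have w01: "?w False \<noteq> ?w True" using incomp_digit[of False True w k] not_incomp_self by metis
  obtain a where a: "a \<in> V" "aff g (?w False) a" using split.prems(3)[OF wW] by blast
  obtain b where b: "b \<in> V" "aff g (?w True) b" using split.prems(3)[OF wW] by blast
  have ab: "a \<noteq> b" using distinct_image[OF wW wW w01 split.prems(2) a(2) b(2)] .
  from split.prems(1) show ?case
  proof cases
    case root
    then show ?thesis using a b ab by simp
  next
    case V: (split V' v l)
    let ?v = "\<lambda>c. app v (digit l c)"
    have vw: "v \<in> words" using guillotine_words V by blast
    have vV: "?v c \<in> V" for c using V by (cases c) auto
    have v01: "?v False \<noteq> ?v True" using incomp_digit[of False True v l] not_incomp_self by metis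
    define p1 where "p1 = exchange a (?v False)"
    \<comment> \<open>The first exchange may displace \<open>b\<close>; its new position is what
      must go to the second half of \<open>v\<close>.\<close>
    define b' where "b' = Transposition.transpose a (?v False) b"
    define p2 where "p2 = exchange b' (?v True)"
    have b': "b' \<in> V" "b' \<noteq> ?v False"
      using a b vV ab by (auto simp: b'_def Transposition.transpose_def)
    have p12: "p1 \<in> swap_group" "p2 \<in> swap_group"
      unfolding p1_def p2_def using exchange_in_swap_group[OF split.prems(1)] a(1) b'(1) vV by blast+
    have ap1: "aff p1 z (Transposition.transpose a (?v False) z)" "aff p2 z (Transposition.transpose b' (?v True) z)" if "z \<in> V" for z
      unfolding p1_def p2_def using aff_exchange[OF split.prems(1)] that a(1) b'(1) vV by blast+
    define g1 where "g1 = p2 \<circ> (p1 \<circ> g)"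
    have g1n: "g1 \<in> nV_set n" unfolding g1_def using nV_comp split.prems(2) p12 swap_group_subset_nV by blast
    have ag1: "aff g1 z (Transposition.transpose b' (?v True) (Transposition.transpose a (?v False) y))" if "y \<in> V" "aff g z y" for z y
    proof -
      have "Transposition.transpose a (?v False) y \<in> V" using that a(1) vV by (auto simp: Transposition.transpose_def)
      then show ?thesis unfolding g1_def using aff_comp ap1 that by blast
    qed
    have g1w: "aff g1 (?w c) (?v c)" for c
      using ag1[OF a] ag1[OF b] b'(2) v01 by (cases c) (simp_all add: b'_def[symmetric])
    \<comment> \<open>This turns the halving of \<open>v\<close> in direction \<open>l\<close> into
      one in direction \<open>k\<close>, so that the two affine pieces on \<open>w\<close> fit
      together to one.\<close>
    define bk where "bk = (if k = l then id else transplant v (baker l k))"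
    have bk: "bk \<in> swap_group" using baker_in_swap_group[OF V(4) split.hyps(3) _ vw] swap_group_id by (auto simp: bk_def)
    have abk: "aff bk (?v c) (app v (digit k c))" for c
      using aff_transplant[OF aff_baker[OF V(4)] digit_words[OF V(4)]] by (auto simp: bk_def aff_def)
    define g2 where "g2 = bk \<circ> g1"
    have g2n: "g2 \<in> nV_set n" unfolding g2_def using nV_comp g1n bk swap_group_subset_nV by blast
    have "aff g2 w v"
      unfolding aff_def
    proof
      fix x assume "x \<in> cube n"
      then obtain c y where y: "y \<in> cube n" "x = emb (digit k c) y" using digit_cover split.hyps(3) by blast
      have "aff g2 (?w c) (app v (digit k c))" unfolding g2_def by (rule aff_comp[OF g1w abk])
      then show "g2 (emb w x) = emb v x" using affD y by (metis emb_app)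
    qed
    moreover have "\<exists>y\<in>V'. aff g2 z y" if z: "z \<in> W" "z \<noteq> w" for z
    proof -
      have zW: "z \<in> ?W" using z by blast
      obtain y0 where y0: "y0 \<in> V" "aff g z y0" using split.prems(3)[OF zW] by blast
      define y where "y = Transposition.transpose b' (?v True) (Transposition.transpose a (?v False) y0)"
      have yV: "y \<in> V" unfolding y_def Transposition.transpose_def using y0(1) a(1) b'(1) vV by simp
      have gy: "aff g1 z y" unfolding y_def by (rule ag1[OF y0])
      have "z \<noteq> ?w c" for c
      proof
        assume "z = ?w c"
        moreover have "incomp w z" using guillotine_incomp split.hyps z by blast
        ultimately show False using incomp_app1 not_incomp_self by metis
      qed
      then have "y \<noteq> ?v c" for c using distinct_image[OF zW wW _ g1n gy g1w] by blast
      then have y: "y \<in> V'" "y \<noteq> v" using yV V by auto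
      then have "incomp y v" using guillotine_incomp V by blast
      then have "aff bk y y" using transplant_fix by (auto simp: bk_def aff_def)
      then have "aff g2 z y" unfolding g2_def using aff_comp gy by blast
      then show ?thesis using y(1) by blast
    qed
    ultimately have "g2 \<in> swap_group"
      using split.IH[OF V(2) g2n] V(3) by blast
    then have "(bk \<circ> p2 \<circ> p1) \<circ> g \<in> swap_group" unfolding g2_def g1_def by (simp add: comp_assoc)
    moreover have "bk \<circ> p2 \<circ> p1 \<in> swap_group" using swap_group_comp bk p12 by blast
    ultimately show ?thesis using swap_group_cancel_left split.prems(2) by blast
  qed
qed

text \<open>The images of the cells of a grid have various depths. Refining each source cell by the
  digits that its image lacks makes all images cells of one grid, and the refined source is still a
  halving pattern.\<close>

lemma swap_group_eq: "swap_group = carrier (nV n)"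
proof
  show "swap_group \<subseteq> carrier (nV n)" using swap_group_subset_nV by (simp add: carrier_nV)
  show "carrier (nV n) \<subseteq> swap_group"
  proof
    fix g assume "g \<in> carrier (nV n)"
    then have g: "g \<in> nV_set n" by (simp add: carrier_nV)
    obtain N f where N: "\<And>w. w \<in> box (\<lambda>_. N) \<Longrightarrow> f w \<in> words \<and> aff g w (f w)"
      using nV_setD(3)[OF g] unfolding piecewise_affine_def by metis
    define M where "M = Max (max_level ` f ` box (\<lambda>_. N))"
    define l where "l w k = M - length (f w k)" for w k
    let ?W = "\<Union>w\<in>box (\<lambda>_. N). app w ` box (l w)"
    have "guillotine ?W"
      using guillotine_refine[OF guillotine_box finite_box subset_refl, of "\<lambda>_. N" l] by simp
    moreover have "\<exists>v\<in>box (\<lambda>_. M). aff g z v" if zW: "z \<in> ?W" for z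
    proof -
      obtain w u where w: "w \<in> box (\<lambda>_. N)" and u: "u \<in> box (l w)" and z: "z = app w u"
        using zW by blast
      have "length (f w k) \<le> M" for k
        using length_le_max_level N[OF w] finite_box w unfolding M_def
        by (intro order_trans[OF length_le_max_level Max_ge]) auto
      then have "app (f w) u \<in> box (\<lambda>_. M)"
        using u N[OF w] by (auto simp: box_def words_def app_def l_def)
      then show ?thesis unfolding z using aff_app N[OF w] u by (auto simp: box_def)
    qed
    ultimately show "g \<in> swap_group" using table_in_swap_group[OF _ guillotine_box g] by blast
  qed
qed

section \<open>Commuting conjugates and property FA\<close>

lemma column_permutation:
  assumes "finite C" "\<And>c. c \<in> C \<Longrightarrow> length c = 3" "inj_on f C" "\<And>c. c \<in> C \<Longrightarrow> length (f c) = 3"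
    "C \<inter> f ` C = {}"
  shows "\<exists>h\<in>swap_group. (\<forall>c\<in>C. aff h (column_word c) (column_word (f c))) \<and>
    (\<forall>c. length c = 3 \<and> c \<notin> C \<union> f ` C \<longrightarrow> aff h (column_word c) (column_word c))"
  using assms
proof (induction C)
  case empty
  show ?case by (rule bexI[OF _ swap_group_id]) (simp add: aff_def)
next
  case (insert c C)
  have inc: "incomp (column_word a) (column_word b)" if "length a = 3" "length b = 3" "a \<noteq> b" for a b
    using incomp_column[of "column_word a" "column_word b"] column_word_shallow that by simp
  \<comment> \<open>The clause on the remaining columns guarantees that \<open>h\<close> leaves
    \<open>c\<close> in place until the new swap moves it.\<close>
  obtain h where h: "h \<in> swap_group" "\<And>x. x \<in> C \<Longrightarrow> aff h (column_word x) (column_word (f x))"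
    "\<And>x. length x = 3 \<Longrightarrow> x \<notin> C \<union> f ` C \<Longrightarrow> aff h (column_word x) (column_word x)"
    using insert.IH insert.prems by (auto simp: inj_on_insert)
  let ?s = "swp (column_word c) (column_word (f c))"
  have lc: "length c = 3" "length (f c) = 3" "c \<noteq> f c" using insert.prems by auto
  have s: "?s \<in> swap_group"
    using swp_in_swap_group inc[OF lc] column_word_shallow lc shallow_words by blast
  have fix_s: "aff ?s (column_word x) (column_word x)" if "length x = 3" "x \<noteq> c" "x \<noteq> f c" for x
    using swp_fix inc that lc by blast
  show ?case
  proof (intro bexI[of _ "?s \<circ> h"] conjI ballI allI impI)
    show "aff (?s \<circ> h) (column_word x) (column_word (f x))" if x: "x \<in> insert c C" for x
    proof (cases "x = c")
      case True
      have "c \<notin> C \<union> f ` C" using insert.hyps insert.prems(4) by auto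
      then show ?thesis using True aff_comp[OF h(3)[OF lc(1)] swp_left] by blast
    next
      case False
      then have "x \<in> C" using x by blast
      moreover have "f x \<noteq> c" "f x \<noteq> f c"
        using insert.prems(2,4) \<open>x \<in> C\<close> False by (auto simp: inj_on_def)
      ultimately show ?thesis using aff_comp[OF h(2) fix_s] insert.prems(3) by blast
    qed
    show "aff (?s \<circ> h) (column_word x) (column_word x)" if "length x = 3 \<and> x \<notin> insert c C \<union> f ` insert c C" for x
      using aff_comp[OF h(3) fix_s] that by auto
    show "?s \<circ> h \<in> swap_group" using swap_group_comp s h(1) by blast
  qed
qed

lemma cell_subset_column:
  assumes "w \<in> shallow"
  shows "cell w \<subseteq> cell (column_word (column w))"
proof -
  define u where "u i = (if i = 0 then drop 3 (w 0) else w i)" for i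
  have "w = app (column_word (column w)) u"
    by (auto simp: app_def column_word_def column_def u_def fun_eq_iff)
  moreover have "u \<in> words" using assms by (auto simp: shallow_def words_def u_def)
  ultimately show ?thesis using cell_app_subset by metis
qed

text \<open>\<open>A\<close> is the union of the columns that \<open>s\<close> and \<open>t\<close>
  can move. \<open>k\<close> carries it off itself, so the conjugates fix \<open>A\<close> pointwise
  while \<open>s\<close> and \<open>t\<close> fix its complement.\<close>

lemma shallow_swaps_commuting_conjugates:
  assumes "s \<in> shallow_swaps" "t \<in> shallow_swaps"
  shows "\<exists>k\<in>carrier (nV n). \<forall>a\<in>{s, t}. \<forall>b\<in>{s, t}.
    (k \<otimes>\<^bsub>nV n\<^esub> a \<otimes>\<^bsub>nV n\<^esub> inv\<^bsub>nV n\<^esub> k) \<otimes>\<^bsub>nV n\<^esub> b = b \<otimes>\<^bsub>nV n\<^esub> (k \<otimes>\<^bsub>nV n\<^esub> a \<otimes>\<^bsub>nV n\<^esub> inv\<^bsub>nV n\<^esub> k)"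
proof -
  obtain w v where s: "w \<in> shallow" "v \<in> shallow" "s = swp w v"
    using assms(1) by (auto simp: shallow_swaps_def)
  obtain w' v' where t: "w' \<in> shallow" "v' \<in> shallow" "t = swp w' v'"
    using assms(2) by (auto simp: shallow_swaps_def)
  define C where "C = {column w, column v, column w', column v'}"
  have C3: "length c = 3" if "c \<in> C" for c
    using that s t shallow_length by (auto simp: C_def column_def)
  define L where "L = {c::bool list. set c \<subseteq> UNIV \<and> length c = 3}"
  have finC: "finite C" "card C \<le> 4" by (auto simp: C_def card_insert_if)
  have finL: "finite L" "card L = 8"
    using card_lists_length_eq[of "UNIV :: bool set" 3] finite_lists_length_eq[of "UNIV :: bool set" 3]
    by (simp_all add: L_def)
  have "C \<subseteq> L" using C3 by (auto simp: L_def)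
  \<comment> \<open>Here eight columns are needed: at most four are occupied, so at least as many
    are free.\<close>
  then have "card C \<le> card (L - C)" using finC finL by (simp add: card_Diff_subset)
  then obtain f where f: "inj_on f C" "f ` C \<subseteq> L - C"
    using card_le_inj[OF finC(1)] finL by blast
  obtain k where k: "k \<in> swap_group" "\<And>c. c \<in> C \<Longrightarrow> aff k (column_word c) (column_word (f c))"
  proof -
    have "length (f c) = 3" if "c \<in> C" for c using f(2) that by (auto simp: L_def)
    moreover have "C \<inter> f ` C = {}" using f(2) by blast
    ultimately show ?thesis using column_permutation[OF finC(1) C3 f(1)] that by blast
  qed
  have kG: "k \<in> carrier (nV n)" using k swap_group_eq by blast
  define A where "A = (\<Union>c\<in>C. cell (column_word c))"
  have supp: "a x = x" if "a \<in> {s, t}" "x \<notin> A" for a x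
  proof -
    have "x \<notin> cell w" "x \<notin> cell v" "x \<notin> cell w'" "x \<notin> cell v'"
      using that(2) s t cell_subset_column unfolding A_def C_def by blast+
    then show ?thesis using that(1) s t by (auto simp: swp_outside)
  qed
  have kA: "k x \<notin> A" if "x \<in> A" for x
  proof -
    obtain c where c: "c \<in> C" "x \<in> cell (column_word c)" using \<open>x \<in> A\<close> by (auto simp: A_def)
    then have "k x \<in> cell (column_word (f c))" using aff_cell[OF k(2)] by blast
    moreover have "cell (column_word (f c)) \<inter> cell (column_word d) = {}" if "d \<in> C" for d
    proof (rule cell_disjoint, rule incomp_column)
      have "length (f c) = 3" "f c \<noteq> d" "length d = 3" using f(2) c(1) that C3 by (auto simp: L_def)
      then show "length (column_word (f c) 0) \<ge> 3" "length (column_word d 0) \<ge> 3"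
        "column (column_word (f c)) \<noteq> column (column_word d)"
        using column_word_shallow by simp_all
    qed
    ultimately show ?thesis by (auto simp: A_def)
  qed
  have inG: "s \<in> carrier (nV n)" "t \<in> carrier (nV n)" using assms shallow_swaps_nV by blast+
  have "(k \<otimes>\<^bsub>nV n\<^esub> a \<otimes>\<^bsub>nV n\<^esub> inv\<^bsub>nV n\<^esub> k) \<circ> b = b \<circ> (k \<otimes>\<^bsub>nV n\<^esub> a \<otimes>\<^bsub>nV n\<^esub> inv\<^bsub>nV n\<^esub> k)"
    if ab: "a \<in> {s, t}" "b \<in> {s, t}" for a b
  proof (rule commute_disjoint_support[of _ _ A])
    have abG: "a \<in> carrier (nV n)" "b \<in> carrier (nV n)" using ab inG by blast+
    show "k \<otimes>\<^bsub>nV n\<^esub> a \<otimes>\<^bsub>nV n\<^esub> inv\<^bsub>nV n\<^esub> k \<in> nV_set n" "b \<in> nV_set n"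
      using abG kG by (simp_all flip: carrier_nV)
    show "b x = x" if "x \<notin> A" for x using supp ab(2) that by blast
    show "(k \<otimes>\<^bsub>nV n\<^esub> a \<otimes>\<^bsub>nV n\<^esub> inv\<^bsub>nV n\<^esub> k) x = x" if "x \<in> A" for x
    proof -
      have kk: "k ((inv\<^bsub>nV n\<^esub> k) x) = x"
        using nV.r_inv[OF kG] by (metis comp_apply id_apply mult_nV one_nV)
      then have "(inv\<^bsub>nV n\<^esub> k) x \<notin> A" using kA that by metis
      then show ?thesis using supp ab(1) kk by (simp add: mult_nV)
    qed
  qed
  then show ?thesis using kG by (auto simp: mult_nV)
qed

lemma FA_nV: "property_FA (nV n) TYPE('v)"
proof (rule property_FA_if_involutions[OF finite_shallow_swaps _ shallow_swaps_nV])
  show "shallow_swaps \<noteq> {}"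
  proof -
    let ?w = "column_word [True, True, True]" and ?v = "column_word [False, True, True]"
    have "?w \<in> shallow" "?v \<in> shallow" "incomp ?w ?v"
      using column_word_shallow by (auto intro!: incomp_column)
    then show ?thesis by (auto simp: shallow_swaps_def)
  qed
  show "generate (nV n) shallow_swaps = carrier (nV n)" using swap_group_eq by (simp add: swap_group_def)
  show "s \<otimes>\<^bsub>nV n\<^esub> s = \<one>\<^bsub>nV n\<^esub>" if "s \<in> shallow_swaps" for s
    using that swp_involution by (auto simp: shallow_swaps_def mult_nV one_nV)
qed (rule shallow_swaps_commuting_conjugates)

end

section \<open>Elements of infinite order\<close>

context brin_thompson
begin

definition fixing :: "(nat \<Rightarrow> real) set \<Rightarrow> ((nat \<Rightarrow> real) \<Rightarrow> nat \<Rightarrow> real) set" where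
  "fixing A = {g \<in> nV_set n. \<forall>x\<in>A. g x = x}"

lemma subgroup_fixing: "subgroup (fixing A) (nV n)"
proof (rule nV.subgroupI)
  fix g assume g: "g \<in> fixing A"
  then have gG: "g \<in> carrier (nV n)" by (simp add: fixing_def carrier_nV)
  have inv: "(inv\<^bsub>nV n\<^esub> g) (g x) = x" for x
    using nV.l_inv[OF gG] by (metis comp_apply id_apply mult_nV one_nV)
  have "(inv\<^bsub>nV n\<^esub> g) x = x" if "x \<in> A" for x
    using inv[of x] g that by (simp add: fixing_def)
  then show "inv\<^bsub>nV n\<^esub> g \<in> fixing A"
    using gG by (simp add: fixing_def flip: carrier_nV)
qed (auto simp: fixing_def carrier_nV mult_nV nV_comp intro: nV_id)

lemma fixing_pow: "g \<in> fixing A \<Longrightarrow> g [^]\<^bsub>nV n\<^esub> (i::int) \<in> fixing A"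
  using nV.subgroup_int_pow_closed[OF subgroup_fixing] .

definition infinite_order :: "((nat \<Rightarrow> real) \<Rightarrow> nat \<Rightarrow> real) \<Rightarrow> bool" where
  "infinite_order g \<longleftrightarrow> (\<forall>i::int. g [^]\<^bsub>nV n\<^esub> i = \<one>\<^bsub>nV n\<^esub> \<longrightarrow> i = 0)"

text \<open>A common power fixes both \<open>A\<close> and its complement, hence is the
  identity.\<close>

lemma independent_disjoint:
  assumes "t \<in> fixing A" "u \<in> fixing (- A)" "infinite_order t" "infinite_order u"
  shows "nV.independent t u"
proof -
  have tu: "t \<in> nV_set n" "u \<in> nV_set n" using assms by (auto simp: fixing_def)
  have "t \<circ> u = u \<circ> t"
    using commute_disjoint_support[OF tu, of A] assms(1,2) by (simp add: fixing_def)
  moreover have "i = 0 \<and> j = 0" if eq: "t [^]\<^bsub>nV n\<^esub> (i::int) = u [^]\<^bsub>nV n\<^esub> (j::int)" for i j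
  proof -
    have "(t [^]\<^bsub>nV n\<^esub> i) x = x" for x
    proof (cases "x \<in> A")
      case True
      then show ?thesis using fixing_pow[OF assms(1), of i] by (simp add: fixing_def)
    next
      case False
      then show ?thesis using fixing_pow[OF assms(2), of j] unfolding eq by (simp add: fixing_def)
    qed
    then have "t [^]\<^bsub>nV n\<^esub> i = \<one>\<^bsub>nV n\<^esub>" by (auto simp: one_nV)
    then show ?thesis using eq assms(3,4) unfolding infinite_order_def by metis
  qed
  ultimately show ?thesis by (simp add: nV.independent_def mult_nV)
qed

lemma independent_commute: "nV.independent t u \<Longrightarrow> nV.independent u t"
  unfolding nV.independent_def by metis

text \<open>On the cell of the word \<open>1\<close> in coordinate \<open>0\<close> this is the contraction onto the cell of
\<open>10\<close>, so its positive powers contract further and further.\<close>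

definition shift :: "(nat \<Rightarrow> real) \<Rightarrow> nat \<Rightarrow> real" where
  "shift = swp (digit 0 False) (app (digit 0 True) (digit 0 False)) \<circ> swp (digit 0 False) (digit 0 True)"

lemma digit0:
  "digit 0 b \<in> words" "incomp (digit 0 False) (digit 0 True)"
  "incomp (digit 0 False) (app (digit 0 True) (digit 0 False))"
proof -
  show "digit 0 b \<in> words" using digit_words n_pos by simp
  show i: "incomp (digit 0 False) (digit 0 True)"
    by (auto simp: incomp_def digit_def parallel_def intro!: exI[of _ 0])
  show "incomp (digit 0 False) (app (digit 0 True) (digit 0 False))" by (rule incomp_app2[OF i])
qed

lemma shift_in_nV: "shift \<in> nV_set n"
  unfolding shift_def using nV_comp swp_in_nV digit0 app_words by blast

text \<open>In coordinate 0 the inner swap turns the prefix 1 into 0, and the outer one turns 0 into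
  10.\<close>

lemma aff_shift: "aff shift (digit 0 True) (app (digit 0 True) (digit 0 False))"
  unfolding shift_def by (rule aff_comp[OF swp_right[OF digit0(2)] swp_left])

lemma aff_pow:
  assumes "g \<in> carrier (nV n)" "aff g w (app w u)" "u \<in> words"
  shows "aff (g [^]\<^bsub>nV n\<^esub> (m::nat)) w (app w (((app u) ^^ m) (\<lambda>_. [])))"
proof (induction m)
  case 0
  then show ?case by (simp add: one_nV aff_def app_def)
next
  case (Suc m)
  have p: "((app u) ^^ m) (\<lambda>_. []) \<in> words" for m
    by (induction m) (use assms(3) app_words in \<open>auto simp: words_def app_def\<close>)
  have "g [^]\<^bsub>nV n\<^esub> Suc m = g \<circ> g [^]\<^bsub>nV n\<^esub> m"
    using nV.nat_pow_Suc2[OF assms(1), of m] by (simp only: mult_nV)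
  moreover have "aff (g \<circ> g [^]\<^bsub>nV n\<^esub> m) w (app (app w u) (((app u) ^^ m) (\<lambda>_. [])))"
    by (rule aff_comp[OF Suc aff_app[OF assms(2) p]])
  moreover have "((app u) ^^ Suc m) (\<lambda>_. []) = app u (((app u) ^^ m) (\<lambda>_. []))" by simp
  ultimately show ?case by (simp only: app_assoc)
qed

lemma infinite_order_transplant_shift:
  assumes w: "w \<in> words"
  shows "infinite_order (transplant w shift)"
  unfolding infinite_order_def
proof (intro allI impI)
  let ?t = "transplant w shift"
  fix i :: int assume i: "?t [^]\<^bsub>nV n\<^esub> i = \<one>\<^bsub>nV n\<^esub>"
  have tG: "?t \<in> carrier (nV n)" using transplant_in_nV[OF w shift_in_nV] by (simp add: carrier_nV)
  define m where "m = nat \<bar>i\<bar>"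
  have m1: "?t [^]\<^bsub>nV n\<^esub> m = \<one>\<^bsub>nV n\<^esub>"
  proof -
    consider "i = int m" | "i = - int m" unfolding m_def by linarith
    then show ?thesis
    proof cases
      case 1
      then show ?thesis using i by (simp only: int_pow_int)
    next
      case 2
      then have "inv\<^bsub>nV n\<^esub> (?t [^]\<^bsub>nV n\<^esub> m) = \<one>\<^bsub>nV n\<^esub>"
        using i nV.int_pow_neg_int[OF tG, of m] by metis
      then show ?thesis using nV.inv_eq_1_iff nV.nat_pow_closed tG by blast
    qed
  qed
  let ?w = "app w (digit 0 True)"
  define p where "p m = ((app (digit 0 False)) ^^ m) (\<lambda>_. [])" for m
  have "aff ?t ?w (app ?w (digit 0 False))"
    using aff_transplant[OF aff_shift digit0(1)] by (simp add: app_assoc)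
  then have aff: "aff (?t [^]\<^bsub>nV n\<^esub> m) ?w (app ?w (p m))"
    unfolding p_def using aff_pow[OF tG] digit0(1) by blast
  \<comment> \<open>Each application halves coordinate 0 relative to \<open>?w\<close>; it must be
    nonzero, since the value 0 would not move.\<close>
  define x :: "nat \<Rightarrow> real" where "x k = (if k = 0 then 1 / 2 else 0)" for k
  have x: "x \<in> cube n" using n_pos by (auto simp: cube_def x_def)
  have "emb ?w x = emb (app ?w (p m)) x" using affD[OF aff x] m1 by (simp add: one_nV)
  then have "x = emb (p m) x" by (simp add: emb_app emb_inj)
  moreover have "emb (p m) x 0 = (1 / 2) / 2 ^ m" for m
    by (induction m) (simp_all add: p_def emb_def x_def app_def digit_def)
  ultimately have "1 / 2 = (1 / 2 :: real) / 2 ^ m" by (metis x_def)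
  then have "(2::real) ^ m = 1" by (simp add: field_simps)
  then have "m = 0" using one_less_power[of "2::real" m] by (cases m) auto
  then show "i = 0" by (simp add: m_def)
qed

text \<open>The conjugation invariant set for \<open>almost_invariant_finite_or_cofinite\<close>. A
  fixed cell leaves room for an independent element supported there.\<close>

definition cell_fixers :: "((nat \<Rightarrow> real) \<Rightarrow> nat \<Rightarrow> real) set" where
  "cell_fixers = {t. infinite_order t \<and> (\<exists>w\<in>words. t \<in> fixing (cell w))}"

lemma transplant_shift_fixing:
  assumes "w \<in> words"
  shows "transplant w shift \<in> fixing (- cell w)"
  using assms transplant_in_nV shift_in_nV by (simp add: fixing_def transplant_outside)

lemma fixing_mono: "A \<subseteq> B \<Longrightarrow> fixing B \<subseteq> fixing A"
  by (auto simp: fixing_def)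

lemma transplant_shift_cell_fixers:
  assumes "w \<in> words" "v \<in> words" "incomp w v"
  shows "transplant w shift \<in> cell_fixers"
proof -
  have "cell v \<subseteq> - cell w" using cell_disjoint[OF assms(3)] by blast
  then have "transplant w shift \<in> fixing (cell v)"
    using transplant_shift_fixing[OF assms(1)] fixing_mono by blast
  then show ?thesis using infinite_order_transplant_shift assms by (auto simp: cell_fixers_def)
qed

lemma incomp_subwords:
  assumes "w \<in> words" "v \<in> words"
  shows "\<exists>a\<in>words. \<exists>b\<in>words. incomp (app w a) (app v b)"
proof -
  have n0: "n \<noteq> 0" using n_pos by simp
  define c where "c z = (\<lambda>k::nat. if k = 0 then z else ([]::bool list))" for z
  have cw: "c z \<in> words" for z using n0 by (simp add: c_def words_def)
  \<comment> \<open>Padding brings both words of coordinate 0 to length \<open>l + 1\<close> with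
    different last digits, even if one cell contains the other.\<close>
  define l where "l = length (w 0) + length (v 0)"
  let ?a = "c (replicate (l - length (w 0)) False @ [False])"
  let ?b = "c (replicate (l - length (v 0)) False @ [True])"
  have x: "app w ?a 0 = w 0 @ replicate (l - length (w 0)) False @ [False]"
    and y: "app v ?b 0 = v 0 @ replicate (l - length (v 0)) False @ [True]"
    by (simp_all add: app_def c_def)
  have len: "length (app w ?a 0) = length (app v ?b 0)" unfolding x y by (simp add: l_def)
  have "last (app w ?a 0) \<noteq> last (app v ?b 0)" unfolding x y by simp
  then have ne: "app w ?a 0 \<noteq> app v ?b 0" by metis
  have "\<not> prefix p q" if "length p = length q" "p \<noteq> q" for p q :: "bool list"
    using that by (auto simp: prefix_def)
  then have "app w ?a 0 \<parallel> app v ?b 0" using len ne by (intro parallelI) metis+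
  then have "incomp (app w ?a) (app v ?b)" by (auto simp: incomp_def)
  then show ?thesis using cw by blast
qed

text \<open>\<open>t\<close> and \<open>u\<close> may have overlapping supports, so each is linked
  to a shift inside a cell that it fixes; shrinking the cells makes the two shifts independent of
  each other.\<close>

lemma cell_fixers_chain:
  assumes "t \<in> cell_fixers" "u \<in> cell_fixers"
  shows "\<exists>t'\<in>cell_fixers. \<exists>u'\<in>cell_fixers. nV.independent t t' \<and> nV.independent t' u' \<and> nV.independent u' u"
proof -
  obtain w v where w: "w \<in> words" "t \<in> fixing (cell w)" and v: "v \<in> words" "u \<in> fixing (cell v)"
    using assms by (auto simp: cell_fixers_def)
  obtain a b where ab: "a \<in> words" "b \<in> words" "incomp (app w a) (app v b)"
    using incomp_subwords w v by blast
  let ?w = "app w a" and ?v = "app v b"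
  have wv: "?w \<in> words" "?v \<in> words" using app_words w v ab by blast+
  let ?t = "transplant ?w shift" and ?u = "transplant ?v shift"
  have tf: "t \<in> fixing (cell ?w)" and uf: "u \<in> fixing (cell ?v)"
    using w v ab fixing_mono[OF cell_app_subset] by blast+
  have io: "infinite_order t" "infinite_order u" using assms by (auto simp: cell_fixers_def)
  have "nV.independent t ?t"
    using independent_disjoint[OF tf transplant_shift_fixing[OF wv(1)] io(1)] infinite_order_transplant_shift wv by blast
  moreover have "nV.independent u ?u"
    using independent_disjoint[OF uf transplant_shift_fixing[OF wv(2)] io(2)] infinite_order_transplant_shift wv by blast
  moreover have "cell ?v \<subseteq> - cell ?w" using cell_disjoint[OF ab(3)] by blast
  then have "?t \<in> fixing (cell ?v)"
    using transplant_shift_fixing[OF wv(1)] fixing_mono by blast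
  then have "nV.independent ?t ?u"
    using independent_disjoint transplant_shift_fixing[OF wv(2)] infinite_order_transplant_shift wv by blast
  moreover have "?t \<in> cell_fixers" "?u \<in> cell_fixers" using transplant_shift_cell_fixers wv ab(3) incomp_sym by blast+
  ultimately show ?thesis using independent_commute by blast
qed

text \<open>The conjugate fixes the image of the cell under the inverse of \<open>g\<close>. This
  need not be a cell but contains one, because the inverse is affine deep inside.\<close>

lemma cell_fixers_conj:
  assumes t: "t \<in> cell_fixers" and g: "g \<in> carrier (nV n)"
  shows "inv\<^bsub>nV n\<^esub> g \<otimes>\<^bsub>nV n\<^esub> t \<otimes>\<^bsub>nV n\<^esub> g \<in> cell_fixers"
proof -
  let ?h = "inv\<^bsub>nV n\<^esub> g"
  obtain w where w: "w \<in> words" "t \<in> fixing (cell w)" and io: "infinite_order t"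
    using t by (auto simp: cell_fixers_def)
  have tG: "t \<in> carrier (nV n)" using w by (simp add: fixing_def carrier_nV)
  have hG: "?h \<in> nV_set n" using g by (simp flip: carrier_nV)
  have "infinite_order (?h \<otimes>\<^bsub>nV n\<^esub> t \<otimes>\<^bsub>nV n\<^esub> g)"
    unfolding infinite_order_def
  proof (intro allI impI)
    fix i :: int
    assume "(?h \<otimes>\<^bsub>nV n\<^esub> t \<otimes>\<^bsub>nV n\<^esub> g) [^]\<^bsub>nV n\<^esub> i = \<one>\<^bsub>nV n\<^esub>"
    then have "?h \<otimes>\<^bsub>nV n\<^esub> t [^]\<^bsub>nV n\<^esub> i \<otimes>\<^bsub>nV n\<^esub> g = \<one>\<^bsub>nV n\<^esub>"
      using nV.int_pow_conj[OF g tG] by simp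
    then have "g \<otimes>\<^bsub>nV n\<^esub> (?h \<otimes>\<^bsub>nV n\<^esub> t [^]\<^bsub>nV n\<^esub> i \<otimes>\<^bsub>nV n\<^esub> g) \<otimes>\<^bsub>nV n\<^esub> ?h = \<one>\<^bsub>nV n\<^esub>"
      using g by simp
    then have "t [^]\<^bsub>nV n\<^esub> i = \<one>\<^bsub>nV n\<^esub>"
      using g tG nV.conj_mult by (simp add: nV.m_assoc) (simp add: nV.m_assoc[symmetric])
    then show "i = 0" using io by (simp add: infinite_order_def)
  qed
  moreover obtain N where N: "\<And>z. z \<in> box (\<lambda>_. N) \<Longrightarrow> \<exists>v\<in>words. aff ?h z v"
    using nV_setD(3)[OF hG] by (auto simp: piecewise_affine_def)
  \<comment> \<open>\<open>N\<close> more digits in every coordinate put the word below a cell of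
    the grid on which the inverse of \<open>g\<close> is affine.\<close>
  define u where "u k = (if k < n then replicate N False else [])" for k
  have u: "u \<in> words" by (simp add: u_def words_def)
  define z where "z k = take N (app w u k)" for k
  define z' where "z' k = drop N (app w u k)" for k
  have zz: "app w u = app z z'"
    by (rule ext) (simp only: app_def[of z z'] z_def z'_def append_take_drop_id)
  have "z \<in> box (\<lambda>_. N)" "z' \<in> words"
    using w u by (auto simp: box_def words_def z_def z'_def app_def u_def)
  then obtain v where v: "v \<in> words" "aff ?h (app w u) v"
    using N[of z] aff_app app_words zz by metis
  have "?h \<otimes>\<^bsub>nV n\<^esub> t \<otimes>\<^bsub>nV n\<^esub> g \<in> fixing (cell v)"
  proof -
    have "?h \<otimes>\<^bsub>nV n\<^esub> t \<otimes>\<^bsub>nV n\<^esub> g \<in> nV_set n" using g tG by (simp flip: carrier_nV)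
    moreover have "(?h \<otimes>\<^bsub>nV n\<^esub> t \<otimes>\<^bsub>nV n\<^esub> g) y = y" if "y \<in> cell v" for y
    proof -
      obtain x where x: "x \<in> cell (app w u)" "y = ?h x" using aff_cell[OF v(2)] \<open>y \<in> cell v\<close> by blast
      have "g (?h x) = x" using nV.r_inv[OF g] by (metis comp_apply id_apply mult_nV one_nV)
      moreover have "t x = x" using w(2) x(1) cell_app_subset[OF u] by (auto simp: fixing_def)
      ultimately show ?thesis using x(2) by (simp add: mult_nV)
    qed
    ultimately show ?thesis by (simp add: fixing_def)
  qed
  ultimately show ?thesis using v(1) by (auto simp: cell_fixers_def)
qed

lemma cell_fixers_carrier: "cell_fixers \<subseteq> carrier (nV n)"
  by (auto simp: cell_fixers_def fixing_def carrier_nV)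

lemma cell_fixers_nonempty: "cell_fixers \<noteq> {}"
  using transplant_shift_cell_fixers[OF digit0(1) digit0(1) digit0(2)] by blast

lemma infinite_nV: "infinite (carrier (nV n))"
proof
  assume fin: "finite (carrier (nV n))"
  obtain t where t: "t \<in> cell_fixers" using cell_fixers_nonempty by blast
  then have tG: "t \<in> carrier (nV n)" using cell_fixers_carrier by blast
  have "inj (\<lambda>i::int. t [^]\<^bsub>nV n\<^esub> i)"
  proof (rule injI)
    fix i j :: int assume "t [^]\<^bsub>nV n\<^esub> i = t [^]\<^bsub>nV n\<^esub> j"
    then have "t [^]\<^bsub>nV n\<^esub> (i - j) = \<one>\<^bsub>nV n\<^esub>" using tG by (simp add: nV.int_pow_diff)
    then have "i - j = 0" using t unfolding cell_fixers_def infinite_order_def by blast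
    then show "i = j" by simp
  qed
  moreover have "range (\<lambda>i::int. t [^]\<^bsub>nV n\<^esub> i) \<subseteq> carrier (nV n)" using tG by auto
  ultimately show False using fin by (meson finite_subset finite_imageD infinite_UNIV_int)
qed

lemma num_ends_nV: "finite_generating_set (nV n) S \<Longrightarrow> num_ends (nV n) S = 1"
  using nV.num_ends_eq_1 infinite_nV nV.almost_invariant_finite_or_cofinite
    cell_fixers_carrier cell_fixers_nonempty cell_fixers_conj cell_fixers_chain
  by blast

end

theorem theorem4p6:
  fixes n :: nat
  assumes "n \<ge> 1"
  shows "property_FA (nV n) TYPE('v)
         \<and> (\<forall>S. finite_generating_set (nV n) S \<longrightarrow> num_ends (nV n) S = 1)"
proof -
  interpret brin_thompson n by unfold_locales (rule assms)
  show ?thesis using FA_nV num_ends_nV by blast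
qed

end
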